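(* Let $D$ be a good successively $k$-almost positive diagram for some $k\ge 0$. Then $D$ represents a split link if and only if the diagram $D$ is split.
   Context: Links are oriented links in $S^3$. A knot (or link) diagram $D$ is successively $k$-almost positive ($k\geq 0$) if all but $k$ crossings of $D$ are positive, and the $k$ negative crossings appear successively along a single overarc, i.e. there is an arc of the diagram (a sub-arc of one component) that passes consecutively through exactly the $k$ negative crossings, always as the overstrand. Such a diagram is good if, whenever two distinct Seifert circles $s,s'$ of $D$ are connected by a negative crossing, there are no other crossings connecting $s$ and $s'$. A diagram is split if it is disconnected as a subset of the plane (sphere). *)

theory Defs
  imports "HOL-Analysis.Analysis"
begin

text \<open>
  The projection plane is \<^typ>\<open>complex\<close>, and Euclidean 3-space is \<^typ>\<open>complex \<times> real\<close>, where the
  second coordinate is the height above the plane. An oriented circle is \<open>\<real>/\<int>\<close>, oriented by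
  increasing parameter: closed curves are 1-periodic functions on the reals, and \<open>(i, t)\<close> with
  \<open>0 \<le> t < 1\<close> names a point of the \<open>i\<close>-th circle.
\<close>

record 'a closed_curves =
  ncomps :: nat
  curve :: "nat \<Rightarrow> real \<Rightarrow> 'a"

definition params :: "('a, 'b) closed_curves_scheme \<Rightarrow> (nat \<times> real) set" where
  "params K = {..<ncomps K} \<times> {0..<1}"

definition pos :: "('a, 'b) closed_curves_scheme \<Rightarrow> nat \<times> real \<Rightarrow> 'a" where
  "pos K = (\<lambda>(i, t). curve K i t)"

definition vel :: "('a::real_normed_vector, 'b) closed_curves_scheme \<Rightarrow> nat \<times> real \<Rightarrow> 'a" where
  "vel K = (\<lambda>(i, t). vector_derivative (curve K i) (at t))"

definition trace :: "('a, 'b) closed_curves_scheme \<Rightarrow> 'a set" where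
  "trace K = (\<Union>i<ncomps K. range (curve K i))"

definition immersed_curves :: "('a::real_normed_vector, 'b) closed_curves_scheme \<Rightarrow> bool" where
  "immersed_curves K \<longleftrightarrow> (\<forall>i<ncomps K.
     curve K i C1_differentiable_on UNIV \<and>
     (\<forall>t. curve K i (t + 1) = curve K i t) \<and>
     (\<forall>t. vector_derivative (curve K i) (at t) \<noteq> 0))"


subsection \<open>Oriented links in the 3-sphere\<close>

definition S3 :: "((complex \<times> real) \<times> real) set" where
  "S3 = sphere 0 1"

definition inverse_stereographic :: "complex \<times> real \<Rightarrow> (complex \<times> real) \<times> real" where
  "inverse_stereographic x =
     ((2 / ((norm x)\<^sup>2 + 1)) *\<^sub>R x, ((norm x)\<^sup>2 - 1) / ((norm x)\<^sup>2 + 1))"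

definition oriented_link :: "((complex \<times> real) \<times> real) closed_curves \<Rightarrow> bool" where
  "oriented_link L \<longleftrightarrow> immersed_curves L \<and> trace L \<subseteq> S3 \<and> inj_on (pos L) (params L)"

text \<open>The bicollar makes the embedded sphere \<open>S\<close> tame (locally flat).\<close>

definition tame_2sphere :: "((complex \<times> real) \<times> real) set \<Rightarrow> bool" where
  "tame_2sphere S \<longleftrightarrow> (\<exists>e :: (complex \<times> real) \<times> real \<Rightarrow> (complex \<times> real) \<times> real.
     continuous_on (sphere 0 1 \<times> {-1..1}) e \<and> inj_on e (sphere 0 1 \<times> {-1..1}) \<and>
     e ` (sphere 0 1 \<times> {-1..1}) \<subseteq> S3 \<and> S = e ` (sphere 0 1 \<times> {0}))"

definition split_link :: "((complex \<times> real) \<times> real) closed_curves \<Rightarrow> bool" where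
  "split_link L \<longleftrightarrow> (\<exists>S. tame_2sphere S \<and> S \<inter> trace L = {} \<and>
     (\<exists>x\<in>trace L. \<exists>y\<in>trace L. \<not> connected_component (S3 - S) x y))"


subsection \<open>Link diagrams\<close>

text \<open>
  \<open>overs\<close> consists of those parameters at which the curves run through a crossing as the overstrand.
\<close>

record link_diagram = "complex closed_curves" +
  overs :: "(nat \<times> real) set"

definition double_pair :: "link_diagram \<Rightarrow> nat \<times> real \<Rightarrow> nat \<times> real \<Rightarrow> bool" where
  "double_pair D p q \<longleftrightarrow> p \<in> params D \<and> q \<in> params D \<and> p \<noteq> q \<and> pos D p = pos D q"

definition passages :: "link_diagram \<Rightarrow> (nat \<times> real) set" where
  "passages D = {p. \<exists>q. double_pair D p q}"

definition plane_det :: "complex \<Rightarrow> complex \<Rightarrow> real" where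
  "plane_det z w = Re z * Im w - Im z * Re w"

definition is_link_diagram :: "link_diagram \<Rightarrow> bool" where
  "is_link_diagram D \<longleftrightarrow>
     immersed_curves D \<and>
     finite (passages D) \<and>
     (\<forall>p q r. double_pair D p q \<and> double_pair D p r \<longrightarrow> q = r) \<and>
     (\<forall>p q. double_pair D p q \<longrightarrow> plane_det (vel D p) (vel D q) \<noteq> 0) \<and>
     overs D \<subseteq> passages D \<and>
     (\<forall>p q. double_pair D p q \<longrightarrow> (p \<in> overs D \<longleftrightarrow> q \<notin> overs D))"

text \<open>A crossing is the pair of its preimages, the one on the overstrand first.\<close>

definition crossings :: "link_diagram \<Rightarrow> ((nat \<times> real) \<times> (nat \<times> real)) set" where
  "crossings D = {(p, q). double_pair D p q \<and> p \<in> overs D}"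

text \<open>
  At a positive crossing the direction of the overstrand is turned counterclockwise, by an angle
  less than \<open>\<pi>\<close>, to the direction of the understrand.
\<close>

definition crossing_sign :: "link_diagram \<Rightarrow> (nat \<times> real) \<times> (nat \<times> real) \<Rightarrow> real" where
  "crossing_sign D = (\<lambda>(p, q). sgn (plane_det (vel D p) (vel D q)))"

definition negative_crossings :: "link_diagram \<Rightarrow> ((nat \<times> real) \<times> (nat \<times> real)) set" where
  "negative_crossings D = {c \<in> crossings D. crossing_sign D c = -1}"

definition split_diagram :: "link_diagram \<Rightarrow> bool" where
  "split_diagram D \<longleftrightarrow> \<not> connected (trace D)"

text \<open>
  \<open>D\<close> represents the links in \<open>\<real>\<^sup>3 \<subseteq> S\<^sup>3\<close> which project to \<open>D\<close> with the prescribed over/under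
  information; \<open>h\<close> is the height function of such a link.
\<close>

definition represents :: "link_diagram \<Rightarrow> ((complex \<times> real) \<times> real) closed_curves \<Rightarrow> bool" where
  "represents D L \<longleftrightarrow> oriented_link L \<and> ncomps L = ncomps D \<and>
     (\<exists>h. (\<forall>i<ncomps D. \<forall>t. curve L i t = inverse_stereographic (curve D i t, h i t)) \<and>
          (\<forall>((i, s), (j, t)) \<in> crossings D. h i s > h j t))"


subsection \<open>Successively almost positive diagrams\<close>

text \<open>
  The subarc of the \<open>i\<close>-th component is the image of \<open>{a..b}\<close>; \<open>b < a + 1\<close> makes it a proper
  subarc. Requiring that its passages through crossings are exactly the overpassages of the
  negative crossings excludes both positive crossings and underpassages on it.
\<close>

definition successively_almost_positive :: "nat \<Rightarrow> link_diagram \<Rightarrow> bool" where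
  "successively_almost_positive k D \<longleftrightarrow>
     (\<forall>c \<in> crossings D - negative_crossings D. crossing_sign D c = 1) \<and>
     card (negative_crossings D) = k \<and>
     (\<exists>i<ncomps D. \<exists>a b. a \<le> b \<and> b < a + 1 \<and>
        {p \<in> passages D. \<exists>u\<in>{a..b}. p = (i, frac u)} = fst ` negative_crossings D)"


subsection \<open>Seifert circles and good diagrams\<close>

text \<open>
  Smoothing all crossings according to the orientation does not move the points of the diagram away
  from the crossings, so a Seifert circle is recorded as the set of these regular points (as
  parameters) which lie on it. Two regular points lie on the same Seifert circle iff they are related
  by the equivalence generated by moving along a component without meeting a crossing, and by
  running into a crossing along one strand and leaving it along the other strand.
\<close>

definition regular_params :: "link_diagram \<Rightarrow> (nat \<times> real) set" where
  "regular_params D = params D - passages D"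

inductive seifert_step :: "link_diagram \<Rightarrow> nat \<times> real \<Rightarrow> nat \<times> real \<Rightarrow> bool" for D where
  along: "a \<le> b \<Longrightarrow> (\<And>u. u \<in> {a..b} \<Longrightarrow> (i, frac u) \<in> regular_params D)
    \<Longrightarrow> seifert_step D (i, frac a) (i, frac b)"
| smoothing: "double_pair D (i, s) (j, t) \<Longrightarrow> a < s \<Longrightarrow> t < b
    \<Longrightarrow> (\<And>u. u \<in> {a..<s} \<Longrightarrow> (i, frac u) \<in> regular_params D)
    \<Longrightarrow> (\<And>u. u \<in> {t<..b} \<Longrightarrow> (j, frac u) \<in> regular_params D)
    \<Longrightarrow> seifert_step D (i, frac a) (j, frac b)"

definition seifert_circles :: "link_diagram \<Rightarrow> (nat \<times> real) set set" where
  "seifert_circles D = regular_params D //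
     {(x, y). x \<in> regular_params D \<and> y \<in> regular_params D \<and> equivclp (seifert_step D) x y}"

text \<open>
  The two Seifert circle segments at a crossing are the ones containing the diagram just before
  the overpassage and just before the underpassage, respectively.
\<close>

definition enters :: "(nat \<times> real) set \<Rightarrow> nat \<times> real \<Rightarrow> bool" where
  "enters C = (\<lambda>(i, t). \<forall>\<^sub>F u in at_left t. (i, frac u) \<in> C)"

definition connects ::
    "(nat \<times> real) \<times> (nat \<times> real) \<Rightarrow> (nat \<times> real) set \<Rightarrow> (nat \<times> real) set \<Rightarrow> bool" where
  "connects = (\<lambda>(p, q) C C'. enters C p \<and> enters C' q \<or> enters C' p \<and> enters C q)"

definition good_diagram :: "link_diagram \<Rightarrow> bool" where
  "good_diagram D \<longleftrightarrow> (\<forall>C \<in> seifert_circles D. \<forall>C' \<in> seifert_circles D. C \<noteq> C' \<longrightarrow>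
     (\<forall>c \<in> negative_crossings D. connects c C C' \<longrightarrow>
        (\<forall>c' \<in> crossings D. connects c' C C' \<longrightarrow> c' = c)))"

end

theory Submission
  imports Defs "HOL-Complex_Analysis.Complex_Analysis"
begin

text \<open>
  A split diagram represents a split link: put the part of the diagram in one closed set above the
  equator and the rest below it.

  Conversely, let a 2-sphere separate two components of a link with diagram \<open>D\<close>. The holonomy of a spin
  frame along a closed curve \<open>\<gamma>\<close>, whose argument is half the solid angle of \<open>\<gamma>\<close> seen from \<open>x\<close>, is a
  nonvanishing function of \<open>x\<close> off \<open>\<gamma>\<close>. As the sphere without the point at infinity is Borsukian, the
  part of this function on the side of the sphere opposite to \<open>\<gamma>\<close> has a continuous logarithm, so its
  argument does not change along a component there; but each positive crossing of that component
  under \<open>\<gamma>\<close> contributes a full turn. Hence a component without negative overpassages never passes over one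
  on the other side of the sphere. Since only one component has negative overpassages, all
  crossings between the two sides have their understrand in the same part \<open>B\<close> of the diagram.

  The smoothed Seifert circles and the winding number of \<open>B\<close> next to them then show that the mixed crossings
  of either sign along a Seifert circle balance. Starting with a mixed negative crossing this leads to a
  mixed positive one and back to a negative one, which must be the same since the winding number of \<open>D\<close>
  is monotone along the overarc; so the positive crossing connects the same two Seifert circles,
  contrary to goodness. There are no mixed crossings, hence \<open>B\<close> and its complement are disjoint.
\<close>

subsection \<open>Jumps of winding numbers\<close>

text \<open>Up to sign, half the solid angle of \<open>b\<close> changes along \<open>a\<close> by 2
  pi times the linking number, which is the signed number of crossings where \<open>b\<close> passes
  over \<open>a\<close>. If \<open>b\<close> has no negative overpassages this is a plain count, so
  a vanishing linking number excludes each such crossing. The holonomy gives the vanishing without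
  homology: of the separating sphere it takes only that nonvanishing complex functions on it have
  logarithms. Since a solid angle is multivalued and has no closed formula for a general curve, the
  curve is replaced by an inscribed polygon with sides short compared with their distance from
  \<open>x\<close>; the logarithm of its explicit holonomy is compared with a sum of explicit
  branches, one per side. Seifert circles are only sets of parameters here, so no nesting or Jordan
  curve argument is made with them. Winding numbers take its place: that of \<open>D\<close> on the
  left of a strand is constant along a Seifert circle, differs by one between the two circles at a
  crossing, and rises by one at each negative overpassage, so that it identifies a negative
  crossing.\<close>

lemma plane_det_eq_Im: "plane_det z w = Im (cnj z * w)"
  by (simp add: plane_det_def)

lemma plane_det_add_left: "plane_det (x + y) z = plane_det x z + plane_det y z"
  and plane_det_add_right: "plane_det z (x + y) = plane_det z x + plane_det z y"
  and plane_det_scaleR_left: "plane_det (r *\<^sub>R x) z = r * plane_det x z"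
  and plane_det_scaleR_right: "plane_det z (r *\<^sub>R x) = r * plane_det z x"
  and plane_det_self: "plane_det x x = 0"
  by (simp_all add: plane_det_def algebra_simps)

lemma plane_det_commute: "plane_det z w = - plane_det w z"
  by (simp add: plane_det_def)

lemma plane_det_minus_right: "plane_det z (- x) = - plane_det z x"
  by (simp add: plane_det_def)

lemma plane_det_ii: "plane_det z (\<i> * z) = (norm z)\<^sup>2"
  unfolding cmod_power2 by (simp add: plane_det_def power2_eq_square)

lemma abs_plane_det_le: "\<bar>plane_det z w\<bar> \<le> norm z * norm w"
  using abs_Im_le_cmod[of "cnj z * w"] by (simp add: plane_det_eq_Im norm_mult)

text \<open>Cramer's rule: pairing the combination with \<open>u\<close> or with \<open>v\<close>
  isolates one coefficient. This makes transversality quantitative.\<close>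

lemma norm_lincomb_ge:
  "(\<bar>a\<bar> + \<bar>b\<bar>) * \<bar>plane_det v u\<bar> \<le> norm (a *\<^sub>R v + b *\<^sub>R u) * (norm v + norm u)"
proof -
  let ?z = "a *\<^sub>R v + b *\<^sub>R u"
  have "plane_det ?z u = a * plane_det v u" "plane_det v ?z = b * plane_det v u"
    by (simp_all add: plane_det_def algebra_simps)
  then have "\<bar>a\<bar> * \<bar>plane_det v u\<bar> \<le> norm ?z * norm u" "\<bar>b\<bar> * \<bar>plane_det v u\<bar> \<le> norm v * norm ?z"
    by (metis abs_mult abs_plane_det_le)+
  then show ?thesis by (simp add: algebra_simps)
qed

section \<open>Differentiable curves and the change of a logarithm along an arc\<close>

lemma C1_has_vector_derivative:
  "c C1_differentiable_on UNIV \<Longrightarrow> (c has_vector_derivative vector_derivative c (at t)) (at t)"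
  by (auto simp: C1_differentiable_on_eq vector_derivative_works)

lemma C1_continuous_derivative:
  "c C1_differentiable_on UNIV \<Longrightarrow> continuous_on A (\<lambda>t. vector_derivative c (at t))"
  using C1_differentiable_on_eq continuous_on_subset by blast

lemma C1_continuous_on:
  "c C1_differentiable_on UNIV \<Longrightarrow> continuous_on A c"
  using C1_differentiable_imp_continuous_on continuous_on_subset by blast

text \<open>The mean value inequality for \<open>c t - t *\<^sub>R c'(t0)\<close>. Both
  \<open>t\<close> and \<open>t'\<close> may move, as is needed to compare points of a strand near,
  but not at, the base point.\<close>

lemma C1_strict_derivative:
  fixes c :: "real \<Rightarrow> complex"
  assumes c: "c C1_differentiable_on UNIV" and "\<kappa> > 0"
  obtains \<eta> where "\<eta> > 0"
    "\<And>t t'. \<bar>t - t0\<bar> \<le> \<eta> \<Longrightarrow> \<bar>t' - t0\<bar> \<le> \<eta> \<Longrightarrow>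
       norm (c t - c t' - (t - t') *\<^sub>R vector_derivative c (at t0)) \<le> \<kappa> * \<bar>t - t'\<bar>"
proof -
  let ?v = "\<lambda>t. vector_derivative c (at t)"
  have "isCont ?v t0"
    using C1_continuous_derivative[OF c, of UNIV] by (simp add: continuous_on_eq_continuous_at)
  then obtain d where d: "d > 0" "\<And>t. \<bar>t - t0\<bar> < d \<Longrightarrow> norm (?v t - ?v t0) < \<kappa>"
    using \<open>\<kappa> > 0\<close> unfolding continuous_at_eps_delta by (metis dist_norm real_norm_def)
  let ?S = "{t0 - d/2..t0 + d/2}"
  have *: "norm ((c t - t *\<^sub>R ?v t0) - (c t' - t' *\<^sub>R ?v t0)) \<le> \<kappa> * norm (t - t')"
    if "t \<in> ?S" "t' \<in> ?S" for t t'
  proof (rule differentiable_bound[where S = ?S and f' = "\<lambda>x h. h *\<^sub>R (?v x - ?v t0)"])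
    fix x assume x: "x \<in> ?S"
    have "(c has_derivative (\<lambda>h. h *\<^sub>R ?v x)) (at x within ?S)"
      using C1_has_vector_derivative[OF c, of x]
      by (simp add: has_vector_derivative_def has_derivative_at_withinI)
    then show "((\<lambda>t. c t - t *\<^sub>R ?v t0) has_derivative (\<lambda>h. h *\<^sub>R (?v x - ?v t0))) (at x within ?S)"
      by (auto intro!: derivative_eq_intros simp: algebra_simps)
    have "\<bar>x - t0\<bar> < d" using x \<open>d > 0\<close> by (auto simp: abs_if)
    then have "norm (?v x - ?v t0) < \<kappa>" by (rule d)
    then show "onorm (\<lambda>h. h *\<^sub>R (?v x - ?v t0)) \<le> \<kappa>"
      by (intro onorm_le) (simp add: mult.commute[of \<kappa>] mult_left_mono)
  qed (use that in auto)
  show ?thesis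
  proof (rule that[of "d/2"])
    fix t t' assume "\<bar>t - t0\<bar> \<le> d/2" "\<bar>t' - t0\<bar> \<le> d/2"
    then have "t \<in> ?S" "t' \<in> ?S" by (auto simp: abs_if split: if_splits)
    from *[OF this] show "norm (c t - c t' - (t - t') *\<^sub>R ?v t0) \<le> \<kappa> * \<bar>t - t'\<bar>"
      by (simp add: algebra_simps)
  qed (use d in auto)
qed

text \<open>The integral of \<open>dz / (z - w)\<close> along the arc. Unlike a winding number it
  makes sense for open arcs, so that the piece of a curve near a crossing can be split off.\<close>

definition log_change :: "(real \<Rightarrow> complex) \<Rightarrow> real \<Rightarrow> real \<Rightarrow> complex \<Rightarrow> complex" where
  "log_change c a b w = integral {a..b} (\<lambda>t. vector_derivative c (at t) / (c t - w))"

lemma log_change_integrable: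
  fixes c :: "real \<Rightarrow> complex"
  assumes c: "c C1_differentiable_on UNIV" and w: "w \<notin> c ` {a..b}"
  shows "(\<lambda>t. vector_derivative c (at t) / (c t - w)) integrable_on {a..b}"
proof (rule integrable_continuous_interval)
  have "continuous_on {a..b} (\<lambda>t. c t - w)"
    by (intro continuous_intros C1_continuous_on[OF c])
  then show "continuous_on {a..b} (\<lambda>t. vector_derivative c (at t) / (c t - w))"
    using w by (intro continuous_on_divide C1_continuous_derivative[OF c]) auto
qed

lemma log_change_combine:
  assumes "c C1_differentiable_on UNIV" "a \<le> b" "b \<le> d" "w \<notin> c ` {a..d}"
  shows "log_change c a d w = log_change c a b w + log_change c b d w"
  using Henstock_Kurzweil_Integration.integral_combine[OF assms(2,3) log_change_integrable[OF assms(1,4)]]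
  by (simp add: log_change_def)

lemma exp_log_change:
  assumes c: "c C1_differentiable_on UNIV" and "a \<le> b" and w: "w \<notin> c ` {a..b}"
  shows "exp (log_change c a b w) = (c b - w) / (c a - w)"
proof -
  have "c piecewise_C1_differentiable_on {a..b}"
    using c C1_differentiable_imp_piecewise C1_differentiable_on_subset by blast
  from winding_number_exp_integral(2)[OF this \<open>a \<le> b\<close> w]
  have "exp (- log_change c a b w) * (c b - w) = c a - w"
    by (simp add: log_change_def)
  moreover have "c a - w \<noteq> 0" using w \<open>a \<le> b\<close> by auto
  ultimately show ?thesis by (simp add: exp_minus field_simps)
qed

text \<open>Dividing by \<open>k\<close> turns the branch cut of \<open>Ln\<close> into a ray of
  choice, which \<open>c - w\<close> has to avoid.\<close>

lemma log_change_eq_Ln: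
  assumes c: "c C1_differentiable_on UNIV" and "a \<le> b" "k \<noteq> 0"
    and ns: "\<And>t. t \<in> {a..b} \<Longrightarrow> (c t - w) / k \<notin> \<real>\<^sub>\<le>\<^sub>0"
  shows "log_change c a b w = Ln ((c b - w) / k) - Ln ((c a - w) / k)"
proof -
  have "((\<lambda>t. vector_derivative c (at t) / (c t - w)) has_integral
          (Ln ((c b - w) / k) - Ln ((c a - w) / k))) {a..b}"
  proof (rule fundamental_theorem_of_calculus[OF \<open>a \<le> b\<close>])
    fix t assume t: "t \<in> {a..b}"
    have "((\<lambda>t. (c t - w) / k) has_vector_derivative vector_derivative c (at t) / k) (at t within {a..b})"
      using has_vector_derivative_at_within[OF C1_has_vector_derivative[OF c, of t], of "{a..b}"]
      by (auto intro!: derivative_eq_intros)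
    from field_vector_diff_chain_within[OF this has_field_derivative_at_within[OF has_field_derivative_Ln[OF ns[OF t]]]]
    have "(Ln \<circ> (\<lambda>t. (c t - w) / k) has_vector_derivative
       vector_derivative c (at t) / k * inverse ((c t - w) / k)) (at t within {a..b})" .
    then show "((\<lambda>t. Ln ((c t - w) / k)) has_vector_derivative vector_derivative c (at t) / (c t - w)) (at t within {a..b})"
      using \<open>k \<noteq> 0\<close> by (simp add: o_def)
  qed
  then show ?thesis by (simp add: log_change_def integral_unique)
qed

lemma isCont_log_change:
  assumes c: "c C1_differentiable_on UNIV" and w0: "w0 \<notin> c ` {a..b}"
  shows "isCont (log_change c a b) w0"
proof -
  have "closed (c ` {a..b})"
    by (intro compact_imp_closed compact_continuous_image C1_continuous_on[OF c]) auto
  then obtain e where e: "e > 0" "ball w0 e \<inter> c ` {a..b} = {}"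
    using w0 open_Compl[of "c ` {a..b}"] unfolding open_contains_ball disjoint_eq_subset_Compl
    by (metis ComplI)
  have "continuous_on (ball w0 e) (\<lambda>w. integral (cbox a b) (\<lambda>t. vector_derivative c (at t) / (c t - w)))"
  proof (rule integral_continuous_on_param)
    have "continuous_on (ball w0 e \<times> cbox a b) (\<lambda>x. vector_derivative c (at (snd x)) / (c (snd x) - fst x))"
    proof (intro continuous_on_divide)
      show "continuous_on (ball w0 e \<times> cbox a b) (\<lambda>x. vector_derivative c (at (snd x)))"
        by (rule continuous_on_compose2[OF C1_continuous_derivative[OF c, of UNIV]]) (auto intro!: continuous_intros)
      show "continuous_on (ball w0 e \<times> cbox a b) (\<lambda>x. c (snd x) - fst x)"
        by (intro continuous_intros continuous_on_compose2[OF C1_continuous_on[OF c, of UNIV]]) auto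
    qed (use e(2) in force)
    then show "continuous_on (ball w0 e \<times> cbox a b) (\<lambda>(w, t). vector_derivative c (at t) / (c t - w))"
      by (simp add: case_prod_unfold)
  qed
  then have "continuous_on (ball w0 e) (log_change c a b)"
    by (simp add: log_change_def)
  then show ?thesis
    using e(1) by (simp add: continuous_on_eq_continuous_at)
qed

lemma Ln_minus_cases:
  shows "Im z > 0 \<Longrightarrow> Ln (- z) = Ln z - \<i> * pi" and "Im z < 0 \<Longrightarrow> Ln (- z) = Ln z + \<i> * pi"
  by (subst Ln_minus; force)+

text \<open>
  On either side of \<open>s0\<close> the point \<open>y s\<close> lies off the arc in a sector around \<open>\<plusminus> y'(s0)\<close>, so that
  \<open>c - y s\<close> avoids a ray and the integral is a difference of logarithms; the two branches differ by
  a half turn at each end of the arc.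
\<close>

lemma log_change_jump:
  assumes c: "c C1_differentiable_on UNIV" and y: "(y has_vector_derivative u) (at s0)"
    and eq: "c t0 = y s0" and v: "v = vector_derivative c (at t0)" and det: "plane_det v u \<noteq> 0"
  obtains \<eta>0 where "\<eta>0 > 0"
    "\<And>\<eta>. 0 < \<eta> \<Longrightarrow> \<eta> \<le> \<eta>0 \<Longrightarrow> \<exists>Lm Lp.
       ((\<lambda>s. log_change c (t0 - \<eta>) (t0 + \<eta>) (y s)) \<longlongrightarrow> Lm) (at_left s0) \<and>
       ((\<lambda>s. log_change c (t0 - \<eta>) (t0 + \<eta>) (y s)) \<longlongrightarrow> Lp) (at_right s0) \<and>
       Lp - Lm = of_real (2 * pi * sgn (plane_det v u)) * \<i>"
proof -
  have vu: "v \<noteq> 0" "u \<noteq> 0" using det by (auto simp: plane_det_def)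
  define m where "m = \<bar>plane_det v u\<bar> / (norm v + norm u)"
  have m: "m > 0" using det vu by (simp add: m_def add_pos_pos)
  have ge: "(\<bar>a\<bar> + \<bar>b\<bar>) * m \<le> norm (a *\<^sub>R v + b *\<^sub>R u)" for a b
    using norm_lincomb_ge[of a b v u] vu by (simp add: m_def field_simps add_pos_pos)
  \<comment> \<open>\<open>m\<close> measures the transversality of \<open>u\<close> and
    \<open>v\<close>. With errors below \<open>m\<close> relative to the tangent lines the two
    curves cannot make up for the divergence of these lines.\<close>
  define \<kappa> where "\<kappa> = m / 2"
  have \<kappa>: "\<kappa> > 0" "\<kappa> < m" using m by (simp_all add: \<kappa>_def)
  have \<kappa>u: "\<kappa> * norm u < \<bar>plane_det v u\<bar>"
  proof -
    have "m * norm u \<le> \<bar>plane_det v u\<bar>"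
      using vu by (simp add: m_def field_simps add_pos_pos mult_left_mono)
    then show ?thesis using vu m by (simp add: \<kappa>_def) (smt (verit) mult_pos_pos zero_less_norm_iff)
  qed
  obtain \<eta>0 where \<eta>0: "\<eta>0 > 0"
    "\<And>t t'. \<bar>t - t0\<bar> \<le> \<eta>0 \<Longrightarrow> \<bar>t' - t0\<bar> \<le> \<eta>0 \<Longrightarrow> norm (c t - c t' - (t - t') *\<^sub>R v) \<le> \<kappa> * \<bar>t - t'\<bar>"
    using C1_strict_derivative[OF c \<kappa>(1), of t0] v by metis
  have "\<forall>\<^sub>F s in at s0. norm (y s - y s0 - (s - s0) *\<^sub>R u) \<le> \<kappa> * \<bar>s - s0\<bar>"
    using y \<kappa>(1) unfolding has_vector_derivative_def has_derivative_at_alt eventually_at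
    by (metis real_norm_def dist_norm)
  then have ev: "\<forall>\<^sub>F s in at s0. s \<noteq> s0 \<and> norm (y s - y s0 - (s - s0) *\<^sub>R u) \<le> \<kappa> * \<bar>s - s0\<bar>"
    by (simp add: eventually_conj_iff eventually_neq_at_within)
  \<comment> \<open>The cut is the ray from \<open>y s\<close> in the direction
    \<open>\<sigma> * u\<close>, which points away from the common point
    \<open>c t0\<close>.\<close>
  have avoid: "(c t - y s) / (- of_real \<sigma> * u) \<notin> \<real>\<^sub>\<le>\<^sub>0"
    if t: "\<bar>t - t0\<bar> \<le> \<eta>0" and s: "s \<noteq> s0" "norm (y s - y s0 - (s - s0) *\<^sub>R u) \<le> \<kappa> * \<bar>s - s0\<bar>"
      and \<sigma>: "\<sigma> = sgn (s - s0)" for s t \<sigma>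
  proof
    assume "(c t - y s) / (- of_real \<sigma> * u) \<in> \<real>\<^sub>\<le>\<^sub>0"
    then obtain r where r: "r \<le> 0" "(c t - y s) / (- of_real \<sigma> * u) = of_real r"
      using nonpos_Reals_cases by blast
    have \<sigma>0: "\<sigma> \<noteq> 0" "\<bar>\<sigma>\<bar> = 1" using \<sigma> s by (auto simp: sgn_if)
    have e: "c t - y s = (- r * \<sigma>) *\<^sub>R u"
      using r \<sigma>0 vu by (simp add: divide_simps scaleR_conv_of_real mult_ac) (simp add: algebra_simps)
    have "(t - t0) *\<^sub>R v + (- (s - s0) + r * \<sigma>) *\<^sub>R u
        = (y s - y s0 - (s - s0) *\<^sub>R u) - (c t - c t0 - (t - t0) *\<^sub>R v)"
      using e eq by (simp add: algebra_simps)
    then have "norm ((t - t0) *\<^sub>R v + (- (s - s0) + r * \<sigma>) *\<^sub>R u) \<le> \<kappa> * \<bar>s - s0\<bar> + \<kappa> * \<bar>t - t0\<bar>"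
      using norm_triangle_ineq4 \<eta>0(2)[OF t, of t0] \<eta>0(1) s(2) by (smt (verit))
    with ge[of "t - t0" "- (s - s0) + r * \<sigma>"]
    have "(\<bar>t - t0\<bar> + \<bar>- (s - s0) + r * \<sigma>\<bar>) * m \<le> \<kappa> * (\<bar>s - s0\<bar> + \<bar>t - t0\<bar>)"
      by (simp add: algebra_simps)
    moreover have "\<bar>- (s - s0) + r * \<sigma>\<bar> \<ge> \<bar>s - s0\<bar>"
      using r(1) \<sigma> by (auto simp: sgn_if)
    moreover have "\<kappa> * (\<bar>s - s0\<bar> + \<bar>t - t0\<bar>) < m * (\<bar>s - s0\<bar> + \<bar>t - t0\<bar>)"
      using \<kappa> s(1) by (intro mult_strict_right_mono) auto
    ultimately show False
      using m by (smt (verit) mult.commute mult_left_mono)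
  qed
  show ?thesis
  proof (rule that[OF \<eta>0(1)])
    fix \<eta> :: real assume \<eta>: "0 < \<eta>" "\<eta> \<le> \<eta>0"
    define A B where "A = (c (t0 + \<eta>) - y s0) / u" and "B = (c (t0 - \<eta>) - y s0) / u"
    have Imdiv: "Im (z / u) = - plane_det z u / (norm u)\<^sup>2" for z
      by (simp add: Im_divide plane_det_def cmod_power2 algebra_simps)
    have small: "\<bar>plane_det e u\<bar> < \<eta> * \<bar>plane_det v u\<bar>" if "norm e \<le> \<kappa> * \<eta>" for e
    proof -
      have "\<bar>plane_det e u\<bar> \<le> norm e * norm u" by (rule abs_plane_det_le)
      also have "\<dots> \<le> \<eta> * (\<kappa> * norm u)" using that mult_right_mono[OF that, of "norm u"] by (simp add: mult_ac)
      also have "\<dots> < \<eta> * \<bar>plane_det v u\<bar>" using \<kappa>u \<eta> by simp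
      finally show ?thesis .
    qed
    have dA: "plane_det (c (t0 + \<eta>) - y s0) u = \<eta> * plane_det v u + plane_det (c (t0 + \<eta>) - c t0 - \<eta> *\<^sub>R v) u"
      and dB: "plane_det (c (t0 - \<eta>) - y s0) u = - \<eta> * plane_det v u + plane_det (c (t0 - \<eta>) - c t0 + \<eta> *\<^sub>R v) u"
      using eq by (simp_all add: plane_det_def algebra_simps)
    have eA: "norm (c (t0 + \<eta>) - c t0 - \<eta> *\<^sub>R v) \<le> \<kappa> * \<eta>"
      and eB: "norm (c (t0 - \<eta>) - c t0 + \<eta> *\<^sub>R v) \<le> \<kappa> * \<eta>"
      using \<eta>0(2)[of "t0 + \<eta>" t0] \<eta>0(2)[of "t0 - \<eta>" t0] \<eta> by auto
    \<comment> \<open>The two ends of the arc lie on opposite sides of the line through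
      \<open>y s0\<close> in the direction \<open>u\<close>; only these signs decide how the
      branches \<open>Ln z\<close> and \<open>Ln (- z)\<close> differ there.\<close>
    have sgnA: "sgn (Im A) = - sgn (plane_det v u)" and sgnB: "sgn (Im B) = sgn (plane_det v u)"
    proof -
      have "sgn (plane_det (c (t0 + \<eta>) - y s0) u) = sgn (plane_det v u)"
        using small[OF eA] \<eta>(1) det unfolding dA
        by (cases "plane_det v u > 0") (auto simp: sgn_if mult_less_0_iff zero_less_mult_iff abs_if split: if_splits)
      moreover have "sgn (plane_det (c (t0 - \<eta>) - y s0) u) = - sgn (plane_det v u)"
        using small[OF eB] \<eta>(1) det unfolding dB
        by (cases "plane_det v u > 0") (auto simp: sgn_if mult_less_0_iff zero_less_mult_iff abs_if split: if_splits)
      moreover have "sgn (- x / (norm u)\<^sup>2) = - sgn x" for x :: real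
        using vu by (simp add: sgn_divide sgn_minus)
      ultimately show "sgn (Im A) = - sgn (plane_det v u)" "sgn (Im B) = sgn (plane_det v u)"
        unfolding A_def B_def Imdiv by simp_all
    qed
    have Im0: "Im A \<noteq> 0" "Im B \<noteq> 0" using sgnA sgnB det by (auto simp: sgn_0_0)
    have yc: "(y \<longlongrightarrow> y s0) (at s0)"
      using has_vector_derivative_continuous[OF y] by (simp add: isCont_def)
    have lim: "((\<lambda>s. Ln ((c t - y s) / (- of_real \<sigma> * u))) \<longlongrightarrow> Ln ((c t - y s0) / (- of_real \<sigma> * u))) (at s0)"
      if "Im ((c t - y s0) / u) \<noteq> 0" "\<sigma> = 1 \<or> \<sigma> = -1" for t \<sigma>
    proof (intro tendsto_Ln tendsto_intros yc)
      show "- of_real \<sigma> * u \<noteq> 0" using vu that by auto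
      have "Im ((c t - y s0) / (- of_real \<sigma> * u)) \<noteq> 0"
        using that by auto
      then show "(c t - y s0) / (- of_real \<sigma> * u) \<notin> \<real>\<^sub>\<le>\<^sub>0"
        by (auto simp: complex_nonpos_Reals_iff)
    qed
    have side: "\<forall>\<^sub>F s in at s0. sgn (s - s0) = \<sigma> \<longrightarrow>
        log_change c (t0 - \<eta>) (t0 + \<eta>) (y s) =
        Ln ((c (t0 + \<eta>) - y s) / (- of_real \<sigma> * u)) - Ln ((c (t0 - \<eta>) - y s) / (- of_real \<sigma> * u))"
      if "\<sigma> = 1 \<or> \<sigma> = -1" for \<sigma>
      using ev
    proof (eventually_elim, safe, goal_cases)
      case (1 s)
      show ?case
      proof (rule log_change_eq_Ln[OF c])
        show "- complex_of_real (sgn (s - s0)) * u \<noteq> 0"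
          using 1 vu by (auto simp: sgn_if)
        fix t assume "t \<in> {t0 - \<eta>..t0 + \<eta>}"
        then have "\<bar>t - t0\<bar> \<le> \<eta>0" using \<eta> by auto
        then show "(c t - y s) / (- complex_of_real (sgn (s - s0)) * u) \<notin> \<real>\<^sub>\<le>\<^sub>0"
          using avoid 1 by blast
      qed (use \<eta> in auto)
    qed
    have "((\<lambda>s. log_change c (t0 - \<eta>) (t0 + \<eta>) (y s)) \<longlongrightarrow> Ln (- A) - Ln (- B)) (at_right s0)"
    proof (rule Lim_transform_eventually)
      show "((\<lambda>s. Ln ((c (t0 + \<eta>) - y s) / (- of_real 1 * u)) - Ln ((c (t0 - \<eta>) - y s) / (- of_real 1 * u)))
            \<longlongrightarrow> Ln (- A) - Ln (- B)) (at_right s0)"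
        using tendsto_diff[OF lim[of "t0 + \<eta>" 1] lim[of "t0 - \<eta>" 1]] Im0
        by (intro filterlim_mono[OF _ order_refl at_le[of "{s0<..}" UNIV]]) (auto simp: A_def B_def)
      show "\<forall>\<^sub>F s in at_right s0. Ln ((c (t0 + \<eta>) - y s) / (- of_real 1 * u)) - Ln ((c (t0 - \<eta>) - y s) / (- of_real 1 * u))
          = log_change c (t0 - \<eta>) (t0 + \<eta>) (y s)"
        using filter_leD[OF at_le[of "{s0<..}" UNIV] side[of 1]] eventually_at_right_less[of s0]
        by (auto elim: eventually_elim2)
    qed
    moreover have "((\<lambda>s. log_change c (t0 - \<eta>) (t0 + \<eta>) (y s)) \<longlongrightarrow> Ln A - Ln B) (at_left s0)"
    proof (rule Lim_transform_eventually)
      show "((\<lambda>s. Ln ((c (t0 + \<eta>) - y s) / (- of_real (-1) * u)) - Ln ((c (t0 - \<eta>) - y s) / (- of_real (-1) * u)))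
            \<longlongrightarrow> Ln A - Ln B) (at_left s0)"
        using tendsto_diff[OF lim[of "t0 + \<eta>" "-1"] lim[of "t0 - \<eta>" "-1"]] Im0
        by (intro filterlim_mono[OF _ order_refl at_le[of "{..<s0}" UNIV]]) (auto simp: A_def B_def)
      have "\<forall>\<^sub>F s in at_left s0. s < s0" by (simp add: eventually_at_filter)
      then show "\<forall>\<^sub>F s in at_left s0. Ln ((c (t0 + \<eta>) - y s) / (- of_real (-1) * u)) - Ln ((c (t0 - \<eta>) - y s) / (- of_real (-1) * u))
          = log_change c (t0 - \<eta>) (t0 + \<eta>) (y s)"
        using filter_leD[OF at_le[of "{..<s0}" UNIV] side[of "-1"]]
        by (auto elim: eventually_elim2)
    qed
    moreover have "(Ln (- A) - Ln (- B)) - (Ln A - Ln B) = of_real (2 * pi * sgn (plane_det v u)) * \<i>"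
    proof (cases "plane_det v u > 0")
      case True
      then have "Im A < 0" "Im B > 0" using sgnA sgnB by (auto simp: sgn_if split: if_splits)
      then show ?thesis using True by (simp add: Ln_minus_cases)
    next
      case False
      then have "Im A > 0" "Im B < 0" using sgnA sgnB det by (auto simp: sgn_if split: if_splits)
      then show ?thesis using False det by (simp add: Ln_minus_cases)
    qed
    ultimately show "\<exists>Lm Lp.
       ((\<lambda>s. log_change c (t0 - \<eta>) (t0 + \<eta>) (y s)) \<longlongrightarrow> Lm) (at_left s0) \<and>
       ((\<lambda>s. log_change c (t0 - \<eta>) (t0 + \<eta>) (y s)) \<longlongrightarrow> Lp) (at_right s0) \<and>
       Lp - Lm = of_real (2 * pi * sgn (plane_det v u)) * \<i>"
      by blast
  qed
qed

section \<open>Periodic integrals and functions recovered from their jumps\<close>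

lemma integral_periodic:
  fixes f :: "real \<Rightarrow> complex"
  assumes cont: "continuous_on UNIV f" and per: "\<And>t. f (t + 1) = f t"
  shows "integral {a..a + 1} f = integral {0..1} f"
proof -
  have per_int: "f (t + of_int n) = f t" for t n
  proof (induction n rule: int_induct[of _ 0])
    case (step1 i)
    then show ?case using per[of "t + of_int i"] by (simp add: add_ac)
  next
    case (step2 i)
    then show ?case using per[of "t + of_int (i - 1)"] by (simp add: add_ac)
  qed simp
  have int: "f integrable_on {x..y}" for x y
    by (intro integrable_continuous_interval continuous_on_subset[OF cont]) auto
  have shift: "integral {x..y} f = integral {x + of_int n..y + of_int n} f" for x y n
    using integral_shift_Icc_real[of x y f "of_int n"] per_int by (simp add: o_def add_ac)
  define b where "b = frac a"
  have b: "0 \<le> b" "b \<le> 1" by (auto simp: b_def frac_lt_1 less_imp_le)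
  have "integral {a..a + 1} f = integral {b..b + 1} f"
    using shift[of b "b + 1" "\<lfloor>a\<rfloor>"] by (simp add: b_def frac_def algebra_simps)
  also have "\<dots> = integral {b..1} f + integral {1..b + 1} f"
    using b by (intro Henstock_Kurzweil_Integration.integral_combine[symmetric] int) auto
  also have "integral {1..b + 1} f = integral {0..b} f"
    using shift[of 0 b 1] by simp
  also have "integral {b..1} f + integral {0..b} f = integral {0..1} f"
    using Henstock_Kurzweil_Integration.integral_combine[OF b int] by (simp add: add.commute)
  finally show ?thesis .
qed

text \<open>Subtracting from \<open>\<psi>\<close> its earlier jumps leaves a locally constant,
  hence constant, function on the interval. The value \<open>\<psi> u\<close> is the left limit and
  \<open>\<psi>' u\<close> the right one; therefore a jump at \<open>a\<close> counts and one at
  \<open>b\<close> does not.\<close>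

lemma sum_of_jumps:
  fixes \<psi> \<psi>' :: "real \<Rightarrow> real"
  assumes "a \<le> b" and T: "finite T" "T \<subseteq> {a..<b}"
    and left: "\<And>u. u \<in> {a..b} \<Longrightarrow> \<forall>\<^sub>F x in at_left u. \<psi> x = \<psi> u"
    and right: "\<And>u. u \<in> {a..b} \<Longrightarrow> \<forall>\<^sub>F x in at_right u. \<psi> x = \<psi>' u"
    and eq: "\<And>u. u \<in> {a..<b} - T \<Longrightarrow> \<psi>' u = \<psi> u"
  shows "\<psi> b - \<psi> a = (\<Sum>t\<in>T. \<psi>' t - \<psi> t)"
proof -
  define G where "G u = \<psi> u - (\<Sum>t\<in>{t\<in>T. t < u}. \<psi>' t - \<psi> t)" for u
  have "\<forall>\<^sub>F x in at u within {a..b}. G u = G x" if u: "u \<in> {a..b}" for u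
  proof -
    have fin: "finite (T - {u})" using T by simp
    have "\<forall>\<^sub>F x in at_left u. G u = G x"
    proof -
      have "\<forall>\<^sub>F x in at_left u. \<forall>t\<in>{t\<in>T. t < u}. t < x"
        using T by (subst eventually_ball_finite_distrib) (auto intro: eventually_at_left_real order_tendstoD tendsto_ident_at)
      moreover have "\<forall>\<^sub>F x in at_left u. x < u" by (simp add: eventually_at_filter)
      ultimately show ?thesis using left[OF u]
      proof eventually_elim
        case (elim x)
        then have "{t\<in>T. t < u} = {t\<in>T. t < x}" by auto
        then show ?case using elim by (simp add: G_def)
      qed
    qed
    moreover have "\<forall>\<^sub>F x in at_right u. x \<le> b \<longrightarrow> G u = G x"
    proof -
      have "\<forall>\<^sub>F x in at_right u. \<forall>t\<in>{t\<in>T. u < t}. x < t"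
        using T by (subst eventually_ball_finite_distrib) (auto intro: order_tendstoD tendsto_ident_at)
      moreover have "\<forall>\<^sub>F x in at_right u. u < x" by (simp add: eventually_at_filter)
      ultimately show ?thesis using right[OF u]
      proof eventually_elim
        case (elim x)
        show ?case
        proof
          assume "x \<le> b"
          then have ub: "u < b" using elim by simp
          have "{t\<in>T. t < x} = {t\<in>T. t < u} \<union> (T \<inter> {u})" using elim by force
          moreover have "(\<Sum>t\<in>{t\<in>T. t < u} \<union> (T \<inter> {u}). \<psi>' t - \<psi> t)
              = (\<Sum>t\<in>{t\<in>T. t < u}. \<psi>' t - \<psi> t) + (\<Sum>t\<in>T \<inter> {u}. \<psi>' t - \<psi> t)"
            using T by (intro sum.union_disjoint) auto
          moreover have "(\<Sum>t\<in>T \<inter> {u}. \<psi>' t - \<psi> t) = \<psi>' u - \<psi> u"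
            using eq[of u] u ub by (cases "u \<in> T") auto
          ultimately show "G u = G x" using elim by (simp add: G_def)
        qed
      qed
    qed
    ultimately have "\<forall>\<^sub>F x in at u. x \<le> b \<longrightarrow> G u = G x"
      by (simp add: eventually_at_split eventually_mono)
    then show ?thesis
      by (auto simp: eventually_at_filter elim: eventually_mono)
  qed
  then have "G a = G b"
    using connected_local_const[of "{a..b}" a b G] \<open>a \<le> b\<close> by auto
  moreover have "{t\<in>T. t < a} = {}" "{t\<in>T. t < b} = T" using T by auto
  ultimately show ?thesis by (simp add: G_def)
qed

lemma Lim_eventually_const:
  fixes x :: "'a :: t2_space"
  assumes "\<forall>\<^sub>F u in F. f u = x" "F \<noteq> bot"
  shows "Lim F f = x"
  by (intro tendsto_Lim assms tendsto_eventually)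

lemma Lim_side_locally_const:
  fixes \<psi> :: "real \<Rightarrow> real"
  shows "\<forall>\<^sub>F x in at_left u. \<psi> x = d \<Longrightarrow> \<forall>\<^sub>F x in at_left u. Lim (at_left x) \<psi> = d"
    and "\<forall>\<^sub>F x in at_right u. \<psi> x = d \<Longrightarrow> \<forall>\<^sub>F x in at_right u. Lim (at_left x) \<psi> = d"
proof -
  assume "\<forall>\<^sub>F x in at_left u. \<psi> x = d"
  then obtain b where b: "b < u" "\<And>x. b < x \<Longrightarrow> x < u \<Longrightarrow> \<psi> x = d"
    by (auto simp: eventually_at_left_field)
  have "Lim (at_left x) \<psi> = d" if "b < x" "x < u" for x
    using that b by (intro Lim_eventually_const) (auto simp: eventually_at_left_field intro!: exI[of _ b])
  then show "\<forall>\<^sub>F x in at_left u. Lim (at_left x) \<psi> = d"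
    using b by (auto simp: eventually_at_left_field)
next
  assume "\<forall>\<^sub>F x in at_right u. \<psi> x = d"
  then obtain b where b: "u < b" "\<And>x. u < x \<Longrightarrow> x < b \<Longrightarrow> \<psi> x = d"
    by (auto simp: eventually_at_right_field)
  have "Lim (at_left x) \<psi> = d" if "u < x" "x < b" for x
    using that b by (intro Lim_eventually_const) (auto simp: eventually_at_left_field intro!: exI[of _ u])
  then show "\<forall>\<^sub>F x in at_right u. Lim (at_left x) \<psi> = d"
    using b by (auto simp: eventually_at_right_field)
qed

text \<open>Passing to the function of left limits allows \<open>\<psi>\<close> to have arbitrary
  values at the jumps themselves, where winding numbers carry no information.\<close>

lemma sum_of_jumps_Lim:
  fixes \<psi> :: "real \<Rightarrow> real"
  assumes "a \<le> b" and T: "finite T" "T \<subseteq> {a..<b}"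
    and left: "\<And>u. u \<in> {a..b} \<Longrightarrow> \<exists>d. \<forall>\<^sub>F x in at_left u. \<psi> x = d"
    and right: "\<And>u. u \<in> {a..b} \<Longrightarrow> \<exists>d. \<forall>\<^sub>F x in at_right u. \<psi> x = d"
    and eq: "\<And>u. u \<in> {a..<b} - T \<Longrightarrow> Lim (at_left u) \<psi> = Lim (at_right u) \<psi>"
  shows "Lim (at_left b) \<psi> - Lim (at_left a) \<psi> = (\<Sum>t\<in>T. Lim (at_right t) \<psi> - Lim (at_left t) \<psi>)"
proof (rule sum_of_jumps[OF assms(1-3)])
  fix u assume u: "u \<in> {a..b}"
  obtain d where d: "\<forall>\<^sub>F x in at_left u. \<psi> x = d" using left[OF u] by blast
  have "Lim (at_left u) \<psi> = d" by (intro Lim_eventually_const d) auto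
  with Lim_side_locally_const(1)[OF d]
  show "\<forall>\<^sub>F x in at_left u. Lim (at_left x) \<psi> = Lim (at_left u) \<psi>" by simp
  obtain d where d: "\<forall>\<^sub>F x in at_right u. \<psi> x = d" using right[OF u] by blast
  have "Lim (at_right u) \<psi> = d" by (intro Lim_eventually_const d) auto
  with Lim_side_locally_const(2)[OF d]
  show "\<forall>\<^sub>F x in at_right u. Lim (at_left x) \<psi> = Lim (at_right u) \<psi>" by simp
qed (use eq in auto)

lemma tendsto_Ints_eventually_const:
  fixes \<psi> :: "real \<Rightarrow> real"
  assumes lim: "(\<psi> \<longlongrightarrow> L) F" and int: "\<forall>\<^sub>F s in F. \<psi> s \<in> \<int>" and "F \<noteq> bot"
  shows "\<forall>\<^sub>F s in F. \<psi> s = L"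
proof -
  have "L \<in> \<int>"
    using Lim_in_closed_set[OF closed_Ints int \<open>F \<noteq> bot\<close> lim] .
  have "\<forall>\<^sub>F s in F. dist (\<psi> s) L < 1"
    using lim by (simp add: tendsto_iff)
  then show ?thesis using int
  proof eventually_elim
    case (elim s)
    then show ?case using \<open>L \<in> \<int>\<close> by (simp add: Ints_eq_abs_less1 dist_real_def)
  qed
qed

section \<open>Winding numbers of closed curves\<close>

definition wind :: "(real \<Rightarrow> complex) \<Rightarrow> complex \<Rightarrow> real" where
  "wind c w = Re (winding_number c w)"

lemma C1_valid_path: "c C1_differentiable_on UNIV \<Longrightarrow> valid_path c"
  unfolding valid_path_def
  using C1_differentiable_imp_piecewise C1_differentiable_on_subset by blast

text \<open>The integrand is periodic, so the integral may start anywhere. Thus an arc around a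
  given parameter never has to be cut at the base point 0.\<close>

lemma winding_number_eq_log_change:
  assumes c: "c C1_differentiable_on UNIV" and per: "\<And>t. c (t + 1) = c t" and w: "w \<notin> range c"
  shows "winding_number c w = log_change c a (a + 1) w / (2 * pi * \<i>)"
proof -
  have per': "vector_derivative c (at (t + 1)) = vector_derivative c (at t)" for t
  proof -
    have "((c \<circ> (\<lambda>x. x + 1)) has_vector_derivative 1 *\<^sub>R vector_derivative c (at (t + 1))) (at t)"
      by (intro vector_diff_chain_at) (auto intro!: derivative_eq_intros C1_has_vector_derivative[OF c])
    then show ?thesis using per by (simp add: o_def vector_derivative_at)
  qed
  have "integral {a..a + 1} (\<lambda>t. vector_derivative c (at t) / (c t - w))
      = integral {0..1} (\<lambda>t. vector_derivative c (at t) / (c t - w))"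
    using w by (intro integral_periodic continuous_intros C1_continuous_derivative[OF c] C1_continuous_on[OF c])
      (auto simp: per per')
  moreover have "w \<notin> path_image c" using w by (auto simp: path_image_def)
  ultimately show ?thesis
    by (simp add: winding_number_valid_path[OF C1_valid_path[OF c]] contour_integral_integral log_change_def)
qed

lemma wind_constant:
  assumes c: "c C1_differentiable_on UNIV" and per: "\<And>t. c (t + 1) = c t"
    and S: "connected S" "S \<inter> range c = {}" "x \<in> S" "y \<in> S"
  shows "wind c x = wind c y"
proof -
  have "winding_number c constant_on S"
    using per[of 0] S by (intro winding_number_constant valid_path_imp_path[OF C1_valid_path[OF c]])
      (auto simp: pathstart_def pathfinish_def path_image_def)
  then show ?thesis using S by (auto simp: wind_def constant_on_def)
qed

text \<open>Split a period into a short arc around \<open>t0\<close>, which carries the jump, and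
  the rest, which misses \<open>y s0\<close> and contributes continuously.\<close>

lemma wind_jump:
  assumes c: "c C1_differentiable_on UNIV" and per: "\<And>t. c (t + 1) = c t"
    and simple: "\<And>t. c t = c t0 \<Longrightarrow> t - t0 \<in> \<int>"
    and y: "(y has_vector_derivative u) (at s0)" and eq: "c t0 = y s0"
    and off: "\<forall>\<^sub>F s in at s0. y s \<notin> range c"
    and det: "plane_det (vector_derivative c (at t0)) u \<noteq> 0"
  shows "\<exists>Lm Lp. ((\<lambda>s. wind c (y s)) \<longlongrightarrow> Lm) (at_left s0) \<and> ((\<lambda>s. wind c (y s)) \<longlongrightarrow> Lp) (at_right s0) \<and>
     Lp - Lm = sgn (plane_det (vector_derivative c (at t0)) u)"
proof -
  let ?d = "sgn (plane_det (vector_derivative c (at t0)) u)"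
  obtain \<eta>0 where \<eta>0: "\<eta>0 > 0" "\<And>\<eta>. 0 < \<eta> \<Longrightarrow> \<eta> \<le> \<eta>0 \<Longrightarrow> \<exists>Lm Lp.
       ((\<lambda>s. log_change c (t0 - \<eta>) (t0 + \<eta>) (y s)) \<longlongrightarrow> Lm) (at_left s0) \<and>
       ((\<lambda>s. log_change c (t0 - \<eta>) (t0 + \<eta>) (y s)) \<longlongrightarrow> Lp) (at_right s0) \<and>
       Lp - Lm = of_real (2 * pi * ?d) * \<i>"
    using log_change_jump[OF c y eq refl det] by blast
  \<comment> \<open>The bound \<open>1/4\<close> leaves a far arc of positive length in the period;
    its parameters differ from \<open>t0\<close> by a number strictly between 0 and 1, so
    \<open>simple\<close> keeps it away from \<open>c t0\<close>.\<close>
  define \<eta> where "\<eta> = min \<eta>0 (1/4)"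
  have \<eta>: "0 < \<eta>" "\<eta> \<le> \<eta>0" "\<eta> \<le> 1/4" using \<eta>0(1) by (auto simp: \<eta>_def)
  obtain Lm Lp where L:
    "((\<lambda>s. log_change c (t0 - \<eta>) (t0 + \<eta>) (y s)) \<longlongrightarrow> Lm) (at_left s0)"
    "((\<lambda>s. log_change c (t0 - \<eta>) (t0 + \<eta>) (y s)) \<longlongrightarrow> Lp) (at_right s0)"
    "Lp - Lm = of_real (2 * pi * ?d) * \<i>"
    using \<eta>0(2)[OF \<eta>(1,2)] by blast
  let ?far = "log_change c (t0 + \<eta>) (t0 - \<eta> + 1)"
  have "y s0 \<notin> c ` {t0 + \<eta>..t0 - \<eta> + 1}"
  proof
    assume "y s0 \<in> c ` {t0 + \<eta>..t0 - \<eta> + 1}"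
    then obtain t where t: "t \<in> {t0 + \<eta>..t0 - \<eta> + 1}" "c t = c t0" using eq by auto
    from simple[OF t(2)] obtain n where "t - t0 = of_int n" by (auto elim: Ints_cases)
    then have "0 < real_of_int n" "real_of_int n < 1" using t \<eta> by auto
    then show False by simp
  qed
  from isCont_log_change[OF c this] have far: "((\<lambda>s. ?far (y s)) \<longlongrightarrow> ?far (y s0)) (at s0)"
    using has_vector_derivative_continuous[OF y] by (intro isCont_tendsto_compose[where g = ?far]) (simp_all add: isCont_def)
  have ev: "\<forall>\<^sub>F s in at s0. Re ((log_change c (t0 - \<eta>) (t0 + \<eta>) (y s) + ?far (y s)) / (2 * pi * \<i>)) = wind c (y s)"
    using off
  proof eventually_elim
    case (elim s)
    have "log_change c (t0 - \<eta>) (t0 - \<eta> + 1) (y s) = log_change c (t0 - \<eta>) (t0 + \<eta>) (y s) + ?far (y s)"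
      using \<eta> elim by (intro log_change_combine[OF c]) auto
    then show ?case
      using winding_number_eq_log_change[OF c per elim, of "t0 - \<eta>"] by (simp add: wind_def)
  qed
  have le: "at_left s0 \<le> at s0" "at_right s0 \<le> at s0"
    by (auto intro: at_le)
  let ?f = "\<lambda>z. Re (z / (2 * pi * \<i>))"
  have "((\<lambda>s. wind c (y s)) \<longlongrightarrow> ?f (Lm + ?far (y s0))) (at_left s0)"
    by (rule Lim_transform_eventually[OF _ filter_leD[OF le(1) ev]])
      (intro tendsto_intros L filterlim_mono[OF far order_refl le(1)]; simp)
  moreover have "((\<lambda>s. wind c (y s)) \<longlongrightarrow> ?f (Lp + ?far (y s0))) (at_right s0)"
    by (rule Lim_transform_eventually[OF _ filter_leD[OF le(2) ev]])
      (intro tendsto_intros L filterlim_mono[OF far order_refl le(2)]; simp)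
  moreover have "?f (Lp + ?far (y s0)) - ?f (Lm + ?far (y s0)) = ?d"
  proof -
    have "?f (Lp + ?far (y s0)) - ?f (Lm + ?far (y s0)) = ?f (Lp - Lm)"
      by (simp flip: minus_complex.simps(1) diff_divide_distrib)
    also have "\<dots> = ?d" by (simp add: L(3))
    finally show ?thesis .
  qed
  ultimately show ?thesis by (intro exI conjI)
qed

text \<open>Within a period, the parameters at distance at least \<open>\<eta>\<close> from all
  preimages of \<open>x0\<close> form a compact set, on which the distance of \<open>c\<close> from
  \<open>x0\<close> has a positive minimum.\<close>

lemma near_preimage:
  fixes c :: "real \<Rightarrow> complex"
  assumes c: "continuous_on UNIV c" and per: "\<And>t n. c (t + of_int n) = c t" and "\<eta> > 0"
  obtains \<rho> where "\<rho> > 0" "\<And>t. norm (c t - x0) < \<rho> \<Longrightarrow> \<exists>t1. c t1 = x0 \<and> \<bar>t - t1\<bar> < \<eta>"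
proof -
  define S where "S = {0..1} \<inter> (\<Inter>t1\<in>{t1. c t1 = x0}. {t. \<bar>t - t1\<bar> \<ge> \<eta>})"
  have "closed {t. \<bar>t - t1\<bar> \<ge> \<eta>}" for t1 :: real
    by (intro closed_Collect_le continuous_intros)
  then have "compact S"
    unfolding S_def by (intro compact_Int_closed closed_INT) auto
  have pos: "norm (c t - x0) > 0" if "t \<in> S" for t
    using that \<open>\<eta> > 0\<close> by (auto simp: S_def)
  obtain \<rho> where \<rho>: "\<rho> > 0" "\<And>t. t \<in> S \<Longrightarrow> \<rho> \<le> norm (c t - x0)"
  proof (cases "S = {}")
    case False
    have "continuous_on S (\<lambda>t. norm (c t - x0))"
      by (intro continuous_intros continuous_on_subset[OF c]) auto
    then obtain t where "t \<in> S" "\<forall>t'\<in>S. norm (c t - x0) \<le> norm (c t' - x0)"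
      using continuous_attains_inf[OF \<open>compact S\<close> False] by blast
    with pos that show ?thesis by blast
  qed (use that[of 1] in auto)
  show ?thesis
  proof (rule that[OF \<rho>(1)])
    fix t assume "norm (c t - x0) < \<rho>"
    moreover have "c (frac t) = c t" using per[of "frac t" "\<lfloor>t\<rfloor>"] by (simp add: frac_def)
    ultimately have "frac t \<notin> S" using \<rho>(2)[of "frac t"] by auto
    then obtain t1 where "c t1 = x0" "\<bar>frac t - t1\<bar> < \<eta>"
      using frac_lt_1[of t] by (auto simp: S_def not_le)
    then show "\<exists>t1. c t1 = x0 \<and> \<bar>t - t1\<bar> < \<eta>"
      using per[of t1 "\<lfloor>t\<rfloor>"] by (intro exI[of _ "t1 + \<lfloor>t\<rfloor>"]) (auto simp: frac_def algebra_simps)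
  qed
qed

lemma frac_eq_imp_diff_Ints: "frac a = frac b \<Longrightarrow> a - b \<in> \<int>" for a b :: real
  by (simp add: frac_def) (metis Ints_diff Ints_of_int add_diff_cancel_left' diff_add_cancel diff_diff_eq2 diff_eq_eq)

lemma eventually_at_notin_finite:
  fixes S :: "'a :: t1_space set"
  assumes "finite S"
  shows "\<forall>\<^sub>F u in at x. u \<notin> S"
proof -
  have "\<forall>\<^sub>F u in at x. \<forall>y\<in>S. u \<noteq> y"
    by (intro eventually_ball_finite assms ballI eventually_neq_at_within)
  then show ?thesis by eventually_elim auto
qed

section \<open>Diagrams and their local structure\<close>

locale diagram =
  fixes D :: link_diagram
  assumes diagram: "is_link_diagram D"
begin

abbreviation n :: nat where "n \<equiv> ncomps D"
abbreviation \<gamma> :: "nat \<Rightarrow> real \<Rightarrow> complex" where "\<gamma> \<equiv> curve D"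
abbreviation V :: "nat \<Rightarrow> real \<Rightarrow> complex" where "V i t \<equiv> vector_derivative (\<gamma> i) (at t)"

lemma C1: "i < n \<Longrightarrow> \<gamma> i C1_differentiable_on UNIV"
  and per: "i < n \<Longrightarrow> \<gamma> i (t + 1) = \<gamma> i t"
  and V_nz: "i < n \<Longrightarrow> V i t \<noteq> 0"
  and finite_passages: "finite (passages D)"
  using diagram by (auto simp: is_link_diagram_def immersed_curves_def)

lemma double_unique: "double_pair D p q \<Longrightarrow> double_pair D p r \<Longrightarrow> q = r"
  and double_transverse: "double_pair D p q \<Longrightarrow> plane_det (vel D p) (vel D q) \<noteq> 0"
  and double_overs: "double_pair D p q \<Longrightarrow> p \<in> overs D \<longleftrightarrow> q \<notin> overs D"
  using diagram unfolding is_link_diagram_def by blast+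

lemma double_sym: "double_pair D p q \<Longrightarrow> double_pair D q p"
  by (auto simp: double_pair_def)

lemma continuous_\<gamma>: "i < n \<Longrightarrow> continuous_on A (\<gamma> i)"
  by (intro C1_continuous_on C1)

lemma isCont_\<gamma>: "i < n \<Longrightarrow> isCont (\<gamma> i) t"
  using continuous_\<gamma>[of i UNIV] by (simp add: continuous_on_eq_continuous_at)

lemma isCont_V: "i < n \<Longrightarrow> isCont (V i) t"
  using C1_continuous_derivative[OF C1, of i UNIV] by (simp add: continuous_on_eq_continuous_at)

lemma per_int: assumes "i < n" shows "\<gamma> i (t + of_int m) = \<gamma> i t"
proof (induction m rule: int_induct[of _ 0])
  case (step1 k)
  then show ?case using per[OF assms, of "t + of_int k"] by (simp add: add_ac)
next
  case (step2 k)
  then show ?case using per[OF assms, of "t + of_int (k - 1)"] by (simp add: add_ac)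
qed simp

lemma V_per_int: assumes "i < n" shows "V i (t + of_int m) = V i t"
proof -
  have "((\<gamma> i \<circ> (\<lambda>x. x + of_int m)) has_vector_derivative 1 *\<^sub>R V i (t + of_int m)) (at t)"
    by (intro vector_diff_chain_at)
      (auto intro!: derivative_eq_intros C1_has_vector_derivative C1 assms)
  then show ?thesis using per_int[OF assms] by (simp add: o_def vector_derivative_at)
qed

lemma per_frac: "i < n \<Longrightarrow> \<gamma> i (frac t) = \<gamma> i t"
  and V_frac: "i < n \<Longrightarrow> V i (frac t) = V i t"
  using per_int[of i "frac t" "\<lfloor>t\<rfloor>"] V_per_int[of i "frac t" "\<lfloor>t\<rfloor>"] by (simp_all add: frac_def)

lemma pos_frac: "i < n \<Longrightarrow> pos D (i, frac t) = \<gamma> i t"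
  and vel_frac: "i < n \<Longrightarrow> vel D (i, frac t) = V i t"
  by (simp_all add: pos_def vel_def per_frac V_frac)

lemma params_frac: "i < n \<Longrightarrow> (i, frac t) \<in> params D"
  by (simp add: params_def frac_lt_1)

lemma double_frac:
  "i < n \<Longrightarrow> j < n \<Longrightarrow> double_pair D (i, frac s) (j, frac t) \<longleftrightarrow> (i, frac s) \<noteq> (j, frac t) \<and> \<gamma> i s = \<gamma> j t"
  by (auto simp: double_pair_def params_frac pos_frac)

lemma double_pairD:
  assumes "double_pair D (i, s) (j, t)"
  shows "i < n" "j < n" "frac s = s" "frac t = t" "\<gamma> i s = \<gamma> j t" "0 \<le> s" "s < 1" "0 \<le> t" "t < 1"
  using assms by (auto simp: double_pair_def params_def pos_def frac_eq)

lemma passages_params: "passages D \<subseteq> params D"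
  by (auto simp: passages_def double_pair_def)

lemma regular_unique:
  assumes reg: "(i, frac t0) \<in> regular_params D" and "j < n" "\<gamma> j t = \<gamma> i t0"
  shows "j = i \<and> t - t0 \<in> \<int>"
proof (rule ccontr)
  have i: "i < n" using reg by (auto simp: regular_params_def params_def)
  assume "\<not> ?thesis"
  then have "double_pair D (i, frac t0) (j, frac t)"
    using assms(2,3) i frac_eq_imp_diff_Ints[of t t0] by (subst double_frac) auto
  with reg show False by (auto simp: regular_params_def passages_def)
qed

lemma crossing_unique:
  assumes d: "double_pair D (i, frac s0) (j, frac t0)" and "l < n" "\<gamma> l t = \<gamma> i s0"
  shows "l = i \<and> t - s0 \<in> \<int> \<or> l = j \<and> t - t0 \<in> \<int>"
proof -
  have i: "i < n" using double_pairD[OF d] by simp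
  consider "(l, frac t) = (i, frac s0)" | "double_pair D (i, frac s0) (l, frac t)"
    using assms(2,3) i by (cases "(l, frac t) = (i, frac s0)") (auto simp: double_frac)
  then show ?thesis
    using double_unique[OF d] frac_eq_imp_diff_Ints by cases auto
qed

lemma mem_trace_iff: "x \<in> trace D \<longleftrightarrow> (\<exists>j<n. \<exists>t. x = \<gamma> j t)"
  by (auto simp: trace_def)

lemma local_trace:
  assumes "\<eta> > 0"
  obtains \<rho> where "\<rho> > 0"
    "\<And>j t. j < n \<Longrightarrow> norm (\<gamma> j t - x0) < \<rho> \<Longrightarrow> \<exists>t1. \<gamma> j t1 = x0 \<and> \<bar>t - t1\<bar> < \<eta>"
proof -
  have "\<forall>j\<in>{..<n}. \<exists>\<rho>>0. \<forall>t. norm (\<gamma> j t - x0) < \<rho> \<longrightarrow> (\<exists>t1. \<gamma> j t1 = x0 \<and> \<bar>t - t1\<bar> < \<eta>)"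
  proof
    fix j assume "j \<in> {..<n}"
    then have j: "j < n" by simp
    show "\<exists>\<rho>>0. \<forall>t. norm (\<gamma> j t - x0) < \<rho> \<longrightarrow> (\<exists>t1. \<gamma> j t1 = x0 \<and> \<bar>t - t1\<bar> < \<eta>)"
      by (rule near_preimage[OF continuous_\<gamma>[OF j] per_int[OF j] \<open>\<eta> > 0\<close>, of x0]) blast
  qed
  then obtain \<rho> where \<rho>: "\<And>j. j < n \<Longrightarrow> \<rho> j > 0"
    "\<And>j t. j < n \<Longrightarrow> norm (\<gamma> j t - x0) < \<rho> j \<Longrightarrow> \<exists>t1. \<gamma> j t1 = x0 \<and> \<bar>t - t1\<bar> < \<eta>"
    by (metis (no_types, lifting) lessThan_iff)
  have "Min (insert 1 (\<rho> ` {..<n})) > 0" using \<rho>(1) by auto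
  moreover have "norm (\<gamma> j t - x0) < \<rho> j"
    if "j < n" "norm (\<gamma> j t - x0) < Min (insert 1 (\<rho> ` {..<n}))" for j t
    using that by auto
  ultimately show ?thesis using \<rho>(2) that by blast
qed

lemma local_regular:
  assumes reg: "(i, frac t0) \<in> regular_params D" and "\<eta> > 0"
  obtains \<rho> where "\<rho> > 0"
    "\<And>x. x \<in> trace D \<Longrightarrow> norm (x - \<gamma> i t0) < \<rho> \<Longrightarrow> \<exists>t'. \<bar>t' - t0\<bar> < \<eta> \<and> x = \<gamma> i t'"
proof -
  obtain \<rho> where \<rho>: "\<rho> > 0"
    "\<And>j t. j < n \<Longrightarrow> norm (\<gamma> j t - \<gamma> i t0) < \<rho> \<Longrightarrow> \<exists>t1. \<gamma> j t1 = \<gamma> i t0 \<and> \<bar>t - t1\<bar> < \<eta>"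
    using local_trace[OF \<open>\<eta> > 0\<close>] by blast
  show ?thesis
  proof (rule that[OF \<rho>(1)])
    fix x assume "x \<in> trace D" and near: "norm (x - \<gamma> i t0) < \<rho>"
    then obtain j t where jt: "j < n" "x = \<gamma> j t" by (auto simp: mem_trace_iff)
    then obtain t1 where t1: "\<gamma> j t1 = \<gamma> i t0" "\<bar>t - t1\<bar> < \<eta>" using \<rho>(2) near by blast
    then obtain m where "j = i" "t1 - t0 = of_int m"
      using regular_unique[OF reg jt(1) t1(1)] by (auto elim: Ints_cases)
    then show "\<exists>t'. \<bar>t' - t0\<bar> < \<eta> \<and> x = \<gamma> i t'"
      using t1(2) jt per_int[of i t "- m"] by (intro exI[of _ "t - of_int m"]) auto
  qed
qed

lemma local_crossing:
  assumes d: "double_pair D (i, frac s0) (j, frac t0)" and "\<eta> > 0"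
  obtains \<rho> where "\<rho> > 0"
    "\<And>x. x \<in> trace D \<Longrightarrow> norm (x - \<gamma> i s0) < \<rho> \<Longrightarrow>
       (\<exists>t'. \<bar>t' - s0\<bar> < \<eta> \<and> x = \<gamma> i t') \<or> (\<exists>t'. \<bar>t' - t0\<bar> < \<eta> \<and> x = \<gamma> j t')"
proof -
  obtain \<rho> where \<rho>: "\<rho> > 0"
    "\<And>l t. l < n \<Longrightarrow> norm (\<gamma> l t - \<gamma> i s0) < \<rho> \<Longrightarrow> \<exists>t1. \<gamma> l t1 = \<gamma> i s0 \<and> \<bar>t - t1\<bar> < \<eta>"
    using local_trace[OF \<open>\<eta> > 0\<close>] by blast
  show ?thesis
  proof (rule that[OF \<rho>(1)])
    fix x assume "x \<in> trace D" and near: "norm (x - \<gamma> i s0) < \<rho>"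
    then obtain l t where lt: "l < n" "x = \<gamma> l t" by (auto simp: mem_trace_iff)
    then obtain t1 where t1: "\<gamma> l t1 = \<gamma> i s0" "\<bar>t - t1\<bar> < \<eta>" using \<rho>(2) near by blast
    from crossing_unique[OF d lt(1) t1(1)]
    consider m where "l = i" "t1 - s0 = of_int m" | m where "l = j" "t1 - t0 = of_int m"
      by (auto elim!: Ints_cases)
    then show "(\<exists>t'. \<bar>t' - s0\<bar> < \<eta> \<and> x = \<gamma> i t') \<or> (\<exists>t'. \<bar>t' - t0\<bar> < \<eta> \<and> x = \<gamma> j t')"
    proof cases
      case 1
      then show ?thesis
        using t1(2) lt per_int[of i t "- m"] by (intro disjI1 exI[of _ "t - of_int m"]) auto
    next
      case 2
      then show ?thesis
        using t1(2) lt per_int[of j t "- m"] by (intro disjI2 exI[of _ "t - of_int m"]) auto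
    qed
  qed
qed

lemma finite_passage_times: "finite {u\<in>{a..b}. (i, frac u) \<in> passages D}"
proof (rule finite_subset)
  show "finite ((\<lambda>(p, m). snd p + of_int m) ` (passages D \<times> {\<lfloor>a\<rfloor>..\<lfloor>b\<rfloor>}))"
    using finite_passages by auto
  show "{u\<in>{a..b}. (i, frac u) \<in> passages D} \<subseteq> (\<lambda>(p, m). snd p + of_int m) ` (passages D \<times> {\<lfloor>a\<rfloor>..\<lfloor>b\<rfloor>})"
  proof safe
    fix u assume "(i, frac u) \<in> passages D" "u \<in> {a..b}"
    then show "u \<in> (\<lambda>(p, m). snd p + of_int m) ` (passages D \<times> {\<lfloor>a\<rfloor>..\<lfloor>b\<rfloor>})"
      by (intro image_eqI[of _ _ "((i, frac u), \<lfloor>u\<rfloor>)"]) (auto simp: frac_def floor_mono)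
  qed
qed

lemma eventually_regular:
  assumes "i < n"
  shows "\<forall>\<^sub>F u in at s. (i, frac u) \<in> regular_params D"
proof -
  have "\<forall>\<^sub>F u in at s. u \<notin> {u\<in>{s - 1..s + 1}. (i, frac u) \<in> passages D}"
    by (intro eventually_at_notin_finite finite_passage_times)
  moreover have "\<forall>\<^sub>F u in at s. u \<in> {s - 1<..<s + 1}"
    by (intro eventually_at_in_open') auto
  ultimately show ?thesis
    by eventually_elim (use assms in \<open>auto simp: regular_params_def params_frac\<close>)
qed

section \<open>The Alexander numbering of the regions of a sublink\<close>

definition W :: "nat set \<Rightarrow> complex \<Rightarrow> real" where
  "W X w = (\<Sum>j\<in>X. wind (\<gamma> j) w)"

lemma W_constant:
  assumes "X \<subseteq> {..<n}" "connected S" "S \<inter> trace D = {}" "x \<in> S" "y \<in> S"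
  shows "W X x = W X y"
  unfolding W_def
proof (rule sum.cong[OF refl])
  fix j assume "j \<in> X"
  then have j: "j < n" using assms by auto
  then show "wind (\<gamma> j) x = wind (\<gamma> j) y"
    using assms by (intro wind_constant[OF C1[OF j] per[OF j], of S]) (auto simp: trace_def)
qed

text \<open>Near a regular point the trace is a single strand with chords almost parallel to
  \<open>V i t0\<close>, whereas \<open>\<zeta>\<close> has a transversal component of at least
  \<open>m\<close>. Uniformity in \<open>t\<close>, \<open>r\<close> and \<open>\<zeta>\<close> is
  what makes whole strips avoid the diagram.\<close>

lemma strip_avoid:
  assumes reg: "(i, frac t0) \<in> regular_params D" and "0 < m" "0 < M"
  obtains \<eta> where "\<eta> > 0"
    "\<And>t r \<zeta>. \<bar>t - t0\<bar> < \<eta> \<Longrightarrow> 0 < r \<Longrightarrow> r < \<eta> \<Longrightarrow> m \<le> \<bar>plane_det (V i t0) \<zeta>\<bar> \<Longrightarrow> norm \<zeta> \<le> M \<Longrightarrow>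
       \<gamma> i t + r *\<^sub>R \<zeta> \<notin> trace D"
proof -
  have i: "i < n" using reg by (auto simp: regular_params_def params_def)
  define v where "v = V i t0"
  have v: "norm v > 0" using V_nz[OF i] by (simp add: v_def)
  \<comment> \<open>The bound \<open>norm v / 2\<close> gives
    \<open>\<bar>d\<bar> * norm v \<le> 2 * (r * M)\<close> for the parameter shift
    \<open>d\<close>; then \<open>m / (4 * M)\<close> bounds the transversal part of the chord by
    \<open>r * m / 2\<close>, half of what is required.\<close>
  define \<kappa> where "\<kappa> = min (norm v / 2) (m / (4 * M))"
  have \<kappa>: "\<kappa> > 0" "\<kappa> \<le> norm v / 2" "\<kappa> * (4 * M) \<le> m"
    using v assms(2,3) by (auto simp: \<kappa>_def min_def field_simps)
  obtain \<eta>1 where \<eta>1: "\<eta>1 > 0"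
    "\<And>t t'. \<bar>t - t0\<bar> \<le> \<eta>1 \<Longrightarrow> \<bar>t' - t0\<bar> \<le> \<eta>1 \<Longrightarrow> norm (\<gamma> i t - \<gamma> i t' - (t - t') *\<^sub>R v) \<le> \<kappa> * \<bar>t - t'\<bar>"
    using C1_strict_derivative[OF C1[OF i] \<kappa>(1), of t0] unfolding v_def by metis
  obtain \<rho> where \<rho>: "\<rho> > 0"
    "\<And>x. x \<in> trace D \<Longrightarrow> norm (x - \<gamma> i t0) < \<rho> \<Longrightarrow> \<exists>t'. \<bar>t' - t0\<bar> < \<eta>1 \<and> x = \<gamma> i t'"
    using local_regular[OF reg \<eta>1(1)] by blast
  obtain \<eta>2 where \<eta>2: "\<eta>2 > 0" "\<And>t. \<bar>t - t0\<bar> < \<eta>2 \<Longrightarrow> norm (\<gamma> i t - \<gamma> i t0) < \<rho> / 2"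
    using isCont_\<gamma>[OF i, of t0] half_gt_zero[OF \<rho>(1)] unfolding continuous_at_eps_delta
    by (metis dist_norm real_norm_def)
  define \<eta> where "\<eta> = min (min \<eta>1 \<eta>2) (\<rho> / (2 * M))"
  have \<eta>: "\<eta> > 0" "\<eta> \<le> \<eta>1" "\<eta> \<le> \<eta>2" "\<eta> \<le> \<rho> / (2 * M)"
    using \<eta>1(1) \<eta>2(1) \<rho>(1) \<open>0 < M\<close> by (auto simp: \<eta>_def)
  from \<eta>(4) \<open>0 < M\<close> have \<eta>M: "\<eta> * M \<le> \<rho> / 2" by (simp add: field_simps)
  show ?thesis
  proof (rule that[OF \<eta>(1)], rule notI)
    fix t r \<zeta>
    assume t: "\<bar>t - t0\<bar> < \<eta>" and r: "0 < r" "r < \<eta>" and m: "m \<le> \<bar>plane_det (V i t0) \<zeta>\<bar>"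
      and M: "norm \<zeta> \<le> M" and mem: "\<gamma> i t + r *\<^sub>R \<zeta> \<in> trace D"
    have rM: "norm (r *\<^sub>R \<zeta>) \<le> r * M" using r M by (simp add: mult_left_mono)
    also have "\<dots> < \<rho> / 2" using r \<eta>M \<open>0 < M\<close> by (smt (verit) mult_strict_right_mono)
    finally have "norm (\<gamma> i t + r *\<^sub>R \<zeta> - \<gamma> i t0) < \<rho>"
      using \<eta>2(2)[of t] t \<eta>(3) norm_triangle_ineq[of "\<gamma> i t - \<gamma> i t0" "r *\<^sub>R \<zeta>"] by (simp add: algebra_simps)
    then obtain t' where t': "\<bar>t' - t0\<bar> < \<eta>1" "\<gamma> i t + r *\<^sub>R \<zeta> = \<gamma> i t'" using \<rho>(2)[OF mem] by blast
    define d where "d = t' - t"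
    define e where "e = \<gamma> i t' - \<gamma> i t - d *\<^sub>R v"
    have e: "norm e \<le> \<kappa> * \<bar>d\<bar>" using \<eta>1(2)[of t' t] t' t \<eta>(2) by (simp add: e_def d_def)
    have eq: "r *\<^sub>R \<zeta> = d *\<^sub>R v + e" using t'(2) by (simp add: e_def algebra_simps)
    have "r * \<bar>plane_det v \<zeta>\<bar> = \<bar>plane_det v (r *\<^sub>R \<zeta>)\<bar>"
      using r by (simp add: plane_det_scaleR_right abs_mult)
    also have "\<dots> = \<bar>plane_det v e\<bar>"
      by (simp add: eq plane_det_add_right plane_det_scaleR_right plane_det_self)
    also have "\<dots> \<le> norm v * norm e" by (rule abs_plane_det_le)
    also have "\<dots> \<le> norm v * (\<kappa> * \<bar>d\<bar>)" using e by (intro mult_left_mono) auto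
    finally have 1: "r * \<bar>plane_det v \<zeta>\<bar> \<le> \<kappa> * (\<bar>d\<bar> * norm v)" by (simp add: mult_ac)
    have "\<bar>d\<bar> * norm v = norm (d *\<^sub>R v)" by simp
    also have "\<dots> \<le> norm (r *\<^sub>R \<zeta>) + norm e" using eq by (metis add_diff_cancel_right' norm_triangle_ineq4)
    also have "\<dots> \<le> r * M + \<kappa> * \<bar>d\<bar>" using rM e by simp
    also have "\<kappa> * \<bar>d\<bar> \<le> norm v / 2 * \<bar>d\<bar>" using \<kappa>(2) by (intro mult_right_mono) auto
    finally have "\<bar>d\<bar> * norm v \<le> 2 * (r * M)" by (simp add: algebra_simps)
    then have "\<kappa> * (\<bar>d\<bar> * norm v) \<le> \<kappa> * (2 * (r * M))" using \<kappa>(1) by (intro mult_left_mono) auto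
    also have "\<dots> = r * (\<kappa> * (4 * M)) / 2" by simp
    also have "\<dots> \<le> r * m / 2" using mult_left_mono[OF \<kappa>(3), of r] r by (simp add: mult_ac)
    finally have "r * \<bar>plane_det v \<zeta>\<bar> \<le> r * m / 2" using 1 by simp
    moreover have "r * m \<le> r * \<bar>plane_det v \<zeta>\<bar>" using m r by (simp add: v_def)
    moreover have "0 < r * m" using r \<open>0 < m\<close> by simp
    ultimately show False by linarith
  qed
qed

text \<open>
  The winding number of the components in \<open>X\<close> just to the left (\<open>\<sigma> = 1\<close>) or right (\<open>\<sigma> = -1\<close>) of a strand.
\<close>

definition side :: "nat set \<Rightarrow> real \<Rightarrow> nat \<Rightarrow> real \<Rightarrow> real" where
  "side X \<sigma> i t = Lim (at_right 0) (\<lambda>r. W X (\<gamma> i t + (r * \<sigma>) *\<^sub>R (\<i> * V i t)))"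

text \<open>All sufficiently short displacements of nearby points to one side of the strand sweep
  out a connected set missing the trace, so \<open>W X\<close> has one value there, whether the
  displacement is along the normal or along \<open>\<zeta>0\<close>.\<close>

lemma side_strip:
  assumes reg: "(i, frac t0) \<in> regular_params D" and X: "X \<subseteq> {..<n}" and \<sigma>: "\<sigma> = 1 \<or> \<sigma> = -1"
    and \<zeta>0: "\<sigma> * plane_det (V i t0) \<zeta>0 > 0"
  obtains \<eta> where "\<eta> > 0" "\<And>t. \<bar>t - t0\<bar> < \<eta> \<Longrightarrow> side X \<sigma> i t = side X \<sigma> i t0"
    "\<And>r. 0 < r \<Longrightarrow> r < \<eta> \<Longrightarrow> W X (\<gamma> i t0 + r *\<^sub>R \<zeta>0) = side X \<sigma> i t0"
proof -
  have i: "i < n" using reg by (auto simp: regular_params_def params_def)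
  define v where "v = V i t0"
  have v: "norm v > 0" using V_nz[OF i] by (simp add: v_def)
  \<comment> \<open>Chosen so that the convex set \<open>Z\<close> below contains both
    \<open>\<zeta>0\<close> and the normals at all parameters near \<open>t0\<close>; the normal at
    \<open>t0\<close> itself has determinant \<open>(norm v)\<^sup>2\<close> with \<open>v\<close>,
    twice the bound.\<close>
  define m where "m = min ((norm v)\<^sup>2 / 2) (\<sigma> * plane_det v \<zeta>0)"
  define M where "M = max (2 * norm v) (norm \<zeta>0)"
  have mM: "m > 0" "M > 0" using v \<zeta>0 by (auto simp: m_def M_def v_def less_max_iff_disj)
  obtain \<eta>1 where \<eta>1: "\<eta>1 > 0"
    "\<And>t r \<zeta>. \<bar>t - t0\<bar> < \<eta>1 \<Longrightarrow> 0 < r \<Longrightarrow> r < \<eta>1 \<Longrightarrow> m \<le> \<bar>plane_det v \<zeta>\<bar> \<Longrightarrow> norm \<zeta> \<le> M \<Longrightarrow>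
       \<gamma> i t + r *\<^sub>R \<zeta> \<notin> trace D"
    using strip_avoid[OF reg mM] unfolding v_def by metis
  define Z where "Z = {\<zeta>. m \<le> \<sigma> * plane_det v \<zeta>} \<inter> cball 0 M"
  have "convex {\<zeta>. m \<le> \<sigma> * plane_det v \<zeta>}"
  proof (rule convexI)
    fix x y :: complex and p q :: real
    assume *: "x \<in> {\<zeta>. m \<le> \<sigma> * plane_det v \<zeta>}" "y \<in> {\<zeta>. m \<le> \<sigma> * plane_det v \<zeta>}" "0 \<le> p" "0 \<le> q" "p + q = 1"
    have "p * m + q * m \<le> p * (\<sigma> * plane_det v x) + q * (\<sigma> * plane_det v y)"
      using * by (intro add_mono mult_left_mono) auto
    moreover have "p * m + q * m = m" using * by (metis distrib_right mult_1)
    ultimately show "p *\<^sub>R x + q *\<^sub>R y \<in> {\<zeta>. m \<le> \<sigma> * plane_det v \<zeta>}"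
      by (simp add: plane_det_add_right plane_det_scaleR_right algebra_simps)
  qed
  then have "convex Z" unfolding Z_def by (intro convex_Int convex_cball)
  define Q where "Q = (\<lambda>(t, r, \<zeta>). \<gamma> i t + r *\<^sub>R \<zeta>) ` ({t0 - \<eta>1<..<t0 + \<eta>1} \<times> {0<..<\<eta>1} \<times> Z)"
  have "connected Q" unfolding Q_def case_prod_unfold
    by (intro connected_continuous_image connected_Times convex_connected[OF \<open>convex Z\<close>] continuous_intros
        continuous_on_compose2[OF continuous_\<gamma>[OF i, of UNIV]]) auto
  have absdet: "\<sigma> * plane_det v \<zeta> \<le> \<bar>plane_det v \<zeta>\<bar>" for \<zeta> using \<sigma> by auto
  have "Q \<inter> trace D = {}"
  proof -
    have "\<gamma> i t + r *\<^sub>R \<zeta> \<notin> trace D" if "t \<in> {t0 - \<eta>1<..<t0 + \<eta>1}" "r \<in> {0<..<\<eta>1}" "\<zeta> \<in> Z" for t r \<zeta>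
      using that absdet[of \<zeta>] by (intro \<eta>1(2)) (auto simp: Z_def abs_less_iff)
    then show ?thesis by (auto simp: Q_def)
  qed
  note const0 = W_constant[OF X \<open>connected Q\<close> this]
  have const: "W X (\<gamma> i t + r *\<^sub>R \<zeta>) = W X (\<gamma> i t' + r' *\<^sub>R \<zeta>')"
    if "\<bar>t - t0\<bar> < \<eta>1" "0 < r" "r < \<eta>1" "\<zeta> \<in> Z" "\<bar>t' - t0\<bar> < \<eta>1" "0 < r'" "r' < \<eta>1" "\<zeta>' \<in> Z" for t r \<zeta> t' r' \<zeta>'
    by (intro const0) (use that in \<open>force simp: Q_def abs_less_iff\<close>)+
  have "((\<lambda>t. \<sigma> * plane_det v (\<sigma> *\<^sub>R (\<i> * V i t))) \<longlongrightarrow> \<sigma> * plane_det v (\<sigma> *\<^sub>R (\<i> * V i t0))) (at t0)"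
    using isCont_V[OF i, of t0] unfolding plane_det_def isCont_def by (intro tendsto_intros)
  moreover have "\<sigma> * plane_det v (\<sigma> *\<^sub>R (\<i> * V i t0)) = (norm v)\<^sup>2"
    using \<sigma> by (auto simp: plane_det_scaleR_right plane_det_ii v_def)
  moreover have "m < (norm v)\<^sup>2" using v by (simp add: m_def min_less_iff_disj)
  ultimately have ev1: "\<forall>\<^sub>F t in at t0. m < \<sigma> * plane_det v (\<sigma> *\<^sub>R (\<i> * V i t))"
    by (metis order_tendstoD(1))
  have "((\<lambda>t. norm (V i t)) \<longlongrightarrow> norm v) (at t0)"
    using isCont_V[OF i, of t0] unfolding v_def isCont_def by (intro tendsto_intros)
  then have ev2: "\<forall>\<^sub>F t in at t0. norm (V i t) < 2 * norm v"
    using v by (intro order_tendstoD(2)) auto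
  obtain \<eta>2 where \<eta>2: "\<eta>2 > 0" "\<And>t. t \<noteq> t0 \<Longrightarrow> \<bar>t - t0\<bar> < \<eta>2 \<Longrightarrow>
      m < \<sigma> * plane_det v (\<sigma> *\<^sub>R (\<i> * V i t)) \<and> norm (V i t) < 2 * norm v"
    using eventually_conj[OF ev1 ev2] unfolding eventually_at by (auto simp: dist_real_def)
  have inZ: "\<sigma> *\<^sub>R (\<i> * V i t) \<in> Z" if "\<bar>t - t0\<bar> < \<eta>2" for t
  proof -
    have "m < \<sigma> * plane_det v (\<sigma> *\<^sub>R (\<i> * V i t)) \<and> norm (V i t) < 2 * norm v"
      using \<eta>2(2)[of t] that v \<open>\<sigma> * plane_det v (\<sigma> *\<^sub>R (\<i> * V i t0)) = (norm v)\<^sup>2\<close> \<open>m < (norm v)\<^sup>2\<close>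
      by (cases "t = t0") (auto simp: v_def)
    then show ?thesis using \<sigma> by (auto simp: Z_def M_def norm_mult le_max_iff_disj)
  qed
  have \<zeta>0Z: "\<zeta>0 \<in> Z" by (auto simp: Z_def m_def M_def)
  define w where "w = W X (\<gamma> i t0 + (\<eta>1 / 2) *\<^sub>R \<zeta>0)"
  have side_eq: "side X \<sigma> i t = w" if "\<bar>t - t0\<bar> < min \<eta>1 \<eta>2" for t
    unfolding side_def
  proof (rule Lim_eventually_const)
    have "\<forall>\<^sub>F r in at_right 0. r \<in> {0<..<\<eta>1}"
      using \<eta>1(1) by (simp add: eventually_at_right_field) (metis)
    then show "\<forall>\<^sub>F r in at_right 0. W X (\<gamma> i t + (r * \<sigma>) *\<^sub>R (\<i> * V i t)) = w"
    proof eventually_elim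
      case (elim r)
      have "W X (\<gamma> i t + r *\<^sub>R (\<sigma> *\<^sub>R (\<i> * V i t))) = w"
        unfolding w_def using elim that inZ[of t] \<zeta>0Z \<eta>1(1) by (intro const) auto
      then show ?case by simp
    qed
  qed simp
  show ?thesis
  proof (rule that[of "min \<eta>1 \<eta>2"])
    show "side X \<sigma> i t = side X \<sigma> i t0" if "\<bar>t - t0\<bar> < min \<eta>1 \<eta>2" for t
      using side_eq[OF that] side_eq[of t0] \<eta>1(1) \<eta>2(1) by simp
    show "W X (\<gamma> i t0 + r *\<^sub>R \<zeta>0) = side X \<sigma> i t0" if "0 < r" "r < min \<eta>1 \<eta>2" for r
    proof -
      have "W X (\<gamma> i t0 + r *\<^sub>R \<zeta>0) = w"
        unfolding w_def using that \<zeta>0Z \<eta>1(1) by (intro const) auto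
      then show ?thesis using side_eq[of t0] \<eta>1(1) \<eta>2(1) by simp
    qed
  qed (use \<eta>1(1) \<eta>2(1) in auto)
qed

lemma side_locally_const:
  assumes "(i, frac t0) \<in> regular_params D" "X \<subseteq> {..<n}" "\<sigma> = 1 \<or> \<sigma> = -1"
  shows "\<forall>\<^sub>F t in at t0. side X \<sigma> i t = side X \<sigma> i t0"
proof -
  have i: "i < n" using assms(1) by (auto simp: regular_params_def params_def)
  have "\<sigma> * plane_det (V i t0) (\<sigma> *\<^sub>R (\<i> * V i t0)) > 0"
    using assms(3) V_nz[OF i] by (auto simp: plane_det_scaleR_right plane_det_ii)
  from side_strip[OF assms this] obtain \<eta> where "\<eta> > 0" "\<And>t. \<bar>t - t0\<bar> < \<eta> \<Longrightarrow> side X \<sigma> i t = side X \<sigma> i t0"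
    by metis
  then show ?thesis unfolding eventually_at dist_real_def by blast
qed

text \<open>Cross the strand along its left normal. The other curves stay away from the point, and
  \<open>\<gamma> i\<close> jumps by the sign of \<open>plane_det v (\<i> * v)\<close>, which is
  positive.\<close>

lemma side_jump:
  assumes reg: "(i, frac t0) \<in> regular_params D" and X: "X \<subseteq> {..<n}"
  shows "side X 1 i t0 - side X (-1) i t0 = of_bool (i \<in> X)"
proof -
  have i: "i < n" using reg by (auto simp: regular_params_def params_def)
  define u where "u = \<i> * V i t0"
  define y where "y r = \<gamma> i t0 + r *\<^sub>R u" for r
  have det: "plane_det (V i t0) u > 0" "(-1) * plane_det (V i t0) (- u) > 0"
    using V_nz[OF i] by (simp_all add: u_def plane_det_ii plane_det_minus_right)
  have ev_side: "\<forall>\<^sub>F r in at_right 0. W X (y (r * \<sigma>)) = side X \<sigma> i t0" if "\<sigma> = 1 \<or> \<sigma> = -1" for \<sigma>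
  proof -
    have "\<sigma> * plane_det (V i t0) (\<sigma> *\<^sub>R u) > 0" using that det by (auto simp: plane_det_def)
    from side_strip[OF reg X that this] obtain \<eta> where "\<eta> > 0"
      "\<And>r. 0 < r \<Longrightarrow> r < \<eta> \<Longrightarrow> W X (\<gamma> i t0 + r *\<^sub>R (\<sigma> *\<^sub>R u)) = side X \<sigma> i t0" by metis
    then show ?thesis unfolding eventually_at_right_field y_def by (intro exI[of _ \<eta>]) simp
  qed
  have Wy: "((\<lambda>r. W X (y r)) \<longlongrightarrow> side X 1 i t0) (at_right 0)"
    using ev_side[of 1] by (intro tendsto_eventually) simp
  have Wy': "((\<lambda>r. W X (y r)) \<longlongrightarrow> side X (-1) i t0) (at_left 0)"
    using ev_side[of "-1"] by (intro tendsto_eventually) (simp add: eventually_at_left_to_right)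
  have y: "(y has_vector_derivative u) (at 0)"
    unfolding y_def by (auto intro!: derivative_eq_intros)
  have lims: "\<exists>Lm Lp. ((\<lambda>r. wind (\<gamma> j) (y r)) \<longlongrightarrow> Lm) (at_left 0) \<and>
      ((\<lambda>r. wind (\<gamma> j) (y r)) \<longlongrightarrow> Lp) (at_right 0) \<and> Lp - Lm = of_bool (j = i)" if "j < n" for j
  proof (cases "j = i")
    case True
    have "\<exists>\<eta>>0. \<forall>r. 0 < r \<and> r < \<eta> \<longrightarrow> y r \<notin> trace D \<and> y (- r) \<notin> trace D"
    proof -
      obtain \<eta> where \<eta>: "\<eta> > 0" "\<And>t r \<zeta>. \<bar>t - t0\<bar> < \<eta> \<Longrightarrow> 0 < r \<Longrightarrow> r < \<eta> \<Longrightarrow>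
          plane_det (V i t0) u \<le> \<bar>plane_det (V i t0) \<zeta>\<bar> \<Longrightarrow> norm \<zeta> \<le> norm u \<Longrightarrow> \<gamma> i t + r *\<^sub>R \<zeta> \<notin> trace D"
        using strip_avoid[OF reg det(1), of "norm u"] V_nz[OF i] by (auto simp: u_def norm_mult)
      show ?thesis
        using \<eta>(2)[of t0 _ u] \<eta>(2)[of t0 _ "- u"] \<eta>(1) det
        by (intro exI[of _ \<eta>]) (auto simp: y_def plane_det_minus_right)
    qed
    then obtain \<eta> where \<eta>: "\<eta> > 0" "\<And>r. 0 < r \<Longrightarrow> r < \<eta> \<Longrightarrow> y r \<notin> trace D \<and> y (- r) \<notin> trace D"
      by blast
    have \<eta>': "y r \<notin> range (\<gamma> i)" if "r \<noteq> 0" "\<bar>r\<bar> < \<eta>" for r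
      using \<eta>(2)[of r] \<eta>(2)[of "- r"] that i by (cases "r > 0") (auto simp: trace_def)
    have off: "\<forall>\<^sub>F r in at 0. y r \<notin> range (\<gamma> i)"
      unfolding eventually_at dist_real_def using \<eta>(1) \<eta>' by (intro exI[of _ \<eta>]) simp
    have simple: "t - t0 \<in> \<int>" if "\<gamma> i t = \<gamma> i t0" for t
      using regular_unique[OF reg i that] by simp
    have "\<gamma> i t0 = y 0" by (simp add: y_def)
    from wind_jump[OF C1[OF i] per[OF i] simple y this off] det(1)
    have "\<exists>Lm Lp. ((\<lambda>r. wind (\<gamma> i) (y r)) \<longlongrightarrow> Lm) (at_left 0) \<and>
        ((\<lambda>r. wind (\<gamma> i) (y r)) \<longlongrightarrow> Lp) (at_right 0) \<and> Lp - Lm = 1"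
      by (simp add: sgn_if)
    then show ?thesis unfolding True by simp
  next
    case False
    have "closed (range (\<gamma> j))"
    proof -
      have "range (\<gamma> j) = \<gamma> j ` {0..1}"
      proof safe
        fix t
        have "\<gamma> j t = \<gamma> j (frac t)" "frac t \<in> {0..1}"
          using per_frac[OF that] frac_lt_1[of t] by (auto simp: less_imp_le)
        then show "\<gamma> j t \<in> \<gamma> j ` {0..1}" by blast
      qed auto
      then show ?thesis
        by (metis compact_Icc compact_continuous_image compact_imp_closed continuous_\<gamma>[OF that])
    qed
    moreover have "\<gamma> i t0 \<notin> range (\<gamma> j)" using regular_unique[OF reg that] False by force
    ultimately obtain e where e: "e > 0" "ball (\<gamma> i t0) e \<inter> range (\<gamma> j) = {}"
      unfolding disjoint_eq_subset_Compl by (metis ComplI open_Compl open_contains_ball)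
    have "(y \<longlongrightarrow> y 0) (at 0)"
      using has_vector_derivative_continuous[OF y] by (simp add: isCont_def)
    then have "\<forall>\<^sub>F r in at 0. dist (y r) (y 0) < e" using e(1) by (rule tendstoD)
    then have "\<forall>\<^sub>F r in at 0. wind (\<gamma> j) (y r) = wind (\<gamma> j) (y 0)"
    proof eventually_elim
      case (elim r)
      then show ?case
        using e by (intro wind_constant[OF C1[OF that] per[OF that], of "ball (\<gamma> i t0) e"])
          (auto simp: y_def dist_commute)
    qed
    then have "((\<lambda>r. wind (\<gamma> j) (y r)) \<longlongrightarrow> wind (\<gamma> j) (y 0)) (at 0)" by (rule tendsto_eventually)
    then show ?thesis
      using False by (auto intro!: exI[of _ "wind (\<gamma> j) (y 0)"] simp: filterlim_at_split)
  qed
  obtain Lm Lp where L: "\<And>j. j < n \<Longrightarrow> ((\<lambda>r. wind (\<gamma> j) (y r)) \<longlongrightarrow> Lm j) (at_left 0)"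
    "\<And>j. j < n \<Longrightarrow> ((\<lambda>r. wind (\<gamma> j) (y r)) \<longlongrightarrow> Lp j) (at_right 0)"
    "\<And>j. j < n \<Longrightarrow> Lp j - Lm j = of_bool (j = i)"
    using lims by metis
  have "((\<lambda>r. W X (y r)) \<longlongrightarrow> (\<Sum>j\<in>X. Lp j)) (at_right 0)" "((\<lambda>r. W X (y r)) \<longlongrightarrow> (\<Sum>j\<in>X. Lm j)) (at_left 0)"
    unfolding W_def using X by (auto intro!: tendsto_sum L)
  then have "side X 1 i t0 = (\<Sum>j\<in>X. Lp j)" "side X (-1) i t0 = (\<Sum>j\<in>X. Lm j)"
    using Wy Wy' tendsto_unique trivial_limit_at_left_real trivial_limit_at_right_real by blast+
  then have "side X 1 i t0 - side X (-1) i t0 = (\<Sum>j\<in>X. Lp j - Lm j)" by (simp add: sum_subtractf)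
  also have "\<dots> = (\<Sum>j\<in>X. of_bool (j = i))" using X by (intro sum.cong L(3)) auto
  also have "\<dots> = of_bool (i \<in> X)"
    using finite_subset[OF X] by (simp add: of_bool_def)
  finally show ?thesis .
qed

section \<open>Regions around a crossing\<close>

lemma strand_coords:
  assumes i: "i < n" and D0: "plane_det (V i s0) w \<noteq> 0"
  shows "\<exists>\<eta>>0. \<forall>s s'. \<bar>s - s0\<bar> < \<eta> \<longrightarrow> \<bar>s' - s0\<bar> < \<eta> \<longrightarrow>
     \<bar>plane_det (\<gamma> i s - \<gamma> i s') w / plane_det (V i s0) w - (s - s')\<bar> \<le> \<bar>s - s'\<bar> / 8 \<and>
     \<bar>plane_det (V i s0) (\<gamma> i s - \<gamma> i s') / plane_det (V i s0) w\<bar> \<le> \<bar>s - s'\<bar> / 8"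
proof -
  let ?v = "V i s0" let ?d = "plane_det ?v w"
  define N where "N = norm ?v + norm w"
  have N: "N > 0" using V_nz[OF i] by (simp add: N_def add_pos_nonneg)
  \<comment> \<open>The two quotients are the coordinates of a chord in the basis \<open>?v\<close>,
    \<open>w\<close>. Each is a determinant over \<open>?d\<close>, so an error of
    \<open>\<kappa>\<close> per unit of parameter becomes at most \<open>1/8\<close> in the
    coordinates.\<close>
  define \<kappa> where "\<kappa> = \<bar>?d\<bar> / (8 * N)"
  have \<kappa>: "\<kappa> > 0" using D0 N by (simp add: \<kappa>_def)
  obtain \<eta> where \<eta>: "\<eta> > 0"
    "\<And>t t'. \<bar>t - s0\<bar> \<le> \<eta> \<Longrightarrow> \<bar>t' - s0\<bar> \<le> \<eta> \<Longrightarrow> norm (\<gamma> i t - \<gamma> i t' - (t - t') *\<^sub>R ?v) \<le> \<kappa> * \<bar>t - t'\<bar>"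
    using C1_strict_derivative[OF C1[OF i] \<kappa>, of s0] by metis
  show ?thesis
  proof (intro exI[of _ \<eta>] conjI \<eta>(1) allI impI)
    fix s s' assume *: "\<bar>s - s0\<bar> < \<eta>" "\<bar>s' - s0\<bar> < \<eta>"
    define e where "e = \<gamma> i s - \<gamma> i s' - (s - s') *\<^sub>R ?v"
    have e: "norm e \<le> \<kappa> * \<bar>s - s'\<bar>" using \<eta>(2)[of s s'] * by (simp add: e_def)
    have eq: "\<gamma> i s - \<gamma> i s' = (s - s') *\<^sub>R ?v + e" by (simp add: e_def)
    have bd: "x / \<bar>?d\<bar> \<le> \<bar>s - s'\<bar> / 8" if "x \<le> norm e * y" "0 \<le> y" "y \<le> N" for x y
    proof -
      have "x \<le> norm e * N" using that by (smt (verit) mult_left_mono norm_ge_zero)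
      also have "\<dots> \<le> \<kappa> * \<bar>s - s'\<bar> * N" using e N by (intro mult_right_mono) auto
      also have "\<dots> = \<bar>?d\<bar> * \<bar>s - s'\<bar> / 8" using N by (simp add: \<kappa>_def)
      finally show ?thesis using D0 by (simp add: field_simps)
    qed
    have "plane_det (\<gamma> i s - \<gamma> i s') w / ?d - (s - s') = plane_det e w / ?d"
      using D0 by (simp add: eq plane_det_add_left plane_det_scaleR_left add_divide_distrib)
    then show "\<bar>plane_det (\<gamma> i s - \<gamma> i s') w / ?d - (s - s')\<bar> \<le> \<bar>s - s'\<bar> / 8"
      using bd[OF abs_plane_det_le[of e w]] by (simp add: abs_divide N_def)
    have "plane_det ?v (\<gamma> i s - \<gamma> i s') / ?d = plane_det ?v e / ?d"
      by (simp add: eq plane_det_add_right plane_det_scaleR_right plane_det_self)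
    moreover have e': "\<bar>plane_det ?v e\<bar> \<le> norm e * norm ?v"
      using abs_plane_det_le[of ?v e] by (simp add: mult.commute)
    then have "\<bar>plane_det ?v e\<bar> / \<bar>?d\<bar> \<le> \<bar>s - s'\<bar> / 8"
      using bd[of "\<bar>plane_det ?v e\<bar>" "norm ?v"] by (simp add: N_def)
    ultimately show "\<bar>plane_det ?v (\<gamma> i s - \<gamma> i s') / ?d\<bar> \<le> \<bar>s - s'\<bar> / 8"
      by (metis abs_divide)
  qed
qed

lemma double_det:
  assumes "double_pair D (i, frac s0) (j, frac t0)"
  shows "plane_det (V i s0) (V j t0) \<noteq> 0"
  using double_transverse[OF assms] double_pairD(1,2)[OF assms] by (simp add: vel_frac)

text \<open>In the affine chart given by the two tangents the strands are nearly the coordinate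
  axes, run through with nearly unit speed, and no other part of the diagram is near. The second
  strand is treated by exchanging the two tangents, which changes the sign of both determinants in
  each quotient.\<close>

lemma crossing_chart:
  assumes d: "double_pair D (i, frac s0) (j, frac t0)"
    and \<Delta>: "\<Delta> = plane_det (V i s0) (V j t0)"
    and \<alpha>: "\<And>x. \<alpha> x = plane_det x (V j t0) / \<Delta>" and \<beta>: "\<And>x. \<beta> x = plane_det (V i s0) x / \<Delta>"
  obtains \<eta> \<rho> where "\<eta> > 0" "\<rho> > 0"
    "\<And>s s'. \<bar>s - s0\<bar> < \<eta> \<Longrightarrow> \<bar>s' - s0\<bar> < \<eta> \<Longrightarrow>
       \<bar>\<alpha> (\<gamma> i s - \<gamma> i s') - (s - s')\<bar> \<le> \<bar>s - s'\<bar> / 8 \<and> \<bar>\<beta> (\<gamma> i s - \<gamma> i s')\<bar> \<le> \<bar>s - s'\<bar> / 8"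
    "\<And>t t'. \<bar>t - t0\<bar> < \<eta> \<Longrightarrow> \<bar>t' - t0\<bar> < \<eta> \<Longrightarrow>
       \<bar>\<alpha> (\<gamma> j t - \<gamma> j t')\<bar> \<le> \<bar>t - t'\<bar> / 8 \<and> \<bar>\<beta> (\<gamma> j t - \<gamma> j t') - (t - t')\<bar> \<le> \<bar>t - t'\<bar> / 8"
    "\<And>x. x \<in> trace D \<Longrightarrow> norm (x - \<gamma> i s0) < \<rho> \<Longrightarrow>
       (\<exists>s'. \<bar>s' - s0\<bar> < \<eta> \<and> x = \<gamma> i s') \<or> (\<exists>t'. \<bar>t' - t0\<bar> < \<eta> \<and> x = \<gamma> j t')"
proof -
  have ij: "i < n" "j < n" using double_pairD[OF d] by auto
  have det: "plane_det (V i s0) (V j t0) \<noteq> 0" by (rule double_det[OF d])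
  have det': "plane_det (V j t0) (V i s0) \<noteq> 0" using det plane_det_commute[of "V j t0" "V i s0"] by simp
  have swap: "plane_det (V j t0) x / plane_det (V j t0) (V i s0) = \<alpha> x"
    "plane_det x (V i s0) / plane_det (V j t0) (V i s0) = \<beta> x" for x
    by (simp_all add: \<alpha> \<beta> \<Delta> plane_det_commute[of "V j t0"] plane_det_commute[of x "V i s0"])
  have "\<exists>\<eta>>0. \<forall>s s'. \<bar>s - s0\<bar> < \<eta> \<longrightarrow> \<bar>s' - s0\<bar> < \<eta> \<longrightarrow>
       \<bar>\<alpha> (\<gamma> i s - \<gamma> i s') - (s - s')\<bar> \<le> \<bar>s - s'\<bar> / 8 \<and> \<bar>\<beta> (\<gamma> i s - \<gamma> i s')\<bar> \<le> \<bar>s - s'\<bar> / 8"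
    using strand_coords[OF ij(1) det] by (simp only: \<alpha> \<beta> \<Delta>)
  then obtain \<eta>1 where \<eta>1: "\<eta>1 > 0" "\<forall>s s'. \<bar>s - s0\<bar> < \<eta>1 \<longrightarrow> \<bar>s' - s0\<bar> < \<eta>1 \<longrightarrow>
       \<bar>\<alpha> (\<gamma> i s - \<gamma> i s') - (s - s')\<bar> \<le> \<bar>s - s'\<bar> / 8 \<and> \<bar>\<beta> (\<gamma> i s - \<gamma> i s')\<bar> \<le> \<bar>s - s'\<bar> / 8"
    by blast
  have "\<exists>\<eta>>0. \<forall>t t'. \<bar>t - t0\<bar> < \<eta> \<longrightarrow> \<bar>t' - t0\<bar> < \<eta> \<longrightarrow>
       \<bar>\<beta> (\<gamma> j t - \<gamma> j t') - (t - t')\<bar> \<le> \<bar>t - t'\<bar> / 8 \<and> \<bar>\<alpha> (\<gamma> j t - \<gamma> j t')\<bar> \<le> \<bar>t - t'\<bar> / 8"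
    using strand_coords[OF ij(2) det'] by (simp only: swap)
  then obtain \<eta>2 where \<eta>2: "\<eta>2 > 0" "\<forall>t t'. \<bar>t - t0\<bar> < \<eta>2 \<longrightarrow> \<bar>t' - t0\<bar> < \<eta>2 \<longrightarrow>
       \<bar>\<beta> (\<gamma> j t - \<gamma> j t') - (t - t')\<bar> \<le> \<bar>t - t'\<bar> / 8 \<and> \<bar>\<alpha> (\<gamma> j t - \<gamma> j t')\<bar> \<le> \<bar>t - t'\<bar> / 8"
    by blast
  define \<eta> where "\<eta> = min \<eta>1 \<eta>2"
  have \<eta>: "\<eta> > 0" using \<eta>1(1) \<eta>2(1) by (simp add: \<eta>_def)
  from local_crossing[OF d this] obtain \<rho> where \<rho>: "\<rho> > 0"
    "\<And>x. x \<in> trace D \<Longrightarrow> norm (x - \<gamma> i s0) < \<rho> \<Longrightarrow>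
       (\<exists>t'. \<bar>t' - s0\<bar> < \<eta> \<and> x = \<gamma> i t') \<or> (\<exists>t'. \<bar>t' - t0\<bar> < \<eta> \<and> x = \<gamma> j t')"
    by blast
  have le: "\<eta> \<le> \<eta>1" "\<eta> \<le> \<eta>2" by (simp_all add: \<eta>_def)
  show ?thesis
  proof (rule that[OF \<eta> \<rho>(1)])
    show "\<bar>\<alpha> (\<gamma> i s - \<gamma> i s') - (s - s')\<bar> \<le> \<bar>s - s'\<bar> / 8 \<and> \<bar>\<beta> (\<gamma> i s - \<gamma> i s')\<bar> \<le> \<bar>s - s'\<bar> / 8"
      if "\<bar>s - s0\<bar> < \<eta>" "\<bar>s' - s0\<bar> < \<eta>" for s s'
      using \<eta>1(2)[rule_format, of s s'] that le by simp
    show "\<bar>\<alpha> (\<gamma> j t - \<gamma> j t')\<bar> \<le> \<bar>t - t'\<bar> / 8 \<and> \<bar>\<beta> (\<gamma> j t - \<gamma> j t') - (t - t')\<bar> \<le> \<bar>t - t'\<bar> / 8"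
      if "\<bar>t - t0\<bar> < \<eta>" "\<bar>t' - t0\<bar> < \<eta>" for t t'
      using \<eta>2(2)[rule_format, of t t'] that le by simp
    show "(\<exists>s'. \<bar>s' - s0\<bar> < \<eta> \<and> x = \<gamma> i s') \<or> (\<exists>t'. \<bar>t' - t0\<bar> < \<eta> \<and> x = \<gamma> j t')"
      if "x \<in> trace D" "norm (x - \<gamma> i s0) < \<rho>" for x
      using \<rho>(2)[OF that] .
  qed
qed

text \<open>The signs \<open>\<epsilon>\<close> and \<open>\<epsilon>'\<close> name a quadrant at
  the crossing, bounded by the half strands of \<open>i\<close> and \<open>j\<close> in these
  directions. From a point of the first half strand one walks parallel to the second one into the
  quadrant, without meeting the diagram.\<close>

lemma corner_half:
  assumes d: "double_pair D (i, frac s0) (j, frac t0)" and X: "X \<subseteq> {..<n}"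
    and \<epsilon>: "\<epsilon> = 1 \<or> \<epsilon> = -1" and \<epsilon>': "\<epsilon>' = 1 \<or> \<epsilon>' = -1"
  shows "\<forall>\<^sub>F h in at_right 0. side X (\<epsilon>' * sgn (plane_det (V i s0) (V j t0))) i (s0 + \<epsilon> * h)
       = W X (\<gamma> i (s0 + \<epsilon> * h) + (\<epsilon>' * h) *\<^sub>R V j t0)"
proof -
  have ij: "i < n" "j < n" using double_pairD[OF d] by auto
  define \<Delta> where "\<Delta> = plane_det (V i s0) (V j t0)"
  have \<Delta>: "\<Delta> \<noteq> 0" using double_det[OF d] by (simp add: \<Delta>_def)
  define \<alpha> \<beta> where "\<alpha> x = plane_det x (V j t0) / \<Delta>" and "\<beta> x = plane_det (V i s0) x / \<Delta>" for x
  have lin: "\<alpha> (x + y) = \<alpha> x + \<alpha> y" "\<beta> (x + y) = \<beta> x + \<beta> y" "\<alpha> (r *\<^sub>R x) = r * \<alpha> x" "\<beta> (r *\<^sub>R x) = r * \<beta> x"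
    "\<alpha> (V j t0) = 0" "\<beta> (V j t0) = 1" for x y r
    using \<Delta> by (simp_all add: \<alpha>_def \<beta>_def plane_det_add_left plane_det_add_right plane_det_scaleR_left
        plane_det_scaleR_right plane_det_self add_divide_distrib flip: \<Delta>_def)
  obtain \<eta> \<rho> where \<eta>: "\<eta> > 0" and \<rho>: "\<rho> > 0" and
    I: "\<And>s s'. \<bar>s - s0\<bar> < \<eta> \<Longrightarrow> \<bar>s' - s0\<bar> < \<eta> \<Longrightarrow>
       \<bar>\<alpha> (\<gamma> i s - \<gamma> i s') - (s - s')\<bar> \<le> \<bar>s - s'\<bar> / 8 \<and> \<bar>\<beta> (\<gamma> i s - \<gamma> i s')\<bar> \<le> \<bar>s - s'\<bar> / 8" and
    J: "\<And>t t'. \<bar>t - t0\<bar> < \<eta> \<Longrightarrow> \<bar>t' - t0\<bar> < \<eta> \<Longrightarrow>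
       \<bar>\<alpha> (\<gamma> j t - \<gamma> j t')\<bar> \<le> \<bar>t - t'\<bar> / 8 \<and> \<bar>\<beta> (\<gamma> j t - \<gamma> j t') - (t - t')\<bar> \<le> \<bar>t - t'\<bar> / 8" and
    loc: "\<And>x. x \<in> trace D \<Longrightarrow> norm (x - \<gamma> i s0) < \<rho> \<Longrightarrow>
       (\<exists>s'. \<bar>s' - s0\<bar> < \<eta> \<and> x = \<gamma> i s') \<or> (\<exists>t'. \<bar>t' - t0\<bar> < \<eta> \<and> x = \<gamma> j t')"
    using crossing_chart[OF d \<Delta>_def \<alpha>_def \<beta>_def] by blast
  have x0: "\<gamma> j t0 = \<gamma> i s0" using d ij by (simp add: double_frac)
  have lim: "((\<lambda>h. s0 + \<epsilon> * h) \<longlongrightarrow> s0) (at_right 0)" by (auto intro!: tendsto_eq_intros)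
  have "filterlim (\<lambda>h. s0 + \<epsilon> * h) (at s0) (at_right 0)"
    unfolding filterlim_at using lim \<epsilon> by (auto simp: eventually_at_filter)
  from eventually_compose_filterlim[OF eventually_regular[OF ij(1)] this]
  have ev1: "\<forall>\<^sub>F h in at_right 0. (i, frac (s0 + \<epsilon> * h)) \<in> regular_params D" .
  have "((\<lambda>h. plane_det (V i (s0 + \<epsilon> * h)) (V j t0) * \<Delta>) \<longlongrightarrow> \<Delta> * \<Delta>) (at_right 0)"
    unfolding plane_det_def \<Delta>_def by (intro tendsto_intros isCont_tendsto_compose[OF isCont_V[OF ij(1)] lim])
  then have ev2: "\<forall>\<^sub>F h in at_right 0. plane_det (V i (s0 + \<epsilon> * h)) (V j t0) * \<Delta> > 0"
    using \<Delta> by (intro order_tendstoD(1)[where y = "\<Delta> * \<Delta>"]) (auto simp: zero_less_mult_iff linorder_neq_iff)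
  have "((\<lambda>h. norm (\<gamma> i (s0 + \<epsilon> * h) - \<gamma> i s0) + h * norm (V j t0)) \<longlongrightarrow> norm (\<gamma> i s0 - \<gamma> i s0) + 0 * norm (V j t0)) (at_right 0)"
    by (intro tendsto_intros isCont_tendsto_compose[OF isCont_\<gamma>[OF ij(1)] lim])
  then have ev3: "\<forall>\<^sub>F h in at_right 0. norm (\<gamma> i (s0 + \<epsilon> * h) - \<gamma> i s0) + h * norm (V j t0) < \<rho>"
    using \<rho> by (intro order_tendstoD(2)) auto
  have ev4: "\<forall>\<^sub>F h in at_right 0. 0 < h \<and> h < \<eta>"
    using \<eta> unfolding eventually_at_right_field by blast
  show ?thesis
    using ev1 ev2 ev3 ev4
  proof eventually_elim
    case (elim h)
    define s where "s = s0 + \<epsilon> * h"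
    have s: "\<bar>s - s0\<bar> < \<eta>" "\<bar>s - s0\<bar> = h" using \<epsilon> elim(4) by (auto simp: s_def)
    \<comment> \<open>The walk keeps the coordinate \<open>\<alpha>\<close>. On strand
      \<open>i\<close> this coordinate determines the point up to a contradiction in
      \<open>\<beta>\<close>; strand \<open>j\<close> attains a value of \<open>\<alpha>\<close>
      this large only at parameters where \<open>\<beta>\<close> is already far too large.\<close>
    have avoid: "\<gamma> i s + (\<epsilon>' * r) *\<^sub>R V j t0 \<notin> trace D" if r: "0 < r" "r \<le> h" for r
    proof
      assume mem: "\<gamma> i s + (\<epsilon>' * r) *\<^sub>R V j t0 \<in> trace D"
      let ?x = "\<gamma> i s + (\<epsilon>' * r) *\<^sub>R V j t0"
      have "norm (?x - \<gamma> i s0) \<le> norm (\<gamma> i s - \<gamma> i s0) + norm ((\<epsilon>' * r) *\<^sub>R V j t0)"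
        using norm_triangle_ineq[of "\<gamma> i s - \<gamma> i s0" "(\<epsilon>' * r) *\<^sub>R V j t0"] by (simp only: diff_add_eq)
      also have "norm ((\<epsilon>' * r) *\<^sub>R V j t0) \<le> h * norm (V j t0)"
        using r \<epsilon>' by (auto intro!: mult_right_mono)
      finally have "norm (?x - \<gamma> i s0) < \<rho>" using elim(3) by (simp add: s_def)
      from loc[OF mem this] consider s' where "\<bar>s' - s0\<bar> < \<eta>" "?x = \<gamma> i s'" | t' where "\<bar>t' - t0\<bar> < \<eta>" "?x = \<gamma> j t'"
        by blast
      then show False
      proof cases
        case 1
        then have "\<gamma> i s' - \<gamma> i s = (\<epsilon>' * r) *\<^sub>R V j t0" by (simp add: algebra_simps)
        from I[OF 1(1) s(1), unfolded this lin] have "\<bar>\<epsilon>' * r\<bar> \<le> 0" by argo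
        then show False using r \<epsilon>' by auto
      next
        case 2
        let ?d = "t' - t0"
        have eq: "\<gamma> j t' - \<gamma> j t0 = (\<gamma> i s - \<gamma> i s0) + (\<epsilon>' * r) *\<^sub>R V j t0"
          using 2(2) x0 by (simp add: algebra_simps)
        have "\<bar>\<alpha> (\<gamma> i s - \<gamma> i s0)\<bar> \<le> \<bar>?d\<bar> / 8" "\<bar>\<beta> (\<gamma> i s - \<gamma> i s0) + \<epsilon>' * r - ?d\<bar> \<le> \<bar>?d\<bar> / 8"
          using J[OF 2(1), of t0] \<eta> unfolding eq by (simp_all add: lin)
        moreover have "\<bar>\<alpha> (\<gamma> i s - \<gamma> i s0) - (s - s0)\<bar> \<le> h / 8" "\<bar>\<beta> (\<gamma> i s - \<gamma> i s0)\<bar> \<le> h / 8"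
          using I[OF s(1), of s0] \<eta> s(2) by simp_all
        moreover have "\<bar>\<epsilon>' * r\<bar> \<le> h" using r \<epsilon>' by auto
        ultimately show False using s(2) elim(4) by argo
      qed
    qed
    define \<sigma> where "\<sigma> = \<epsilon>' * sgn \<Delta>"
    have \<sigma>: "\<sigma> = 1 \<or> \<sigma> = -1" using \<epsilon>' \<Delta> by (auto simp: \<sigma>_def sgn_if)
    have "sgn \<Delta> * plane_det (V i s) (V j t0) > 0"
      using elim(2) by (auto simp: s_def sgn_if zero_less_mult_iff)
    then have "\<sigma> * plane_det (V i s) (\<epsilon>' *\<^sub>R V j t0) > 0"
      using \<epsilon>' by (auto simp: \<sigma>_def plane_det_scaleR_right)
    from side_strip[OF elim(1)[folded s_def] X \<sigma> this] obtain \<eta>' where \<eta>': "\<eta>' > 0"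
      "\<And>r. 0 < r \<Longrightarrow> r < \<eta>' \<Longrightarrow> W X (\<gamma> i s + r *\<^sub>R (\<epsilon>' *\<^sub>R V j t0)) = side X \<sigma> i s" by metis
    define r where "r = min (\<eta>' / 2) h"
    have r: "0 < r" "r < \<eta>'" "r \<le> h" using \<eta>'(1) elim(4) by (auto simp: r_def)
    have "side X \<sigma> i s = W X (\<gamma> i s + (\<epsilon>' * r) *\<^sub>R V j t0)"
      using \<eta>'(2)[OF r(1,2)] by (simp add: mult.commute)
    also have "\<dots> = W X (\<gamma> i s + (\<epsilon>' * h) *\<^sub>R V j t0)"
    proof (rule W_constant[OF X])
      show "connected ((\<lambda>r. \<gamma> i s + (\<epsilon>' * r) *\<^sub>R V j t0) ` {0<..h})"
        by (intro connected_continuous_image continuous_intros) auto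
      show "(\<lambda>r. \<gamma> i s + (\<epsilon>' * r) *\<^sub>R V j t0) ` {0<..h} \<inter> trace D = {}"
        using avoid by force
    qed (use r in auto)
    finally show ?case by (simp add: \<sigma>_def s_def \<Delta>_def)
  qed
qed

text \<open>Both half strands of a quadrant border the same region: the points reached from either
  of them by \<open>corner_half\<close> lie in a common convex set free of the diagram.\<close>

lemma corner:
  assumes d: "double_pair D (i, frac s0) (j, frac t0)" and X: "X \<subseteq> {..<n}"
    and \<epsilon>: "\<epsilon> = 1 \<or> \<epsilon> = -1" and \<epsilon>': "\<epsilon>' = 1 \<or> \<epsilon>' = -1"
  shows "\<forall>\<^sub>F h in at_right 0. side X (\<epsilon>' * sgn (plane_det (V i s0) (V j t0))) i (s0 + \<epsilon> * h)
       = side X (\<epsilon> * sgn (plane_det (V j t0) (V i s0))) j (t0 + \<epsilon>' * h)"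
proof -
  have ij: "i < n" "j < n" using double_pairD[OF d] by auto
  define \<Delta> where "\<Delta> = plane_det (V i s0) (V j t0)"
  have \<Delta>: "\<Delta> \<noteq> 0" using double_det[OF d] by (simp add: \<Delta>_def)
  define \<alpha> \<beta> where "\<alpha> x = plane_det x (V j t0) / \<Delta>" and "\<beta> x = plane_det (V i s0) x / \<Delta>" for x
  have lin: "\<alpha> (x + y) = \<alpha> x + \<alpha> y" "\<beta> (x + y) = \<beta> x + \<beta> y" "\<alpha> (r *\<^sub>R x) = r * \<alpha> x" "\<beta> (r *\<^sub>R x) = r * \<beta> x"
    "\<alpha> (V j t0) = 0" "\<beta> (V j t0) = 1" "\<alpha> (V i s0) = 1" "\<beta> (V i s0) = 0" for x y r
    using \<Delta> by (simp_all add: \<alpha>_def \<beta>_def plane_det_add_left plane_det_add_right plane_det_scaleR_left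
        plane_det_scaleR_right plane_det_self add_divide_distrib flip: \<Delta>_def)
  obtain \<eta> \<rho> where \<eta>: "\<eta> > 0" and \<rho>: "\<rho> > 0" and
    I: "\<And>s s'. \<bar>s - s0\<bar> < \<eta> \<Longrightarrow> \<bar>s' - s0\<bar> < \<eta> \<Longrightarrow>
       \<bar>\<alpha> (\<gamma> i s - \<gamma> i s') - (s - s')\<bar> \<le> \<bar>s - s'\<bar> / 8 \<and> \<bar>\<beta> (\<gamma> i s - \<gamma> i s')\<bar> \<le> \<bar>s - s'\<bar> / 8" and
    J: "\<And>t t'. \<bar>t - t0\<bar> < \<eta> \<Longrightarrow> \<bar>t' - t0\<bar> < \<eta> \<Longrightarrow>
       \<bar>\<alpha> (\<gamma> j t - \<gamma> j t')\<bar> \<le> \<bar>t - t'\<bar> / 8 \<and> \<bar>\<beta> (\<gamma> j t - \<gamma> j t') - (t - t')\<bar> \<le> \<bar>t - t'\<bar> / 8" and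
    loc: "\<And>x. x \<in> trace D \<Longrightarrow> norm (x - \<gamma> i s0) < \<rho> \<Longrightarrow>
       (\<exists>s'. \<bar>s' - s0\<bar> < \<eta> \<and> x = \<gamma> i s') \<or> (\<exists>t'. \<bar>t' - t0\<bar> < \<eta> \<and> x = \<gamma> j t')"
    using crossing_chart[OF d \<Delta>_def \<alpha>_def \<beta>_def] by blast
  have x0: "\<gamma> j t0 = \<gamma> i s0" using d ij by (simp add: double_frac)
  have lim: "((\<lambda>h. s0 + \<epsilon> * h) \<longlongrightarrow> s0) (at_right 0)" and lim': "((\<lambda>h. t0 + \<epsilon>' * h) \<longlongrightarrow> t0) (at_right 0)"
    by (auto intro!: tendsto_eq_intros)
  let ?X1 = "\<lambda>h. \<gamma> i (s0 + \<epsilon> * h) + (\<epsilon>' * h) *\<^sub>R V j t0"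
  let ?X2 = "\<lambda>h. \<gamma> j (t0 + \<epsilon>' * h) + (\<epsilon> * h) *\<^sub>R V i s0"
  have "(?X1 \<longlongrightarrow> \<gamma> i s0 + (\<epsilon>' * 0) *\<^sub>R V j t0) (at_right 0)" "(?X2 \<longlongrightarrow> \<gamma> j t0 + (\<epsilon> * 0) *\<^sub>R V i s0) (at_right 0)"
    by (intro tendsto_intros isCont_tendsto_compose[OF isCont_\<gamma>[OF ij(1)] lim]
        isCont_tendsto_compose[OF isCont_\<gamma>[OF ij(2)] lim'])+
  then have ev1: "\<forall>\<^sub>F h in at_right 0. ?X1 h \<in> ball (\<gamma> i s0) \<rho>" "\<forall>\<^sub>F h in at_right 0. ?X2 h \<in> ball (\<gamma> i s0) \<rho>"
    using \<rho> by (auto simp: tendsto_iff x0 dist_commute)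
  have ev2: "\<forall>\<^sub>F h in at_right 0. 0 < h \<and> h < \<eta>"
    using \<eta> unfolding eventually_at_right_field by blast
  have "\<forall>\<^sub>F h in at_right 0. W X (?X1 h) = W X (?X2 h)"
    using ev1 ev2
  proof eventually_elim
    case (elim h)
    define s t where "s = s0 + \<epsilon> * h" and "t = t0 + \<epsilon>' * h"
    have s: "\<bar>s - s0\<bar> < \<eta>" "\<bar>s - s0\<bar> = h" using \<epsilon> elim(3) by (auto simp: s_def)
    have t: "\<bar>t - t0\<bar> < \<eta>" "\<bar>t - t0\<bar> = h" using \<epsilon>' elim(3) by (auto simp: t_def)
    have eqs: "?X1 h - \<gamma> i s0 = (\<gamma> i s - \<gamma> i s0) + (t - t0) *\<^sub>R V j t0"
      "?X2 h - \<gamma> i s0 = (\<gamma> j t - \<gamma> j t0) + (s - s0) *\<^sub>R V i s0"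
      using x0 by (simp_all add: s_def t_def)
    \<comment> \<open>A box around the chart point \<open>(\<epsilon> * h, \<epsilon>' * h)\<close>.
      Its half width \<open>h / 8\<close> is the error allowed by the chart at distance
      \<open>h\<close>.\<close>
    define B where "B = {x. \<bar>\<alpha> (x - \<gamma> i s0) - (s - s0)\<bar> \<le> h / 8 \<and> \<bar>\<beta> (x - \<gamma> i s0) - (t - t0)\<bar> \<le> h / 8}"
    have mem: "?X1 h \<in> B" "?X2 h \<in> B"
      using I[OF s(1), of s0] J[OF t(1), of t0] \<eta> s t unfolding B_def mem_Collect_eq eqs by (simp_all add: lin)
    have "B \<inter> ball (\<gamma> i s0) \<rho> \<inter> trace D = {}"
    proof (rule ccontr)
      assume "\<not> ?thesis"
      then obtain x where x: "x \<in> B" "norm (x - \<gamma> i s0) < \<rho>" "x \<in> trace D"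
        by (auto simp: dist_norm norm_minus_commute)
      from loc[OF x(3,2)] consider s' where "\<bar>s' - s0\<bar> < \<eta>" "x = \<gamma> i s'" | t' where "\<bar>t' - t0\<bar> < \<eta>" "x = \<gamma> j t'"
        by blast
      then show False
      proof cases
        case 1
        let ?a = "\<alpha> (x - \<gamma> i s0)" let ?b = "\<beta> (x - \<gamma> i s0)" let ?d = "s' - s0"
        have f: "\<bar>?a - ?d\<bar> \<le> \<bar>?d\<bar> / 8" "\<bar>?b\<bar> \<le> \<bar>?d\<bar> / 8"
          "\<bar>?a - (s - s0)\<bar> \<le> h / 8" "\<bar>?b - (t - t0)\<bar> \<le> h / 8"
          using I[OF 1(1), of s0] 1(2) x(1) \<eta> unfolding B_def by simp_all
        \<comment> \<open>To have its small coordinate in the box, the strand would have to run at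
          least \<open>7 * h\<close> in parameter, and then its large coordinate is beyond the
          box.\<close>
        have "7 * h \<le> \<bar>?d\<bar>" using f(2,4) t(2) by argo
        moreover have "\<bar>?a\<bar> \<le> 9/8 * h" using f(3) s(2) by argo
        moreover have "7/8 * \<bar>?d\<bar> \<le> \<bar>?a\<bar>" using f(1) by argo
        ultimately show False using elim(3) by argo
      next
        case 2
        let ?a = "\<alpha> (x - \<gamma> i s0)" let ?b = "\<beta> (x - \<gamma> i s0)" let ?d = "t' - t0"
        have f: "\<bar>?a\<bar> \<le> \<bar>?d\<bar> / 8" "\<bar>?b - ?d\<bar> \<le> \<bar>?d\<bar> / 8"
          "\<bar>?a - (s - s0)\<bar> \<le> h / 8" "\<bar>?b - (t - t0)\<bar> \<le> h / 8"
          using J[OF 2(1), of t0] 2(2) x(1) x0 \<eta> unfolding B_def by simp_all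
        have "7 * h \<le> \<bar>?d\<bar>" using f(1,3) s(2) by argo
        moreover have "\<bar>?b\<bar> \<le> 9/8 * h" using f(4) t(2) by argo
        moreover have "7/8 * \<bar>?d\<bar> \<le> \<bar>?b\<bar>" using f(2) by argo
        ultimately show False using elim(3) by argo
      qed
    qed
    moreover have "convex (B \<inter> ball (\<gamma> i s0) \<rho>)"
    proof (intro convex_Int convex_ball)
      have "B = (+) (\<gamma> i s0) ` ({x. \<bar>\<alpha> x - (s - s0)\<bar> \<le> h / 8 \<and> \<bar>\<beta> x - (t - t0)\<bar> \<le> h / 8})"
        unfolding B_def by (auto intro!: image_eqI[where x = "x - \<gamma> i s0" for x])
      moreover have "convex {x. \<bar>\<alpha> x - (s - s0)\<bar> \<le> h / 8 \<and> \<bar>\<beta> x - (t - t0)\<bar> \<le> h / 8}"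
      proof -
        have "linear \<alpha>" "linear \<beta>" by (intro linearI; simp add: lin)+
        then have "convex (\<alpha> -` cball (s - s0) (h / 8) \<inter> \<beta> -` cball (t - t0) (h / 8))"
          by (intro convex_Int convex_linear_vimage convex_cball)
        moreover have "\<alpha> -` cball (s - s0) (h / 8) \<inter> \<beta> -` cball (t - t0) (h / 8)
            = {x. \<bar>\<alpha> x - (s - s0)\<bar> \<le> h / 8 \<and> \<bar>\<beta> x - (t - t0)\<bar> \<le> h / 8}"
          by (auto simp: dist_real_def abs_minus_commute)
        ultimately show ?thesis by simp
      qed
      ultimately show "convex B" by (simp add: convex_translation)
    qed
    ultimately show ?case
      using mem elim by (intro W_constant[OF X convex_connected, of "B \<inter> ball (\<gamma> i s0) \<rho>"]) auto
  qed
  with corner_half[OF d X \<epsilon> \<epsilon>'] corner_half[OF double_sym[OF d] X \<epsilon>' \<epsilon>]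
  show ?thesis by eventually_elim simp
qed

end

text \<open>Written with the factors \<open>- 1\<close> and \<open>1\<close> so as to match the
  points \<open>s0 + \<epsilon> * h\<close> of \<open>corner\<close>.\<close>

lemma eventually_at_right_0_shift:
  fixes s :: real
  shows "(\<forall>\<^sub>F x in at_left s. P x) \<longleftrightarrow> (\<forall>\<^sub>F h in at_right 0. P (s + - 1 * h))"
    and "(\<forall>\<^sub>F x in at_right s. P x) \<longleftrightarrow> (\<forall>\<^sub>F h in at_right 0. P (s + 1 * h))"
proof -
  show "(\<forall>\<^sub>F x in at_right s. P x) \<longleftrightarrow> (\<forall>\<^sub>F h in at_right 0. P (s + 1 * h))"
    by (subst at_right_to_0) (simp add: eventually_filtermap add.commute)
  have "(\<forall>\<^sub>F x in at_left s. P x) \<longleftrightarrow> (\<forall>\<^sub>F x in at_right (- s). P (- x))"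
    by (rule eventually_at_left_to_right)
  also have "\<dots> \<longleftrightarrow> (\<forall>\<^sub>F h in at_right 0. P (s + - 1 * h))"
    by (subst at_right_to_0) (simp add: eventually_filtermap)
  finally show "(\<forall>\<^sub>F x in at_left s. P x) \<longleftrightarrow> (\<forall>\<^sub>F h in at_right 0. P (s + - 1 * h))" .
qed

subsection \<open>Winding numbers along Seifert circles\<close>

text \<open>A term -1 in a vanishing sum of terms -1, 0, 1 has to be compensated by a term 1.
  Applied to passages with membership of the two strands in \<open>B\<close> as \<open>P\<close> and
  \<open>Q\<close>.\<close>

lemma exchange:
  fixes S :: "'b set" and P Q :: "'b \<Rightarrow> bool"
  assumes "finite S" and sum: "(\<Sum>p\<in>S. of_bool (Q p) - of_bool (P p)) = (0::real)"
    and p: "p \<in> S" "P p" "\<not> Q p"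
  shows "\<exists>p'\<in>S. Q p' \<and> \<not> P p'"
proof (rule ccontr)
  assume "\<not> ?thesis"
  then have nonneg: "of_bool (P x) - of_bool (Q x) \<ge> (0::real)" if "x \<in> S" for x
    using that by (cases "P x"; cases "Q x") auto
  have "(\<Sum>p\<in>S. of_bool (P p) - of_bool (Q p)) = (0::real)"
    using sum by (simp add: sum_subtractf)
  then have "of_bool (P p) - of_bool (Q p) = (0::real)"
    using sum_nonneg_0[of S "\<lambda>p. of_bool (P p) - of_bool (Q p) :: real" p] \<open>finite S\<close> nonneg p(1) by simp
  with p show False by simp
qed

section \<open>Functions that are constant on the arcs between passages\<close>

context diagram
begin

text \<open>The common frame for the winding numbers beside a strand, the indicators of Seifert
  circles and their products. No condition is imposed at passages, where only one-sided limits are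
  used.\<close>

definition locally_const :: "(nat \<Rightarrow> real \<Rightarrow> real) \<Rightarrow> bool" where
  "locally_const \<psi> \<longleftrightarrow> (\<forall>i<n. \<forall>t m. \<psi> i (t + of_int m) = \<psi> i t) \<and>
     (\<forall>i t. (i, frac t) \<in> regular_params D \<longrightarrow> (\<forall>\<^sub>F u in at t. \<psi> i u = \<psi> i t))"

text \<open>The value on the arc arriving at a parameter; \<open>out_lim\<close> is that on the arc
  leaving it.\<close>

definition in_lim :: "(nat \<Rightarrow> real \<Rightarrow> real) \<Rightarrow> nat \<Rightarrow> real \<Rightarrow> real" where
  "in_lim \<psi> i t = Lim (at_left t) (\<psi> i)"

definition out_lim :: "(nat \<Rightarrow> real \<Rightarrow> real) \<Rightarrow> nat \<Rightarrow> real \<Rightarrow> real" where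
  "out_lim \<psi> i t = Lim (at_right t) (\<psi> i)"

lemma locally_const_interval:
  assumes "locally_const \<psi>" "connected S" "\<And>u. u \<in> S \<Longrightarrow> (i, frac u) \<in> regular_params D" "a \<in> S" "b \<in> S"
  shows "\<psi> i a = \<psi> i b"
proof (rule connected_local_const[OF assms(2,4,5)], rule ballI)
  fix u assume "u \<in> S"
  then have "\<forall>\<^sub>F x in at u. \<psi> i x = \<psi> i u"
    using assms(1,3) by (simp add: locally_const_def)
  then have "\<forall>\<^sub>F x in at u within S. \<psi> i x = \<psi> i u"
    by (rule filter_leD[OF at_le, rotated]) simp
  then show "\<forall>\<^sub>F x in at u within S. \<psi> i u = \<psi> i x"
    by eventually_elim simp
qed

lemma eventually_in_lim:
  assumes \<psi>: "locally_const \<psi>" and i: "i < n"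
  shows "\<forall>\<^sub>F x in at_left t. \<psi> i x = in_lim \<psi> i t"
proof -
  have "\<forall>\<^sub>F u in at_left t. (i, frac u) \<in> regular_params D"
    by (rule filter_leD[OF at_le eventually_regular[OF i]]) simp
  then obtain b where b: "b < t" "\<And>u. b < u \<Longrightarrow> u < t \<Longrightarrow> (i, frac u) \<in> regular_params D"
    by (auto simp: eventually_at_left_field)
  have "\<psi> i u = \<psi> i ((b + t) / 2)" if "b < u" "u < t" for u
  proof (rule locally_const_interval[OF \<psi>, of "{b<..<t}"])
    show "(i, frac x) \<in> regular_params D" if "x \<in> {b<..<t}" for x using that b(2) by simp
  qed (use b(1) that in simp_all)
  then have ev: "\<forall>\<^sub>F x in at_left t. \<psi> i x = \<psi> i ((b + t) / 2)"
    using b(1) unfolding eventually_at_left_field by blast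
  then have "in_lim \<psi> i t = \<psi> i ((b + t) / 2)"
    unfolding in_lim_def by (rule Lim_eventually_const) simp
  with ev show ?thesis by simp
qed

lemma eventually_out_lim:
  assumes \<psi>: "locally_const \<psi>" and i: "i < n"
  shows "\<forall>\<^sub>F x in at_right t. \<psi> i x = out_lim \<psi> i t"
proof -
  have "\<forall>\<^sub>F u in at_right t. (i, frac u) \<in> regular_params D"
    by (rule filter_leD[OF at_le eventually_regular[OF i]]) simp
  then obtain b where b: "t < b" "\<And>u. t < u \<Longrightarrow> u < b \<Longrightarrow> (i, frac u) \<in> regular_params D"
    by (auto simp: eventually_at_right_field)
  have "\<psi> i u = \<psi> i ((b + t) / 2)" if "t < u" "u < b" for u
  proof (rule locally_const_interval[OF \<psi>, of "{t<..<b}"])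
    show "(i, frac x) \<in> regular_params D" if "x \<in> {t<..<b}" for x using that b(2) by simp
  qed (use b(1) that in simp_all)
  then have ev: "\<forall>\<^sub>F x in at_right t. \<psi> i x = \<psi> i ((b + t) / 2)"
    using b(1) unfolding eventually_at_right_field by blast
  then have "out_lim \<psi> i t = \<psi> i ((b + t) / 2)"
    unfolding out_lim_def by (rule Lim_eventually_const) simp
  with ev show ?thesis by simp
qed

lemma in_lim_eqI: "\<forall>\<^sub>F x in at_left t. \<psi> i x = d \<Longrightarrow> in_lim \<psi> i t = d"
  and out_lim_eqI: "\<forall>\<^sub>F x in at_right t. \<psi> i x = d \<Longrightarrow> out_lim \<psi> i t = d"
  unfolding in_lim_def out_lim_def by (rule Lim_eventually_const; simp)+

lemma in_lim_periodic: "in_lim \<psi> i (t + of_int m) = in_lim \<psi> i t"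
  and out_lim_periodic: "out_lim \<psi> i (t + of_int m) = out_lim \<psi> i t"
  if \<psi>: "locally_const \<psi>" and i: "i < n"
proof -
  have per: "\<psi> i (x + of_int m) = \<psi> i x" for x using \<psi> i by (simp add: locally_const_def)
  have sh: "\<psi> i (t + of_int m + c * h) = \<psi> i (t + c * h)" for c h
    using per[of "t + c * h"] by (simp add: add_ac)
  show "in_lim \<psi> i (t + of_int m) = in_lim \<psi> i t"
  proof (rule in_lim_eqI)
    show "\<forall>\<^sub>F x in at_left (t + of_int m). \<psi> i x = in_lim \<psi> i t"
      using eventually_in_lim[OF that, of t] unfolding eventually_at_right_0_shift(1) sh .
  qed
  show "out_lim \<psi> i (t + of_int m) = out_lim \<psi> i t"
  proof (rule out_lim_eqI)
    show "\<forall>\<^sub>F x in at_right (t + of_int m). \<psi> i x = out_lim \<psi> i t"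
      using eventually_out_lim[OF that, of t]
      unfolding eventually_at_right_0_shift(2)[of _ t] eventually_at_right_0_shift(2)[of _ "t + of_int m"] sh .
  qed
qed

lemma in_lim_frac: "in_lim \<psi> i (frac t) = in_lim \<psi> i t"
  and out_lim_frac: "out_lim \<psi> i (frac t) = out_lim \<psi> i t"
  if "locally_const \<psi>" "i < n"
  using in_lim_periodic[OF that, of "frac t" "\<lfloor>t\<rfloor>"] out_lim_periodic[OF that, of "frac t" "\<lfloor>t\<rfloor>"]
  by (simp_all add: frac_def)

lemma lims_regular:
  assumes "locally_const \<psi>" "(i, frac t) \<in> regular_params D"
  shows "in_lim \<psi> i t = \<psi> i t" "out_lim \<psi> i t = \<psi> i t"
proof -
  have ev: "\<forall>\<^sub>F u in at t. \<psi> i u = \<psi> i t" using assms by (simp add: locally_const_def)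
  show "in_lim \<psi> i t = \<psi> i t" "out_lim \<psi> i t = \<psi> i t"
    by (rule in_lim_eqI; rule filter_leD[OF at_le ev]; simp) (rule out_lim_eqI; rule filter_leD[OF at_le ev]; simp)
qed

lemma sum_jumps_arc:
  assumes \<psi>: "locally_const \<psi>" and i: "i < n" and "a \<le> b"
  shows "in_lim \<psi> i b - in_lim \<psi> i a
       = (\<Sum>t\<in>{t\<in>{a..<b}. (i, frac t) \<in> passages D}. out_lim \<psi> i t - in_lim \<psi> i t)"
  unfolding in_lim_def out_lim_def
proof (rule sum_of_jumps_Lim[OF \<open>a \<le> b\<close>])
  show "finite {t\<in>{a..<b}. (i, frac t) \<in> passages D}"
    by (rule finite_subset[OF _ finite_passage_times[of a b i]]) auto
  fix u
  show "\<exists>d. \<forall>\<^sub>F x in at_left u. \<psi> i x = d" "\<exists>d. \<forall>\<^sub>F x in at_right u. \<psi> i x = d"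
    using eventually_in_lim[OF \<psi> i] eventually_out_lim[OF \<psi> i] by blast+
  assume "u \<in> {a..<b} - {t\<in>{a..<b}. (i, frac t) \<in> passages D}"
  then have "(i, frac u) \<in> regular_params D" using i by (simp add: regular_params_def params_frac)
  from lims_regular[OF \<psi> this] show "Lim (at_left u) (\<psi> i) = Lim (at_right u) (\<psi> i)"
    by (simp add: in_lim_def out_lim_def)
qed auto

text \<open>On each circle the jumps over one period add up to zero, because the left limits at 0
  and 1 agree.\<close>

lemma sum_jumps_closed:
  assumes \<psi>: "locally_const \<psi>"
  shows "(\<Sum>(i, t)\<in>passages D. out_lim \<psi> i t) = (\<Sum>(i, t)\<in>passages D. in_lim \<psi> i t)"
proof -
  have eq: "passages D = Sigma {..<n} (\<lambda>i. {t\<in>{0..<1}. (i, frac t) \<in> passages D})"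
    using passages_params by (force simp: params_def frac_eq)
  have fin: "finite {t\<in>{0..<1}. (i, frac t) \<in> passages D}" for i
    by (rule finite_subset[OF _ finite_passage_times[of 0 1 i]]) auto
  have "(\<Sum>(i, t)\<in>passages D. out_lim \<psi> i t - in_lim \<psi> i t)
      = (\<Sum>i<n. \<Sum>t\<in>{t\<in>{0..<1}. (i, frac t) \<in> passages D}. out_lim \<psi> i t - in_lim \<psi> i t)"
    by (subst eq, subst sum.Sigma) (use fin in auto)
  also have "\<dots> = (\<Sum>i<n. in_lim \<psi> i 1 - in_lim \<psi> i 0)"
    using sum_jumps_arc[OF \<psi>, of _ 0 1] by simp
  also have "\<dots> = 0" using in_lim_periodic[OF \<psi>, of _ 0 1] by simp
  finally show ?thesis by (simp add: case_prod_unfold sum_subtractf)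
qed

section \<open>Passing through a crossing along the smoothing\<close>

definition partner :: "nat \<times> real \<Rightarrow> nat \<times> real" where
  "partner p = (THE q. double_pair D p q)"

lemma partner_eq: "double_pair D p q \<Longrightarrow> partner p = q"
  unfolding partner_def using double_unique by blast

lemma double_partner: assumes "p \<in> passages D" shows "double_pair D p (partner p)"
proof -
  obtain q where "double_pair D p q" using assms by (auto simp: passages_def)
  then show ?thesis using partner_eq by simp
qed

lemma sum_partner: "(\<Sum>p\<in>passages D. f (partner p)) = (\<Sum>p\<in>passages D. f p)"
proof (rule sum.reindex_bij_witness[of _ partner partner])
  have *: "partner (partner p) = p \<and> partner p \<in> passages D" if "p \<in> passages D" for p
    using double_sym[OF double_partner[OF that]] partner_eq[OF double_sym[OF double_partner[OF that]]]
    unfolding passages_def by blast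
  then show "p \<in> passages D \<Longrightarrow> partner (partner p) = p" "p \<in> passages D \<Longrightarrow> partner p \<in> passages D" for p
    by blast+
  then show "p \<in> passages D \<Longrightarrow> partner (partner p) = p" "p \<in> passages D \<Longrightarrow> partner p \<in> passages D" for p
    by blast+
qed auto

lemma locally_const_side:
  assumes "X \<subseteq> {..<n}" "\<sigma> = 1 \<or> \<sigma> = -1"
  shows "locally_const (side X \<sigma>)"
  unfolding locally_const_def using side_locally_const assms
  by (auto simp: side_def per_int V_per_int)

lemma sgn_det_cases: "double_pair D (i, s) (j, t) \<Longrightarrow>
   sgn (plane_det (vel D (i, s)) (vel D (j, t))) = 1 \<or> sgn (plane_det (vel D (i, s)) (vel D (j, t))) = -1"
  using double_transverse[of "(i, s)" "(j, t)"] by (auto simp: sgn_if)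

lemma sgn_det_swap: "sgn (plane_det z w) = - sgn (plane_det w z)"
  by (metis plane_det_commute sgn_minus)

text \<open>Two instances of \<open>corner\<close>. The first is the quadrant between arriving
  \<open>i\<close> and leaving \<open>j\<close>; it lies on the inner side \<open>\<tau>\<close> of
  the turn from \<open>i\<close> to \<open>j\<close>, left for \<open>\<tau> = 1\<close>. The second
  is the quadrant between the two arriving strands.\<close>

lemma side_limits_at_crossing:
  assumes d: "double_pair D (i, s) (j, t)" and X: "X \<subseteq> {..<n}"
    and \<tau>: "\<tau> = sgn (plane_det (vel D (i, s)) (vel D (j, t)))"
  shows side_smoothing: "out_lim (side X \<tau>) j t = in_lim (side X \<tau>) i s"
    and side_incoming: "in_lim (side X (- \<tau>)) i s = in_lim (side X \<tau>) j t"
proof -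
  have ij: "i < n" "j < n" and st: "frac s = s" "frac t = t" using double_pairD[OF d] by auto
  have d': "double_pair D (i, frac s) (j, frac t)" using d st by simp
  have \<tau>': "\<tau> = sgn (plane_det (V i s) (V j t))" "\<tau> = - sgn (plane_det (V j t) (V i s))"
    using \<tau> vel_frac[OF ij(1), of s] vel_frac[OF ij(2), of t] st sgn_det_swap by metis+
  have c: "1 * sgn (plane_det (V i s) (V j t)) = \<tau>" "- 1 * sgn (plane_det (V i s) (V j t)) = - \<tau>"
    "- 1 * sgn (plane_det (V j t) (V i s)) = \<tau>"
    using \<tau>' by simp_all
  have \<tau>1: "\<tau> = 1 \<or> \<tau> = -1" "- \<tau> = 1 \<or> - \<tau> = -1" using sgn_det_cases[OF d] \<tau> by auto
  note lc = locally_const_side[OF X \<tau>1(1)] locally_const_side[OF X \<tau>1(2)]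
  have "\<forall>\<^sub>F h in at_right 0. side X \<tau> i (s + - 1 * h) = side X \<tau> j (t + 1 * h)"
    using corner[OF d' X, of "- 1" 1] unfolding c by simp
  moreover have "\<forall>\<^sub>F h in at_right 0. side X \<tau> i (s + - 1 * h) = in_lim (side X \<tau>) i s"
    using eventually_in_lim[OF lc(1) ij(1), of s] unfolding eventually_at_right_0_shift(1) .
  ultimately have "\<forall>\<^sub>F h in at_right 0. side X \<tau> j (t + 1 * h) = in_lim (side X \<tau>) i s"
    by eventually_elim simp
  then have "\<forall>\<^sub>F x in at_right t. side X \<tau> j x = in_lim (side X \<tau>) i s"
    unfolding eventually_at_right_0_shift(2)[of _ t] .
  then show "out_lim (side X \<tau>) j t = in_lim (side X \<tau>) i s"
    by (rule out_lim_eqI)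
  have "\<forall>\<^sub>F h in at_right 0. side X (- \<tau>) i (s + - 1 * h) = side X \<tau> j (t + - 1 * h)"
    using corner[OF d' X, of "- 1" "- 1"] unfolding c by simp
  moreover have "\<forall>\<^sub>F h in at_right 0. side X (- \<tau>) i (s + - 1 * h) = in_lim (side X (- \<tau>)) i s"
    using eventually_in_lim[OF lc(2) ij(1), of s] unfolding eventually_at_right_0_shift(1) .
  ultimately have "\<forall>\<^sub>F h in at_right 0. side X \<tau> j (t + - 1 * h) = in_lim (side X (- \<tau>)) i s"
    by eventually_elim simp
  then have "\<forall>\<^sub>F x in at_left t. side X \<tau> j x = in_lim (side X (- \<tau>)) i s"
    unfolding eventually_at_right_0_shift(1) .
  then show "in_lim (side X (- \<tau>)) i s = in_lim (side X \<tau>) j t"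
    by (rule in_lim_eqI[symmetric])
qed

lemma side_lim_jump:
  assumes X: "X \<subseteq> {..<n}" and i: "i < n" and \<sigma>: "\<sigma> = 1 \<or> \<sigma> = -1"
  shows "in_lim (side X \<sigma>) i t = in_lim (side X (- \<sigma>)) i t + \<sigma> * of_bool (i \<in> X)"
    and "out_lim (side X \<sigma>) i t = out_lim (side X (- \<sigma>)) i t + \<sigma> * of_bool (i \<in> X)"
proof -
  have \<sigma>': "- \<sigma> = 1 \<or> - \<sigma> = -1" using \<sigma> by auto
  note lc = locally_const_side[OF X \<sigma>] locally_const_side[OF X \<sigma>']
  have reg: "\<forall>\<^sub>F u in at t. side X \<sigma> i u = side X (- \<sigma>) i u + \<sigma> * of_bool (i \<in> X)"
    using eventually_regular[OF i]
  proof eventually_elim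
    case (elim u)
    from side_jump[OF elim X] \<sigma> show ?case by auto
  qed
  have "\<forall>\<^sub>F u in at_left t. side X \<sigma> i u = side X (- \<sigma>) i u + \<sigma> * of_bool (i \<in> X)"
    by (rule filter_leD[OF at_le reg]) simp
  with eventually_in_lim[OF lc(2) i]
  have "\<forall>\<^sub>F u in at_left t. side X \<sigma> i u = in_lim (side X (- \<sigma>)) i t + \<sigma> * of_bool (i \<in> X)"
    by (eventually_elim) simp
  then show "in_lim (side X \<sigma>) i t = in_lim (side X (- \<sigma>)) i t + \<sigma> * of_bool (i \<in> X)"
    by (rule in_lim_eqI)
  have "\<forall>\<^sub>F u in at_right t. side X \<sigma> i u = side X (- \<sigma>) i u + \<sigma> * of_bool (i \<in> X)"
    by (rule filter_leD[OF at_le reg]) simp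
  with eventually_out_lim[OF lc(2) i]
  have "\<forall>\<^sub>F u in at_right t. side X \<sigma> i u = out_lim (side X (- \<sigma>)) i t + \<sigma> * of_bool (i \<in> X)"
    by (eventually_elim) simp
  then show "out_lim (side X \<sigma>) i t = out_lim (side X (- \<sigma>)) i t + \<sigma> * of_bool (i \<in> X)"
    by (rule out_lim_eqI)
qed

text \<open>On the inner side of the turn the region stays the same. The outer side is compared with
  it across arriving \<open>i\<close> and across leaving \<open>j\<close>, where the numbering of
  \<open>X\<close> steps only if the strand belongs to \<open>X\<close>.\<close>

lemma side_change_at_smoothing:
  assumes d: "double_pair D (i, s) (j, t)" and X: "X \<subseteq> {..<n}" and \<sigma>: "\<sigma> = 1 \<or> \<sigma> = -1"
  shows "out_lim (side X \<sigma>) j t - in_lim (side X \<sigma>) i s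
     = (if sgn (plane_det (vel D (i, s)) (vel D (j, t))) = \<sigma> then 0 else \<sigma> * (of_bool (j \<in> X) - of_bool (i \<in> X)))"
proof -
  have ij: "i < n" "j < n" using double_pairD[OF d] by auto
  define \<tau> where "\<tau> = sgn (plane_det (vel D (i, s)) (vel D (j, t)))"
  have \<tau>: "\<tau> = 1 \<or> \<tau> = -1" using sgn_det_cases[OF d] by (simp add: \<tau>_def)
  show ?thesis
  proof (cases "\<tau> = \<sigma>")
    case True
    then show ?thesis using side_smoothing[OF d X \<tau>_def] by (simp add: \<tau>_def)
  next
    case False
    then have "\<tau> = - \<sigma>" using \<sigma> \<tau> by auto
    then show ?thesis
      using side_smoothing[OF d X \<tau>_def] side_lim_jump[OF X ij(1) \<sigma>, of s] side_lim_jump[OF X ij(2) \<sigma>, of t] False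
      by (simp add: algebra_simps flip: \<tau>_def)
  qed
qed

lemma locally_const_frac:
  assumes "locally_const \<psi>" "i < n"
  shows "\<psi> i (frac t) = \<psi> i t"
proof -
  have "\<psi> i (frac t + of_int \<lfloor>t\<rfloor>) = \<psi> i (frac t)"
    using assms unfolding locally_const_def by blast
  then show ?thesis by (simp add: frac_def)
qed

lemma regular_before:
  assumes "i < n"
  obtains a where "a < s" "\<And>u. u \<in> {a..<s} \<Longrightarrow> (i, frac u) \<in> regular_params D"
proof -
  have "\<forall>\<^sub>F u in at_left s. (i, frac u) \<in> regular_params D"
    by (rule filter_leD[OF at_le eventually_regular[OF assms]]) simp
  then obtain b where b: "b < s" "\<And>u. b < u \<Longrightarrow> u < s \<Longrightarrow> (i, frac u) \<in> regular_params D"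
    by (auto simp: eventually_at_left_field)
  show ?thesis by (rule that[of "(b + s) / 2"]) (use b in auto)
qed

lemma regular_after:
  assumes "i < n"
  obtains b where "s < b" "\<And>u. u \<in> {s<..b} \<Longrightarrow> (i, frac u) \<in> regular_params D"
proof -
  have "\<forall>\<^sub>F u in at_right s. (i, frac u) \<in> regular_params D"
    by (rule filter_leD[OF at_le eventually_regular[OF assms]]) simp
  then obtain b where b: "s < b" "\<And>u. s < u \<Longrightarrow> u < b \<Longrightarrow> (i, frac u) \<in> regular_params D"
    by (auto simp: eventually_at_right_field)
  show ?thesis by (rule that[of "(b + s) / 2"]) (use b in auto)
qed

lemma in_lim_eq:
  assumes \<psi>: "locally_const \<psi>" and "a < s" and reg: "\<And>u. u \<in> {a..<s} \<Longrightarrow> (i, frac u) \<in> regular_params D"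
  shows "in_lim \<psi> i s = \<psi> i a"
proof (rule in_lim_eqI)
  have "\<psi> i u = \<psi> i a" if "a < u" "u < s" for u
    using that \<open>a < s\<close> by (intro locally_const_interval[OF \<psi> _ reg, of "{a..<s}"]) auto
  then show "\<forall>\<^sub>F u in at_left s. \<psi> i u = \<psi> i a"
    unfolding eventually_at_left_field using \<open>a < s\<close> by blast
qed

lemma out_lim_eq:
  assumes \<psi>: "locally_const \<psi>" and "s < b" and reg: "\<And>u. u \<in> {s<..b} \<Longrightarrow> (i, frac u) \<in> regular_params D"
  shows "out_lim \<psi> i s = \<psi> i b"
proof (rule out_lim_eqI)
  have "\<psi> i u = \<psi> i b" if "s < u" "u < b" for u
    using that \<open>s < b\<close> by (intro locally_const_interval[OF \<psi> _ reg, of "{s<..b}"]) auto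
  then show "\<forall>\<^sub>F u in at_right s. \<psi> i u = \<psi> i b"
    unfolding eventually_at_right_field using \<open>s < b\<close> by blast
qed

lemma locally_const_mult:
  assumes "locally_const \<psi>" "locally_const \<phi>"
  shows "locally_const (\<lambda>i t. \<psi> i t * \<phi> i t)"
  unfolding locally_const_def
proof (intro conjI allI impI)
  fix i t assume "(i, frac t) \<in> regular_params D"
  then have "\<forall>\<^sub>F u in at t. \<psi> i u = \<psi> i t" "\<forall>\<^sub>F u in at t. \<phi> i u = \<phi> i t"
    using assms unfolding locally_const_def by blast+
  then show "\<forall>\<^sub>F u in at t. \<psi> i u * \<phi> i u = \<psi> i t * \<phi> i t" by eventually_elim simp
qed (use assms in \<open>simp add: locally_const_def\<close>)

lemma lim_mult:
  assumes "locally_const \<psi>" "locally_const \<phi>" "i < n"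
  shows "in_lim (\<lambda>i t. \<psi> i t * \<phi> i t) i t = in_lim \<psi> i t * in_lim \<phi> i t"
    and "out_lim (\<lambda>i t. \<psi> i t * \<phi> i t) i t = out_lim \<psi> i t * out_lim \<phi> i t"
proof -
  show "in_lim (\<lambda>i t. \<psi> i t * \<phi> i t) i t = in_lim \<psi> i t * in_lim \<phi> i t"
    by (rule in_lim_eqI, rule eventually_elim2[OF eventually_in_lim[OF assms(1,3), of t] eventually_in_lim[OF assms(2,3), of t]]) simp
  show "out_lim (\<lambda>i t. \<psi> i t * \<phi> i t) i t = out_lim \<psi> i t * out_lim \<phi> i t"
    by (rule out_lim_eqI, rule eventually_elim2[OF eventually_out_lim[OF assms(1,3), of t] eventually_out_lim[OF assms(2,3), of t]]) simp
qed

section \<open>Seifert circles through their indicator functions\<close>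

lemma seifert_mem:
  assumes "C \<in> seifert_circles D" "x \<in> C"
  shows "y \<in> C \<longleftrightarrow> y \<in> regular_params D \<and> equivclp (seifert_step D) x y"
proof -
  from assms obtain z where "C = {y. z \<in> regular_params D \<and> y \<in> regular_params D \<and> equivclp (seifert_step D) z y}"
    by (auto simp: seifert_circles_def quotient_def)
  with assms(2) show ?thesis by (auto intro: equivclp_trans equivclp_sym)
qed

lemma ex_seifert: "x \<in> regular_params D \<Longrightarrow> \<exists>C\<in>seifert_circles D. x \<in> C"
  unfolding seifert_circles_def quotient_def by (auto intro!: bexI[of _ x])

lemma seifert_step_mem:
  assumes "C \<in> seifert_circles D" "seifert_step D x y" "x \<in> regular_params D" "y \<in> regular_params D"
  shows "x \<in> C \<longleftrightarrow> y \<in> C"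
  using seifert_mem[OF assms(1), of x y] seifert_mem[OF assms(1), of y x] assms(3,4)
    r_into_equivclp[of "seifert_step D", OF assms(2)] converse_r_into_equivclp[of "seifert_step D", OF assms(2)] by auto

text \<open>As a locally constant function, a Seifert circle can be multiplied with a winding
  number, which restricts sums over all passages to this circle.\<close>

definition ind :: "(nat \<times> real) set \<Rightarrow> nat \<Rightarrow> real \<Rightarrow> real" where
  "ind C i t = of_bool ((i, frac t) \<in> C)"

lemma locally_const_ind:
  assumes C: "C \<in> seifert_circles D"
  shows "locally_const (ind C)"
  unfolding locally_const_def
proof (intro conjI allI impI)
  fix i t assume reg: "(i, frac t) \<in> regular_params D"
  then have i: "i < n" by (auto simp: regular_params_def params_def)
  obtain a where a: "a < t" "\<And>u. u \<in> {a..<t} \<Longrightarrow> (i, frac u) \<in> regular_params D"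
    using regular_before[OF i] by blast
  obtain b where b: "t < b" "\<And>u. u \<in> {t<..b} \<Longrightarrow> (i, frac u) \<in> regular_params D"
    using regular_after[OF i] by blast
  have ab: "(i, frac u) \<in> regular_params D" if "u \<in> {a..b}" for u
    using a(2)[of u] b(2)[of u] reg that by (cases u t rule: linorder_cases) auto
  have "\<forall>\<^sub>F u in at t. u \<in> {a<..<b}"
    using a(1) b(1) by (intro eventually_at_in_open') auto
  then show "\<forall>\<^sub>F u in at t. ind C i u = ind C i t"
  proof eventually_elim
    case (elim u)
    have "seifert_step D (i, frac (min u t)) (i, frac (max u t))"
      by (rule seifert_step.along) (use elim a(1) b(1) in \<open>auto intro!: ab simp: min_def max_def split: if_splits\<close>)
    from seifert_step_mem[OF C this] have "(i, frac (min u t)) \<in> C \<longleftrightarrow> (i, frac (max u t)) \<in> C"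
      using elim a(1) b(1) ab[of "min u t"] ab[of "max u t"] by simp
    then show ?case by (cases "u \<le> t") (auto simp: ind_def min_def max_def)
  qed
qed (simp add: ind_def frac_def)

lemma enters_iff:
  assumes C: "C \<in> seifert_circles D" and i: "i < n"
  shows "in_lim (ind C) i s = of_bool (enters C (i, s))"
proof -
  have ev: "\<forall>\<^sub>F u in at_left s. of_bool ((i, frac u) \<in> C) = in_lim (ind C) i s"
    using eventually_in_lim[OF locally_const_ind[OF C] i] by (simp add: ind_def)
  show ?thesis
  proof (cases "enters C (i, s)")
    case True
    then have "\<forall>\<^sub>F u in at_left s. (i, frac u) \<in> C" by (simp add: enters_def)
    then have "\<forall>\<^sub>F u in at_left s. ind C i u = 1" by eventually_elim (simp add: ind_def)
    with True show ?thesis using in_lim_eqI by fastforce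
  next
    case False
    have "in_lim (ind C) i s \<noteq> 1"
    proof
      assume "in_lim (ind C) i s = 1"
      with ev have "\<forall>\<^sub>F u in at_left s. (i, frac u) \<in> C"
        by (auto elim!: eventually_mono)
      with False show False by (simp add: enters_def)
    qed
    moreover obtain u where "of_bool ((i, frac u) \<in> C) = in_lim (ind C) i s"
      using eventually_happens'[OF _ ev] by auto
    ultimately show ?thesis using False by (cases "(i, frac u) \<in> C") auto
  qed
qed

lemma ind_smoothing:
  assumes C: "C \<in> seifert_circles D" and d: "double_pair D (i, s) (j, t)"
  shows "out_lim (ind C) j t = in_lim (ind C) i s"
proof -
  have ij: "i < n" "j < n" using double_pairD[OF d] by auto
  obtain a where a: "a < s" "\<And>u. u \<in> {a..<s} \<Longrightarrow> (i, frac u) \<in> regular_params D"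
    using regular_before[OF ij(1)] by blast
  obtain b where b: "t < b" "\<And>u. u \<in> {t<..b} \<Longrightarrow> (j, frac u) \<in> regular_params D"
    using regular_after[OF ij(2)] by blast
  have "seifert_step D (i, frac a) (j, frac b)"
    by (rule seifert_step.smoothing[OF d a(1) b(1) a(2) b(2)])
  from seifert_step_mem[OF C this] a b have "(i, frac a) \<in> C \<longleftrightarrow> (j, frac b) \<in> C" by simp
  moreover have "in_lim (ind C) i s = ind C i a" by (rule in_lim_eq[OF locally_const_ind[OF C] a])
  moreover have "out_lim (ind C) j t = ind C j b" by (rule out_lim_eq[OF locally_const_ind[OF C] b])
  ultimately show ?thesis by (simp add: ind_def)
qed

lemma ex_enters:
  assumes i: "i < n"
  shows "\<exists>C\<in>seifert_circles D. enters C (i, s)"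
proof -
  obtain a where a: "a < s" "\<And>u. u \<in> {a..<s} \<Longrightarrow> (i, frac u) \<in> regular_params D"
    using regular_before[OF i] by blast
  obtain C where C: "C \<in> seifert_circles D" "(i, frac a) \<in> C"
    using ex_seifert[of "(i, frac a)"] a by auto
  have "in_lim (ind C) i s = 1" using in_lim_eq[OF locally_const_ind[OF C(1)] a] C(2) by (simp add: ind_def)
  then show ?thesis using enters_iff[OF C(1) i] C(1) by (intro bexI[of _ C]) (auto split: if_splits)
qed

text \<open>
  The jump of \<open>side X \<sigma>\<close> along the smoothed curve \<open>C\<close>, summed over all corners of \<open>C\<close>, vanishes; it is
  nonzero only at corners which lie on the other side and where \<open>C\<close> passes between \<open>X\<close> and its complement.
\<close>

lemma balance:
  assumes C: "C \<in> seifert_circles D" and X: "X \<subseteq> {..<n}" and \<sigma>: "\<sigma> = 1 \<or> \<sigma> = -1"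
  shows "(\<Sum>p\<in>{p\<in>passages D. enters C p \<and> sgn (plane_det (vel D p) (vel D (partner p))) = - \<sigma>}.
           of_bool (fst (partner p) \<in> X) - of_bool (fst p \<in> X)) = (0::real)"
proof -
  note lc = locally_const_ind[OF C] locally_const_side[OF X \<sigma>]
  let ?\<psi> = "\<lambda>i t. ind C i t * side X \<sigma> i t"
  let ?c = "\<lambda>p. of_bool (fst (partner p) \<in> X) - of_bool (fst p \<in> X) :: real"
  let ?P = "\<lambda>p. enters C p \<and> sgn (plane_det (vel D p) (vel D (partner p))) = - \<sigma>"
  \<comment> \<open>The total of leaving values equals that of arriving values. Reindexing the
    former by \<open>partner\<close> pairs each arriving strand with the strand on which the
    smoothed curve goes on; both carry the same indicator, so each term is a change of
    \<open>side X \<sigma>\<close> along \<open>C\<close>.\<close>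
  have "(\<Sum>p\<in>passages D. out_lim ?\<psi> (fst (partner p)) (snd (partner p)) - in_lim ?\<psi> (fst p) (snd p)) = 0"
    using sum_jumps_closed[OF locally_const_mult[OF lc]]
      sum_partner[of "\<lambda>p. out_lim ?\<psi> (fst p) (snd p)"]
    by (simp add: sum_subtractf case_prod_unfold)
  also have "(\<Sum>p\<in>passages D. out_lim ?\<psi> (fst (partner p)) (snd (partner p)) - in_lim ?\<psi> (fst p) (snd p))
      = (\<Sum>p\<in>passages D. if ?P p then \<sigma> * ?c p else 0)"
  proof (rule sum.cong[OF refl])
    fix p assume p: "p \<in> passages D"
    obtain i s j t where eq: "p = (i, s)" "partner p = (j, t)" by (cases p, cases "partner p")
    have eq': "partner (i, s) = (j, t)" using eq by simp
    have d: "double_pair D (i, s) (j, t)" using double_partner[OF p] eq by simp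
    have ij: "i < n" "j < n" using double_pairD[OF d] by auto
    have "out_lim ?\<psi> j t - in_lim ?\<psi> i s = of_bool (enters C p) * (out_lim (side X \<sigma>) j t - in_lim (side X \<sigma>) i s)"
      by (simp add: lim_mult[OF lc] ij ind_smoothing[OF C d] enters_iff[OF C] eq algebra_simps)
    also have "\<dots> = (if ?P p then \<sigma> * ?c p else 0)"
      using side_change_at_smoothing[OF d X \<sigma>] sgn_det_cases[OF d] \<sigma> by (auto simp: eq(1) eq')
    finally show "out_lim ?\<psi> (fst (partner p)) (snd (partner p)) - in_lim ?\<psi> (fst p) (snd p)
        = (if ?P p then \<sigma> * ?c p else 0)" unfolding eq(1) eq' fst_conv snd_conv .
  qed
  also have "\<dots> = \<sigma> * (\<Sum>p\<in>{p\<in>passages D. ?P p}. ?c p)"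
    using finite_passages by (auto simp: sum.inter_filter sum_distrib_left intro!: sum.cong)
  finally show ?thesis using \<sigma> by auto
qed

section \<open>The winding number of the whole diagram as level of a Seifert circle\<close>

abbreviation level :: "nat \<Rightarrow> real \<Rightarrow> real" where "level \<equiv> side {..<n} 1"

lemma locally_const_level: "locally_const level"
  by (rule locally_const_side) auto

text \<open>Both strands belong to the full set of components, so the change in
  \<open>side_change_at_smoothing\<close> vanishes on the outer side of a turn as well.\<close>

lemma level_smoothing:
  assumes d: "double_pair D (i, s) (j, t)"
  shows "out_lim level j t = in_lim level i s"
  using side_change_at_smoothing[OF d order_refl, of 1] double_pairD[OF d] by (simp split: if_splits)

lemma level_seifert_step:
  assumes "seifert_step D x y"
  shows "level (fst x) (snd x) = level (fst y) (snd y)"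
  using assms
proof cases
  case (along a b i)
  have i: "i < n" using along(4)[of a] along(3) by (auto simp: regular_params_def params_def)
  have "level i a = level i b"
    by (rule locally_const_interval[OF locally_const_level, of "{a..b}"]) (use along in auto)
  then show ?thesis using along by (simp add: locally_const_frac[OF locally_const_level i])
next
  case (smoothing i s j t a b)
  have ij: "i < n" "j < n" using double_pairD[OF smoothing(3)] by auto
  have "in_lim level i s = level i a" "out_lim level j t = level j b"
    using in_lim_eq[OF locally_const_level smoothing(4) smoothing(6)] out_lim_eq[OF locally_const_level smoothing(5) smoothing(7)]
    by auto
  then show ?thesis
    using smoothing ij level_smoothing[OF smoothing(3)] by (simp add: locally_const_frac[OF locally_const_level])
qed

lemma level_seifert_circle:
  assumes C: "C \<in> seifert_circles D" and xy: "x \<in> C" "y \<in> C"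
  shows "level (fst x) (snd x) = level (fst y) (snd y)"
proof -
  have "equivclp (seifert_step D) x y" using seifert_mem[OF C xy(1)] xy(2) by blast
  then show ?thesis
    by (induction rule: equivclp_induct) (auto dest: level_seifert_step)
qed

lemma level_enters:
  assumes C: "C \<in> seifert_circles D" and e: "enters C (i, s)" "enters C (j, t)" and ij: "i < n" "j < n"
  shows "in_lim level i s = in_lim level j t"
proof -
  have ex: "\<exists>u. (k, frac u) \<in> C \<and> level k u = in_lim level k r" if "enters C (k, r)" "k < n" for k r
  proof -
    have "\<forall>\<^sub>F u in at_left r. (k, frac u) \<in> C" using that(1) by (simp add: enters_def)
    with eventually_in_lim[OF locally_const_level that(2), of r]
    have "\<forall>\<^sub>F u in at_left r. (k, frac u) \<in> C \<and> level k u = in_lim level k r" by eventually_elim simp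
    then show ?thesis using eventually_happens'[of "at_left r"] by auto
  qed
  obtain u w where "(i, frac u) \<in> C" "level i u = in_lim level i s" "(j, frac w) \<in> C" "level j w = in_lim level j t"
    using ex[OF e(1) ij(1)] ex[OF e(2) ij(2)] by blast
  with level_seifert_circle[OF C, of "(i, frac u)" "(j, frac w)"] ij show ?thesis
    by (simp add: locally_const_frac[OF locally_const_level])
qed

text \<open>The region between the two arriving strands is to the left of one and to the right of
  the other. So the two Seifert circles at a crossing have different levels, and the sign tells
  which is higher.\<close>

lemma level_incoming:
  assumes d: "double_pair D (i, s) (j, t)"
  shows "sgn (plane_det (vel D (i, s)) (vel D (j, t))) = -1 \<Longrightarrow> in_lim level j t = in_lim level i s + 1"
    and "sgn (plane_det (vel D (i, s)) (vel D (j, t))) = 1 \<Longrightarrow> in_lim level i s = in_lim level j t + 1"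
proof -
  have ij: "i < n" "j < n" using double_pairD[OF d] by auto
  have jump: "in_lim level l u = in_lim (side {..<n} (- 1)) l u + 1" if "l < n" for l u
    using side_lim_jump(1)[OF order_refl that, of 1 u] that by simp
  show "in_lim level j t = in_lim level i s + 1" if "sgn (plane_det (vel D (i, s)) (vel D (j, t))) = -1"
    using side_incoming[OF d order_refl that[symmetric]] jump[OF ij(2)] by simp
  show "in_lim level i s = in_lim level j t + 1" if "sgn (plane_det (vel D (i, s)) (vel D (j, t))) = 1"
    using side_incoming[OF d order_refl that[symmetric]] jump[OF ij(1)] by simp
qed

lemma crossingsD:
  assumes "(p, q) \<in> crossings D"
  shows "double_pair D p q \<and> partner p = q \<and> partner q = p \<and> p \<in> passages D \<and> q \<in> passages D"
proof -
  have d: "double_pair D p q" using assms by (simp add: crossings_def)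
  then show ?thesis
    using partner_eq[OF d] partner_eq[OF double_sym[OF d]] double_sym[OF d] unfolding passages_def by blast
qed

lemma negative_crossingsD:
  "(p, q) \<in> negative_crossings D \<longleftrightarrow> (p, q) \<in> crossings D \<and> sgn (plane_det (vel D p) (vel D q)) = -1"
  by (simp add: negative_crossings_def crossing_sign_def)

text \<open>After smoothing, the leaving overstrand continues the circle on which the understrand
  arrives, and at a negative crossing that one is higher by one.\<close>

lemma level_over_arc:
  assumes neg: "((i, s), q) \<in> negative_crossings D"
  shows "out_lim level i s = in_lim level i s + 1"
proof -
  obtain j t where q: "q = (j, t)" by (cases q)
  have d: "double_pair D (i, s) (j, t)" using neg crossingsD by (auto simp: q negative_crossingsD)
  have "in_lim level j t = in_lim level i s + 1"
    using level_incoming(1)[OF d] neg by (simp add: q negative_crossingsD)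
  then show ?thesis using level_smoothing[OF double_sym[OF d]] by simp
qed

text \<open>Every passage on the overarc is an overpassage of a negative crossing and raises the
  level, so between two different ones the level has strictly increased.\<close>

lemma level_inj_over_arc:
  assumes i: "i < n" and arc: "{p \<in> passages D. \<exists>u\<in>{a..b}. p = (i, frac u)} = fst ` negative_crossings D"
    and neg: "((i1, s1), q1) \<in> negative_crossings D" "((i2, s2), q2) \<in> negative_crossings D"
    and eq: "in_lim level i1 s1 = in_lim level i2 s2"
  shows "(i1, s1) = (i2, s2)"
proof -
  have "(i1, s1) \<in> {p \<in> passages D. \<exists>u\<in>{a..b}. p = (i, frac u)}" "(i2, s2) \<in> {p \<in> passages D. \<exists>u\<in>{a..b}. p = (i, frac u)}"
    unfolding arc using neg by force+
  then obtain u1 u2 where u: "u1 \<in> {a..b}" "(i1, s1) = (i, frac u1)" "u2 \<in> {a..b}" "(i2, s2) = (i, frac u2)"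
    and pass: "(i, frac u1) \<in> passages D" "(i, frac u2) \<in> passages D"
    by auto
  have mono: "in_lim level i x < in_lim level i y"
    if xy: "x < y" "x \<in> {a..b}" "y \<in> {a..b}" "(i, frac x) \<in> passages D" for x y
  proof -
    let ?T = "{t\<in>{x..<y}. (i, frac t) \<in> passages D}"
    have "out_lim level i t - in_lim level i t = 1" if t: "t \<in> ?T" for t
    proof -
      have "(i, frac t) \<in> fst ` negative_crossings D" unfolding arc[symmetric] using t xy by auto
      then obtain q where "((i, frac t), q) \<in> negative_crossings D" by force
      from level_over_arc[OF this] show ?thesis
        by (simp add: in_lim_frac[OF locally_const_level i] out_lim_frac[OF locally_const_level i])
    qed
    then have "in_lim level i y - in_lim level i x = real (card ?T)"
      using sum_jumps_arc[OF locally_const_level i, of x y] xy by simp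
    moreover have "card ?T > 0"
    proof -
      have "finite ?T" by (rule finite_subset[OF _ finite_passage_times[of x y i]]) auto
      moreover have "x \<in> ?T" using xy by simp
      ultimately show ?thesis unfolding card_gt_0_iff by blast
    qed
    ultimately show ?thesis by simp
  qed
  have "in_lim level i u1 = in_lim level i u2"
    using eq u by (simp add: in_lim_frac[OF locally_const_level i])
  with mono[of u1 u2] mono[of u2 u1] u pass have "u1 = u2" by (cases u1 u2 rule: linorder_cases) auto
  with u show ?thesis by simp
qed

text \<open>
  If the components outside \<open>B\<close> always pass over those in \<open>B\<close>, then on each Seifert circle the negative
  and positive mixed crossings balance, separately for those on its left and on its right. At
  most one negative mixed crossing lies in the region between two consecutive levels, so a negative
  mixed crossing is accompanied by a positive one connecting the same two Seifert circles.
\<close>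

lemma no_mixed_crossings:
  assumes succ: "successively_almost_positive k D" and good: "good_diagram D" and B: "B \<subseteq> {..<n}"
    and over: "\<And>p q. (p, q) \<in> crossings D \<Longrightarrow> fst p \<in> B \<Longrightarrow> fst q \<in> B"
    and pq: "(p, q) \<in> crossings D" "fst q \<in> B"
  shows "fst p \<in> B"
proof (rule ccontr)
  assume pB: "fst p \<notin> B"
  \<comment> \<open>The sign as seen from one strand: the crossing sign for an overpassage, its
    negative for an underpassage. Thus \<open>sg x = -1\<close> collects negative overpassages and
    positive underpassages.\<close>
  define sg where "sg p = sgn (plane_det (vel D p) (vel D (partner p)))" for p
  have sign: "crossing_sign D (x, y) = sg x \<and> sg y = - sg x" if "(x, y) \<in> crossings D" for x y
    using crossingsD[OF that] sgn_det_swap[of "vel D y" "vel D x"] by (simp add: sg_def crossing_sign_def)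
  have neg: "(x, y) \<in> negative_crossings D \<longleftrightarrow> (x, y) \<in> crossings D \<and> sg x = -1" for x y
    using sign[of x y] unfolding negative_crossings_def by auto
  have pos: "sg x = 1" if "(x, y) \<in> crossings D" "(x, y) \<notin> negative_crossings D" for x y
    using succ sign[OF that(1)] that unfolding successively_almost_positive_def by force
  have crossing: "(x, partner x) \<in> crossings D \<or> (partner x, x) \<in> crossings D" if "x \<in> passages D" for x
    using double_partner[OF that] double_sym[OF double_partner[OF that]] double_overs[OF double_partner[OF that]]
    by (auto simp: crossings_def)
  have mixed: "(x, partner x) \<in> crossings D"
    if "x \<in> passages D" "fst x \<notin> B" "fst (partner x) \<in> B" for x
    using crossing[OF that(1)] over that by blast
  have mixed': "(partner x, x) \<in> crossings D"
    if "x \<in> passages D" "fst x \<in> B" "fst (partner x) \<notin> B" for x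
    using crossing[OF that(1)] over that by blast
  have bal: "(\<Sum>x\<in>{x\<in>passages D. enters C x \<and> sg x = - \<sigma>}. of_bool (fst (partner x) \<in> B) - of_bool (fst x \<in> B)) = (0::real)"
    if "C \<in> seifert_circles D" "\<sigma> = 1 \<or> \<sigma> = -1" for C \<sigma>
    using balance[OF that(1) B that(2)] by (simp add: sg_def)
  have fin: "finite {x\<in>passages D. enters C x \<and> sg x = - \<sigma>}" for C \<sigma>
    using finite_passages by simp
  have bal': "(\<Sum>x\<in>{x\<in>passages D. enters C x \<and> sg x = - \<sigma>}. of_bool (fst x \<in> B) - of_bool (fst (partner x) \<in> B)) = (0::real)"
    if "C \<in> seifert_circles D" "\<sigma> = 1 \<or> \<sigma> = -1" for C \<sigma>
    using bal[OF that] by (simp add: sum_subtractf)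
  note ex = exchange[OF fin bal] exchange[OF fin bal']
  have pass: "fst x < n" if "x \<in> passages D" for x
    using passages_params that by (auto simp: params_def)
  have ex_ent: "\<exists>C\<in>seifert_circles D. enters C x" if "x \<in> passages D" for x
    using ex_enters[OF pass[OF that], of "snd x"] by simp
  \<comment> \<open>In the balance over \<open>sg = -1\<close> on \<open>C\<close>, a strand outside
    \<open>B\<close> is compensated by a strand in \<open>B\<close> meeting one outside. The latter
    passes over by assumption, so the compensating strand is an underpassage, and the sign makes its
    crossing positive.\<close>
  have neg_to_pos: "\<exists>x' y'. (x', y') \<in> crossings D \<and> sg x' = 1 \<and> fst x' \<notin> B \<and> fst y' \<in> B \<and> enters C y'"
    if C: "C \<in> seifert_circles D" and x: "(x, y) \<in> crossings D" "sg x = -1" "fst x \<notin> B" "fst y \<in> B" "enters C x" for C x y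
  proof -
    obtain z where "z \<in> passages D" "enters C z" "sg z = -1" "fst z \<in> B" "fst (partner z) \<notin> B"
      using ex(2)[OF C disjI1[OF refl], of x] crossingsD[OF x(1)] x by auto
    then show ?thesis using mixed'[of z] sign[of "partner z" z] by (intro exI[of _ "partner z"] exI[of _ z]) auto
  qed
  have "\<exists>x y. (x, y) \<in> crossings D \<and> sg x = -1 \<and> fst x \<notin> B \<and> fst y \<in> B"
  proof (cases "sg p = -1")
    case True
    then show ?thesis using pq pB by blast
  next
    case False
    \<comment> \<open>A positive mixed crossing yields a negative one by the same balance, on the
      circle along which its understrand arrives.\<close>
    then have "sg q = -1" using pos[of p q] neg[of p q] sign[of p q] pq by auto
    obtain C where C: "C \<in> seifert_circles D" "enters C q" using ex_ent crossingsD[OF pq(1)] by blast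
    obtain z where "z \<in> passages D" "sg z = -1" "fst z \<notin> B" "fst (partner z) \<in> B"
      using ex(1)[OF C(1) disjI1[OF refl], of q] crossingsD[OF pq(1)] pq pB C \<open>sg q = -1\<close> by auto
    then show ?thesis using mixed[of z] by blast
  qed
  then obtain x y where x: "(x, y) \<in> crossings D" "sg x = -1" "fst x \<notin> B" "fst y \<in> B" by blast
  obtain C where C: "C \<in> seifert_circles D" "enters C x" using ex_ent crossingsD[OF x(1)] by blast
  obtain x' y' where x': "(x', y') \<in> crossings D" "sg x' = 1" "fst x' \<notin> B" "fst y' \<in> B" "enters C y'"
    using neg_to_pos[OF C(1) x C(2)] by blast
  obtain C' where C': "C' \<in> seifert_circles D" "enters C' x'" using ex_ent crossingsD[OF x'(1)] by blast
  \<comment> \<open>The balance over \<open>sg = 1\<close>, now on the circle of the positive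
    overpassage \<open>x'\<close>: it is compensated by an underpassage in \<open>B\<close>, whose
    crossing is negative.\<close>
  obtain y'' where y'': "y'' \<in> passages D" "enters C' y''" "sg y'' = 1" "fst y'' \<in> B" "fst (partner y'') \<notin> B"
    using ex(2)[OF C'(1) disjI2[OF refl], of x'] crossingsD[OF x'(1)] x' C'(2) by auto
  define x'' where "x'' = partner y''"
  have c'': "(x'', y'') \<in> crossings D" using mixed' y'' by (simp add: x''_def)
  have negs: "(x, y) \<in> negative_crossings D" "(x'', y'') \<in> negative_crossings D"
    using neg x c'' sign[OF c''] y''(3) by auto
  let ?l = "\<lambda>x. in_lim level (fst x) (snd x)"
  have inc: "(sg u = -1 \<longrightarrow> ?l w = ?l u + 1) \<and> (sg u = 1 \<longrightarrow> ?l u = ?l w + 1)" if "(u, w) \<in> crossings D" for u w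
  proof -
    have d: "double_pair D (fst u, snd u) (fst w, snd w)" using crossingsD[OF that] by simp
    have "sg u = sgn (plane_det (vel D (fst u, snd u)) (vel D (fst w, snd w)))"
      using crossingsD[OF that] by (simp add: sg_def)
    then show ?thesis using level_incoming[OF d] by simp
  qed
  have "sg x'' = -1" using sign[OF c''] y''(3) by simp
  with inc[OF x(1)] inc[OF x'(1)] inc[OF c''] x(2) x'(2)
  have lev: "?l y = ?l x + 1" "?l x' = ?l y' + 1" "?l y'' = ?l x'' + 1" by simp_all
  have ent: "?l u = ?l w" if "K \<in> seifert_circles D" "enters K u" "enters K w" "u \<in> passages D" "w \<in> passages D" for K u w
    using level_enters[OF that(1), of "fst u" "snd u" "fst w" "snd w"] that pass by simp
  have l1: "?l x = ?l y'" using ent[OF C(1) C(2) x'(5)] crossingsD[OF x(1)] crossingsD[OF x'(1)] by blast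
  have l2: "?l x' = ?l y''" using ent[OF C'(1) C'(2) y''(2)] crossingsD[OF x'(1)] y''(1) by blast
  obtain i a b where i: "i < n" and arc: "{p \<in> passages D. \<exists>u\<in>{a..b}. p = (i, frac u)} = fst ` negative_crossings D"
    using succ unfolding successively_almost_positive_def by blast
  \<comment> \<open>Going from \<open>C\<close> to \<open>C'\<close> raises the level by one, and
    going from \<open>y''\<close> to \<open>x''\<close> lowers it by one, so \<open>x\<close> and
    \<open>x''\<close> have equal levels on the overarc.\<close>
  have "x = x''"
    using level_inj_over_arc[OF i arc, of "fst x" "snd x" y "fst x''" "snd x''" y''] negs lev l1 l2 by simp
  then have "y = y''" using crossingsD[OF x(1)] crossingsD[OF c''] by metis
  have "C \<noteq> C'"
  proof
    assume "C = C'"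
    then have "?l x' = ?l y'" using ent[OF C(1) _ x'(5), of x'] C'(2) crossingsD[OF x'(1)] by blast
    with lev(2) show False by simp
  qed
  moreover have "connects (x, y) C C'" using C(2) y''(2) \<open>y = y''\<close> by (simp add: connects_def)
  moreover have "connects (x', y') C C'" using C'(2) x'(5) by (simp add: connects_def)
  ultimately have "(x', y') = (x, y)"
    using good C(1) C'(1) negs(1) x'(1) unfolding good_diagram_def by blast
  with x(2) x'(2) show False by simp
qed

end

subsection \<open>Holonomy around a curve and separating surfaces\<close>

text \<open>A logarithm on \<open>K1 \<inter> K2\<close> extends to the whole space as a continuous
  function; its exponential continues \<open>f\<close> across \<open>K2\<close> without zeros. The
  result lives on a Euclidean space and so has a logarithm.\<close>

lemma closed_Un_continuous_logarithm:
  fixes K1 K2 :: "'a::euclidean_space set" and f :: "'a \<Rightarrow> complex"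
  assumes cl: "closed K1" "closed K2" and un: "K1 \<union> K2 = UNIV" and bors: "Borsukian (K1 \<inter> K2)"
    and f: "continuous_on K1 f" "\<And>x. x \<in> K1 \<Longrightarrow> f x \<noteq> 0"
  obtains g where "continuous_on K1 g" "\<And>x. x \<in> K1 \<Longrightarrow> f x = exp (g x)"
proof -
  have "continuous_on (K1 \<inter> K2) f" using f(1) continuous_on_subset by blast
  then obtain \<theta> where \<theta>: "continuous_on (K1 \<inter> K2) \<theta>" "\<And>x. x \<in> K1 \<inter> K2 \<Longrightarrow> f x = exp (\<theta> x)"
    using bors f(2) unfolding Borsukian_continuous_logarithm by (metis Compl_iff IntD1 Pi_I singletonD)
  have "closedin (top_of_set UNIV) (K1 \<inter> K2)" using cl by auto
  then obtain \<Theta> where \<Theta>: "continuous_on UNIV \<Theta>" "\<And>x. x \<in> K1 \<inter> K2 \<Longrightarrow> \<Theta> x = \<theta> x"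
    using Dugundji[of "UNIV :: complex set" UNIV "K1 \<inter> K2" \<theta>] \<theta>(1) by auto
  define F where "F x = (if x \<in> K1 then f x else exp (\<Theta> x))" for x
  have "continuous_on (K1 \<union> K2) F"
    unfolding F_def
    by (intro continuous_on_cases cl f(1) continuous_on_exp continuous_on_subset[OF \<Theta>(1)])
      (use \<theta>(2) \<Theta>(2) in auto)
  moreover have "F x \<noteq> 0" for x using f(2) by (simp add: F_def)
  ultimately obtain g where "continuous_on UNIV g" "\<And>x. F x = exp (g x)"
    using Borsukian_UNIV[where 'a = 'a] un unfolding Borsukian_continuous_logarithm
    by (metis Compl_iff Pi_I UNIV_I singletonD)
  then show ?thesis
    using that[of g] continuous_on_subset[of UNIV g K1] by (auto simp: F_def) (metis)
qed

text \<open>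
  The rank one matrix \<open>spin P\<close> is \<open>U U\<^sup>*\<close> for a spinor \<open>U\<close> in the direction \<open>P\<close>. There is no continuous choice
  of \<open>U\<close>, but the trace of a product of such matrices along a closed polygon seen from a point \<open>x\<close> is
  continuous in \<open>x\<close>; its argument is half the solid angle of the polygon.
\<close>

definition spin :: "complex \<times> real \<Rightarrow> bool \<Rightarrow> bool \<Rightarrow> complex" where
  "spin P a b = (if a = b then of_real (if a then norm P + snd P else norm P - snd P)
     else if a then fst P else cnj (fst P))"

text \<open>The second column of \<open>spin P\<close>, normalised by the square root of its
  diagonal entry; the ray \<open>norm P = snd P\<close>, where this column vanishes, gets a value of
  its own.\<close>

definition spinor :: "complex \<times> real \<Rightarrow> bool \<Rightarrow> complex" where
  "spinor P a = (if norm P - snd P = 0 then (if a then of_real (sqrt (norm P + snd P)) else 0)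
     else (if a then fst P else of_real (norm P - snd P)) / of_real (sqrt (norm P - snd P)))"

definition spin_inner :: "complex \<times> real \<Rightarrow> complex \<times> real \<Rightarrow> complex" where
  "spin_inner P Q = cnj (spinor P True) * spinor Q True + cnj (spinor P False) * spinor Q False"

section \<open>Products of spinors and the holonomy of a polygon\<close>

lemma norm_prod_sq: "(norm P)\<^sup>2 = (norm (fst P))\<^sup>2 + (snd P)\<^sup>2" for P :: "complex \<times> real"
  by (simp add: norm_prod_def)

lemma abs_snd_le_norm: "\<bar>snd P\<bar> \<le> norm P" for P :: "complex \<times> real"
  by (metis norm_snd_le real_norm_def prod.collapse)

lemma spin_eq: "spin P a b = spinor P a * cnj (spinor P b)"
proof -
  define w t R where "w = fst P" and "t = snd P" and "R = norm P"
  note defs = w_def[symmetric] t_def[symmetric] R_def[symmetric]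
  have sq: "R\<^sup>2 = (norm w)\<^sup>2 + t\<^sup>2" using norm_prod_sq[of P] by (simp add: defs)
  have le: "\<bar>t\<bar> \<le> R" using abs_snd_le_norm[of P] by (simp add: defs)
  have "(norm w)\<^sup>2 = (R + t) * (R - t)" using sq by (simp add: power2_eq_square algebra_simps)
  then have ww: "w * cnj w = of_real (R + t) * of_real (R - t)"
    by (metis complex_norm_square of_real_mult)
  show ?thesis
  proof (cases "R - t = 0")
    case True
    then have "w = 0" using ww by auto
    have "complex_of_real (sqrt (R + t)) * complex_of_real (sqrt (R + t)) = of_real (R + t)"
      using le by (simp flip: of_real_mult)
    then show ?thesis using True \<open>w = 0\<close> unfolding spin_def spinor_def defs by simp
  next
    case False
    define E S where "E = complex_of_real (R - t)" and "S = complex_of_real (sqrt (R - t))"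
    have s: "S * S = E" unfolding E_def S_def using le by (simp flip: of_real_mult)
    then have s': "complex_of_real R = of_real t + S * S" by (simp add: E_def)
    have E: "E \<noteq> 0" using False by (simp add: E_def flip: of_real_diff)
    have "S \<noteq> 0" using s E by auto
    have cnj: "cnj E = E" "cnj S = S" by (simp_all add: E_def S_def)
    show ?thesis
      using False \<open>S \<noteq> 0\<close> ww unfolding spin_def spinor_def defs E_def[symmetric] S_def[symmetric]
      by (cases a; cases b) (simp_all add: cnj field_simps s' flip: s)
  qed
qed

text \<open>The squared modulus is \<open>2 * (norm P * norm Q + P \<bullet> Q)\<close>: spinors are
  orthogonal only for opposite directions.\<close>

lemma spin_inner_nonzero:
  assumes "P \<bullet> Q > 0"
  shows "spin_inner P Q \<noteq> 0"
proof
  assume 0: "spin_inner P Q = 0"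
  have "spin_inner P Q * cnj (spin_inner P Q) = spin P True True * spin Q True True + spin P True False * spin Q False True
      + spin P False True * spin Q True False + spin P False False * spin Q False False"
    unfolding spin_eq spin_inner_def by (simp add: algebra_simps)
  also have "\<dots> = of_real (2 * (norm P * norm Q + snd P * snd Q)) + (fst P * cnj (fst Q) + cnj (fst P) * fst Q)"
    by (simp add: spin_def algebra_simps)
  also have "fst P * cnj (fst Q) + cnj (fst P) * fst Q = of_real (2 * (fst P \<bullet> fst Q))"
    by (simp add: complex_eq_iff inner_complex_def algebra_simps)
  also have "of_real (2 * (norm P * norm Q + snd P * snd Q)) + of_real (2 * (fst P \<bullet> fst Q)) = (of_real (2 * (norm P * norm Q + P \<bullet> Q)) :: complex)"
    by (simp add: inner_prod_def algebra_simps)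
  finally have "norm P * norm Q + P \<bullet> Q = 0" using 0 by (simp flip: of_real_add of_real_mult)
  with assms show False by (smt (verit) mult_nonneg_nonneg norm_ge_zero)
qed

text \<open>Off the vertical axis the normalising square roots are positive reals, and only the
  argument matters for the logarithms to follow.\<close>

lemma spin_inner_eq:
  assumes "fst P \<noteq> 0" "fst Q \<noteq> 0"
  obtains r where "r > 0"
    "spin_inner P Q = of_real r * (of_real ((norm P - snd P) * (norm Q - snd Q)) + cnj (fst P) * fst Q)"
proof -
  have pos: "norm P - snd P > 0" if "fst P \<noteq> 0" for P :: "complex \<times> real"
  proof -
    have "(snd P)\<^sup>2 < (norm P)\<^sup>2" using that by (simp add: norm_prod_sq)
    then have "\<bar>snd P\<bar> < norm P" by (metis abs_norm_cancel abs_square_eq_1 power2_less_imp_less abs_ge_zero norm_ge_zero power2_abs)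
    then show ?thesis by simp
  qed
  let ?r = "1 / (sqrt (norm P - snd P) * sqrt (norm Q - snd Q))"
  show ?thesis
  proof (rule that[of ?r])
    show "?r > 0" using pos[OF assms(1)] pos[OF assms(2)] by simp
    show "spin_inner P Q = of_real ?r * (of_real ((norm P - snd P) * (norm Q - snd Q)) + cnj (fst P) * fst Q)"
      using pos[OF assms(1)] pos[OF assms(2)] unfolding spin_inner_def spinor_def
      by (simp add: field_simps)
  qed
qed

text \<open>Multiplication of 2x2 matrices whose rows and columns are indexed by
  \<open>bool\<close>.\<close>

primrec chain :: "(nat \<Rightarrow> bool \<Rightarrow> bool \<Rightarrow> complex) \<Rightarrow> nat \<Rightarrow> bool \<Rightarrow> bool \<Rightarrow> complex" where
  "chain A 0 a b = A 0 a b"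
| "chain A (Suc m) a b = chain A m a True * A (Suc m) True b + chain A m a False * A (Suc m) False b"

lemma chain_spin:
  "chain (\<lambda>m. spin (P m)) m a b = spinor (P 0) a * (\<Prod>j<m. spin_inner (P j) (P (Suc j))) * cnj (spinor (P m) b)"
proof (induction m arbitrary: b)
  case (Suc m)
  then show ?case by (simp add: spin_eq spin_inner_def algebra_simps)
qed (simp add: spin_eq)

definition holonomy :: "(nat \<Rightarrow> complex \<times> real) \<Rightarrow> nat \<Rightarrow> complex \<times> real \<Rightarrow> complex" where
  "holonomy p N x = chain (\<lambda>m. spin (p m - x)) (N - 1) True True + chain (\<lambda>m. spin (p m - x)) (N - 1) False False"

text \<open>In the trace the last spinor is paired with the first one, which is the missing side of
  the polygon since \<open>p N = p 0\<close>. The phases of the spinors cancel, although each factor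
  on the right depends on them.\<close>

lemma holonomy_eq:
  assumes "N > 0" "p N = p 0"
  shows "holonomy p N x = (\<Prod>m<N. spin_inner (p m - x) (p (Suc m) - x))"
proof -
  have N: "{..<N} = insert (N - 1) {..<N - 1}" "Suc (N - 1) = N" using assms(1) by auto
  show ?thesis
    unfolding holonomy_def chain_spin N(1) using assms(2) N(2)
    by (simp add: spin_inner_def algebra_simps)
qed

lemma continuous_holonomy: "continuous_on A (holonomy p N)"
proof -
  have spin: "continuous_on A (\<lambda>x. spin (p m - x) a b)" for m a b
    unfolding spin_def by (cases a; cases b) (auto intro!: continuous_intros)
  have "continuous_on A (\<lambda>x. chain (\<lambda>m. spin (p m - x)) k a b)" for k a b
    by (induction k arbitrary: b) (auto intro!: continuous_intros spin)
  then show ?thesis unfolding holonomy_def by (intro continuous_intros)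
qed

lemma norm_fst_le_norm: "norm (fst P) \<le> norm P" for P :: "complex \<times> real"
  by (metis norm_fst_le prod.collapse)

lemma norm_minus_snd_less:
  fixes P :: "complex \<times> real"
  assumes "snd P > 0" "fst P \<noteq> 0"
  shows "norm P - snd P < norm (fst P)"
proof -
  have "(norm P)\<^sup>2 < (norm (fst P) + snd P)\<^sup>2"
    using assms by (simp add: norm_prod_sq power2_sum)
  then have "norm P < norm (fst P) + snd P"
    using assms by (intro power2_less_imp_less[of "norm P"]) auto
  then show ?thesis by simp
qed

text \<open>
  A logarithm of \<open>spin_inner P Q\<close> up to a positive factor, where \<open>P\<close>, \<open>Q\<close> are the ends of the arc
  \<open>(\<gamma>, h)\<close> over \<open>[a, b]\<close> seen from \<open>x\<close>. Below the arc the branch follows the argument of \<open>\<gamma> - x\<close>,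
  so that it jumps exactly when \<open>x\<close> moves under the arc.
\<close>

definition cell_log ::
    "(real \<Rightarrow> complex) \<Rightarrow> (real \<Rightarrow> real) \<Rightarrow> real \<Rightarrow> real \<Rightarrow> real \<Rightarrow> complex \<times> real \<Rightarrow> complex" where
  "cell_log \<gamma> h \<delta> a b x =
     (let P = (\<gamma> a, h a) - x; Q = (\<gamma> b, h b) - x; \<rho> = of_real ((norm P - snd P) * (norm Q - snd Q)) in
      if norm (fst P) < 3 * \<delta> \<and> snd P > 0
      then log_change \<gamma> a b (fst x) + Ln (1 + \<rho> / (cnj (fst P) * fst Q))
      else Ln ((\<rho> + cnj (fst P) * fst Q) / (cnj (fst P) * fst P)))"

text \<open>Both branches have the exponential
  \<open>(\<rho> + cnj (fst P) * fst Q) / (cnj (fst P) * fst P)\<close>, and the denominator is a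
  positive real number.\<close>

lemma exp_cell_log:
  assumes \<gamma>: "\<gamma> C1_differentiable_on UNIV" and "a \<le> b" and x: "fst x \<notin> \<gamma> ` {a..b}"
    and pos: "((\<gamma> a, h a) - x) \<bullet> ((\<gamma> b, h b) - x) > 0"
  obtains r where "r > 0" "exp (cell_log \<gamma> h \<delta> a b x) = of_real r * spin_inner ((\<gamma> a, h a) - x) ((\<gamma> b, h b) - x)"
proof -
  define P Q where "P = (\<gamma> a, h a) - x" and "Q = (\<gamma> b, h b) - x"
  define \<rho> where "\<rho> = complex_of_real ((norm P - snd P) * (norm Q - snd Q))"
  have "\<gamma> a \<in> \<gamma> ` {a..b}" "\<gamma> b \<in> \<gamma> ` {a..b}" using \<open>a \<le> b\<close> by auto
  then have nz: "fst P \<noteq> 0" "fst Q \<noteq> 0" using x by (auto simp: P_def Q_def)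
  obtain r where r: "r > 0" "spin_inner P Q = of_real r * (\<rho> + cnj (fst P) * fst Q)"
    using spin_inner_eq[OF nz] unfolding \<rho>_def by blast
  have "spin_inner P Q \<noteq> 0" using spin_inner_nonzero pos by (simp add: P_def Q_def)
  then have g: "\<rho> + cnj (fst P) * fst Q \<noteq> 0" using r by auto
  have g': "1 + \<rho> / (cnj (fst P) * fst Q) \<noteq> 0" using g nz by (simp add: field_simps)
  have prod_eq: "fst Q * (1 + \<rho> / (cnj (fst P) * fst Q)) / fst P = (\<rho> + cnj (fst P) * fst Q) / (cnj (fst P) * fst P)"
    using nz by (simp add: field_simps)
  have "exp (log_change \<gamma> a b (fst x)) = fst Q / fst P"
    using exp_log_change[OF \<gamma> \<open>a \<le> b\<close> x] by (simp add: P_def Q_def)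
  then have "exp (cell_log \<gamma> h \<delta> a b x) = (\<rho> + cnj (fst P) * fst Q) / (cnj (fst P) * fst P)"
    using g g' nz unfolding cell_log_def Let_def P_def[symmetric] Q_def[symmetric] \<rho>_def[symmetric]
    by (simp add: exp_add prod_eq)
  also have "cnj (fst P) * fst P = of_real ((norm (fst P))\<^sup>2)"
    by (metis complex_norm_square mult.commute)
  also have "(\<rho> + cnj (fst P) * fst Q) / of_real ((norm (fst P))\<^sup>2) = of_real (1 / (r * (norm (fst P))\<^sup>2)) * spin_inner P Q"
    using r nz by (simp add: field_simps)
  finally have "exp (cell_log \<gamma> h \<delta> a b x) = of_real (1 / (r * (norm (fst P))\<^sup>2)) * spin_inner P Q" .
  moreover have "1 / (r * (norm (fst P))\<^sup>2) > 0" using r nz by simp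
  ultimately show ?thesis
    using that[of "1 / (r * (norm (fst P))\<^sup>2)"] unfolding P_def[symmetric] Q_def[symmetric] by blast
qed

section \<open>Jumps of the logarithm of one side of the polygon\<close>

lemma isCont_imp_limits:
  fixes l :: "real \<Rightarrow> complex"
  assumes "(l \<longlongrightarrow> L) (at s0)"
  shows "(l \<longlongrightarrow> L) (at_left s0)" "(l \<longlongrightarrow> L) (at_right s0)"
  using assms by (auto simp: filterlim_at_split)

text \<open>The analogue of \<open>wind_jump\<close> for an open arc met at most once: cut it
  shortly before and after the meeting point, so that only the middle piece jumps.\<close>

lemma log_change_limits:
  assumes \<gamma>: "\<gamma> C1_differentiable_on UNIV" and c: "(c has_vector_derivative u) (at s0)" and "a < b"
    and ends: "c s0 \<noteq> \<gamma> a" "c s0 \<noteq> \<gamma> b"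
    and off: "\<forall>\<^sub>F s in at s0. c s \<notin> \<gamma> ` {a..b}"
    and simple: "\<And>t t'. t \<in> {a..b} \<Longrightarrow> t' \<in> {a..b} \<Longrightarrow> \<gamma> t = c s0 \<Longrightarrow> \<gamma> t' = c s0 \<Longrightarrow> t = t'"
    and trans: "\<And>t. t \<in> {a..b} \<Longrightarrow> \<gamma> t = c s0 \<Longrightarrow> plane_det (vector_derivative \<gamma> (at t)) u > 0"
  shows "\<exists>Lm Lp. ((\<lambda>s. log_change \<gamma> a b (c s)) \<longlongrightarrow> Lm) (at_left s0) \<and>
     ((\<lambda>s. log_change \<gamma> a b (c s)) \<longlongrightarrow> Lp) (at_right s0) \<and>
     Lp - Lm = of_real (2 * pi * of_bool (c s0 \<in> \<gamma> ` {a..b})) * \<i>"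
proof -
  have cc: "(c \<longlongrightarrow> c s0) (at s0)"
    using has_vector_derivative_continuous[OF c] by (simp add: isCont_def)
  have cont: "((\<lambda>s. log_change \<gamma> a' b' (c s)) \<longlongrightarrow> log_change \<gamma> a' b' (c s0)) (at s0)" if "c s0 \<notin> \<gamma> ` {a'..b'}" for a' b'
    using isCont_tendsto_compose[OF isCont_log_change[OF \<gamma> that] cc] .
  show ?thesis
  proof (cases "c s0 \<in> \<gamma> ` {a..b}")
    case False
    then show ?thesis using isCont_imp_limits[OF cont[OF False]] by auto
  next
    case True
    then obtain t1 where t1: "t1 \<in> {a..b}" "\<gamma> t1 = c s0" by auto
    then have t1': "a < t1" "t1 < b" using ends by (auto simp: less_le)
    have d: "plane_det (vector_derivative \<gamma> (at t1)) u > 0" using trans[OF t1] .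
    obtain \<eta>0 where \<eta>0: "\<eta>0 > 0" "\<And>\<eta>. 0 < \<eta> \<Longrightarrow> \<eta> \<le> \<eta>0 \<Longrightarrow> \<exists>Lm Lp.
       ((\<lambda>s. log_change \<gamma> (t1 - \<eta>) (t1 + \<eta>) (c s)) \<longlongrightarrow> Lm) (at_left s0) \<and>
       ((\<lambda>s. log_change \<gamma> (t1 - \<eta>) (t1 + \<eta>) (c s)) \<longlongrightarrow> Lp) (at_right s0) \<and>
       Lp - Lm = of_real (2 * pi * sgn (plane_det (vector_derivative \<gamma> (at t1)) u)) * \<i>"
      using log_change_jump[OF \<gamma> c t1(2) refl] d by (metis order_less_irrefl)
    define \<eta> where "\<eta> = min \<eta>0 (min (t1 - a) (b - t1))"
    have \<eta>: "0 < \<eta>" "\<eta> \<le> \<eta>0" "a \<le> t1 - \<eta>" "t1 + \<eta> \<le> b" using \<eta>0(1) t1' by (auto simp: \<eta>_def)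
    obtain Lm Lp where L: "((\<lambda>s. log_change \<gamma> (t1 - \<eta>) (t1 + \<eta>) (c s)) \<longlongrightarrow> Lm) (at_left s0)"
       "((\<lambda>s. log_change \<gamma> (t1 - \<eta>) (t1 + \<eta>) (c s)) \<longlongrightarrow> Lp) (at_right s0)"
       "Lp - Lm = of_real (2 * pi) * \<i>"
      using \<eta>0(2)[OF \<eta>(1,2)] d by auto
    let ?A = "log_change \<gamma> a (t1 - \<eta>)" let ?B = "log_change \<gamma> (t1 + \<eta>) b"
    have ne: "c s0 \<noteq> \<gamma> t" if "t \<in> {a..b}" "t \<noteq> t1" for t
      using simple[OF t1(1) that(1) t1(2)] that(2) by metis
    have "c s0 \<notin> \<gamma> ` S" if "S \<subseteq> {a..b} - {t1}" for S
      using that ne by blast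
    moreover have "{a..t1 - \<eta>} \<subseteq> {a..b} - {t1}" "{t1 + \<eta>..b} \<subseteq> {a..b} - {t1}"
      using t1' \<eta> by auto
    ultimately have "c s0 \<notin> \<gamma> ` {a..t1 - \<eta>}" "c s0 \<notin> \<gamma> ` {t1 + \<eta>..b}"
      by blast+
    from isCont_imp_limits[OF cont[OF this(1)]] isCont_imp_limits[OF cont[OF this(2)]]
    have AB: "((\<lambda>s. ?A (c s)) \<longlongrightarrow> ?A (c s0)) (at_left s0)" "((\<lambda>s. ?A (c s)) \<longlongrightarrow> ?A (c s0)) (at_right s0)"
      "((\<lambda>s. ?B (c s)) \<longlongrightarrow> ?B (c s0)) (at_left s0)" "((\<lambda>s. ?B (c s)) \<longlongrightarrow> ?B (c s0)) (at_right s0)"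
      by auto
    have ev: "\<forall>\<^sub>F s in at s0. ?A (c s) + (log_change \<gamma> (t1 - \<eta>) (t1 + \<eta>) (c s) + ?B (c s)) = log_change \<gamma> a b (c s)"
      using off
    proof eventually_elim
      case (elim s)
      have "log_change \<gamma> a b (c s) = ?A (c s) + log_change \<gamma> (t1 - \<eta>) b (c s)"
        using elim \<eta> by (intro log_change_combine[OF \<gamma>]) auto
      also have "log_change \<gamma> (t1 - \<eta>) b (c s) = log_change \<gamma> (t1 - \<eta>) (t1 + \<eta>) (c s) + ?B (c s)"
        using elim \<eta> by (intro log_change_combine[OF \<gamma>]) auto
      finally show ?case by simp
    qed
    have "((\<lambda>s. log_change \<gamma> a b (c s)) \<longlongrightarrow> ?A (c s0) + (Lm + ?B (c s0))) (at_left s0)"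
      by (rule Lim_transform_eventually[OF tendsto_add[OF AB(1) tendsto_add[OF L(1) AB(3)]]], rule filter_leD[OF at_le ev]) simp
    moreover have "((\<lambda>s. log_change \<gamma> a b (c s)) \<longlongrightarrow> ?A (c s0) + (Lp + ?B (c s0))) (at_right s0)"
      by (rule Lim_transform_eventually[OF tendsto_add[OF AB(2) tendsto_add[OF L(2) AB(4)]]], rule filter_leD[OF at_le ev]) simp
    moreover have "(?A (c s0) + (Lp + ?B (c s0))) - (?A (c s0) + (Lm + ?B (c s0))) = of_real (2 * pi * of_bool (c s0 \<in> \<gamma> ` {a..b})) * \<i>"
      using L(3) True by simp
    ultimately show ?thesis by (intro exI conjI)
  qed
qed

text \<open>The arc varies by less than \<open>\<delta>\<close> and the point is
  \<open>4 * \<delta>\<close> away from its start. If it is more than \<open>2 * \<delta>\<close>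
  away horizontally, both branches agree, which makes the switch at \<open>3 * \<delta>\<close>
  harmless; otherwise it is clearly below or above. Below, the jump is that of
  \<open>log_change\<close>; above, the positive term \<open>\<rho>\<close> dominates and there is
  no jump.\<close>

lemma cell_log_limits:
  fixes \<gamma> c :: "real \<Rightarrow> complex" and h k :: "real \<Rightarrow> real"
  assumes \<gamma>: "\<gamma> C1_differentiable_on UNIV" and c: "(c has_vector_derivative u) (at s0)"
    and k: "isCont k s0" and "a < b" and \<delta>: "\<delta> > 0"
    and small: "\<And>t. t \<in> {a..b} \<Longrightarrow> norm (\<gamma> t - \<gamma> a) < \<delta> \<and> \<bar>h t - h a\<bar> < \<delta>"
    and far: "norm (\<gamma> a - c s0, h a - k s0) \<ge> 4 * \<delta>"
    and ends: "c s0 \<noteq> \<gamma> a" "c s0 \<noteq> \<gamma> b"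
    and off: "\<forall>\<^sub>F s in at s0. c s \<notin> \<gamma> ` {a..b}"
    and simple: "\<And>t t'. t \<in> {a..b} \<Longrightarrow> t' \<in> {a..b} \<Longrightarrow> \<gamma> t = c s0 \<Longrightarrow> \<gamma> t' = c s0 \<Longrightarrow> t = t'"
    and trans: "\<And>t. t \<in> {a..b} \<Longrightarrow> \<gamma> t = c s0 \<Longrightarrow> h t > k s0 \<Longrightarrow> plane_det (vector_derivative \<gamma> (at t)) u > 0"
  shows "\<exists>Lm Lp. ((\<lambda>s. cell_log \<gamma> h \<delta> a b (c s, k s)) \<longlongrightarrow> Lm) (at_left s0) \<and>
     ((\<lambda>s. cell_log \<gamma> h \<delta> a b (c s, k s)) \<longlongrightarrow> Lp) (at_right s0) \<and>
     Lp - Lm = of_real (2 * pi * of_bool (\<exists>t\<in>{a..b}. \<gamma> t = c s0 \<and> h t > k s0)) * \<i>"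
proof -
  define P Q where "P s = (\<gamma> a - c s, h a - k s)" and "Q s = (\<gamma> b - c s, h b - k s)" for s
  define \<rho> where "\<rho> s = (norm (P s) - snd (P s)) * (norm (Q s) - snd (Q s))" for s
  define up where "up s = log_change \<gamma> a b (c s) + Ln (1 + of_real (\<rho> s) / (cnj (fst (P s)) * fst (Q s)))" for s
  define q where "q s = (of_real (\<rho> s) + cnj (fst (P s)) * fst (Q s)) / (cnj (fst (P s)) * fst (P s))" for s
  have cl: "cell_log \<gamma> h \<delta> a b (c s, k s) = (if norm (fst (P s)) < 3 * \<delta> \<and> snd (P s) > 0 then up s else Ln (q s))" for s
    by (simp add: cell_log_def Let_def P_def Q_def \<rho>_def up_def q_def)
  have cc: "(c \<longlongrightarrow> c s0) (at s0)" and kk: "(k \<longlongrightarrow> k s0) (at s0)"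
    using has_vector_derivative_continuous[OF c] k by (simp_all add: isCont_def)
  have PQ: "(P \<longlongrightarrow> P s0) (at s0)" "(Q \<longlongrightarrow> Q s0) (at s0)"
    unfolding P_def Q_def by (intro tendsto_intros cc kk)+
  have lim\<rho>: "(\<rho> \<longlongrightarrow> \<rho> s0) (at s0)" unfolding \<rho>_def by (intro tendsto_intros PQ)
  have nz: "fst (P s0) \<noteq> 0" "fst (Q s0) \<noteq> 0" using ends by (auto simp: P_def Q_def)
  have limq: "(q \<longlongrightarrow> q s0) (at s0)" unfolding q_def by (intro tendsto_intros PQ lim\<rho>) (use nz in auto)
  have dQ: "norm (fst (Q s) - fst (P s)) < \<delta>" "\<bar>snd (Q s) - snd (P s)\<bar> < \<delta>" for s
    using small[of b] \<open>a < b\<close> by (simp_all add: P_def Q_def)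
  have \<rho>0: "\<rho> s \<ge> 0" for s
    unfolding \<rho>_def using abs_snd_le_norm[of "P s"] abs_snd_le_norm[of "Q s"] by (intro mult_nonneg_nonneg) auto
  have Re_mult: "Re (of_real r * z) = r * Re z" for r z by simp
  have normq: "cnj z * z = of_real ((norm z)\<^sup>2)" for z by (metis complex_norm_square mult.commute)
  have down: "\<exists>Lm Lp. ((\<lambda>s. cell_log \<gamma> h \<delta> a b (c s, k s)) \<longlongrightarrow> Lm) (at_left s0) \<and>
     ((\<lambda>s. cell_log \<gamma> h \<delta> a b (c s, k s)) \<longlongrightarrow> Lp) (at_right s0) \<and>
     Lp - Lm = of_real (2 * pi * of_bool (\<exists>t\<in>{a..b}. \<gamma> t = c s0 \<and> h t > k s0)) * \<i>"
    if ev: "\<forall>\<^sub>F s in at s0. cell_log \<gamma> h \<delta> a b (c s, k s) = Ln (q s)"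
      and Re: "Re (of_real (\<rho> s0) + cnj (fst (P s0)) * fst (Q s0)) > 0"
      and no: "\<not> (\<exists>t\<in>{a..b}. \<gamma> t = c s0 \<and> h t > k s0)"
  proof -
    have "Re (q s0) > 0" unfolding q_def normq using Re nz by (simp add: Re_divide_of_real del: of_real_power)
    then have "q s0 \<notin> \<real>\<^sub>\<le>\<^sub>0" by (auto simp: complex_nonpos_Reals_iff)
    then have "((\<lambda>s. Ln (q s)) \<longlongrightarrow> Ln (q s0)) (at s0)" by (intro tendsto_Ln limq)
    moreover have "\<forall>\<^sub>F s in at s0. Ln (q s) = cell_log \<gamma> h \<delta> a b (c s, k s)" using ev by eventually_elim simp
    ultimately have "((\<lambda>s. cell_log \<gamma> h \<delta> a b (c s, k s)) \<longlongrightarrow> Ln (q s0)) (at s0)"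
      by (rule Lim_transform_eventually)
    from isCont_imp_limits[OF this] show ?thesis using no by auto
  qed
  show ?thesis
  proof (cases "norm (fst (P s0)) > 2 * \<delta>")
    case True
    \<comment> \<open>Seen from a horizontal distance above \<open>2 * \<delta>\<close>, the arc
      stays in a half plane around the direction of its start. Both factors in \<open>up\<close>
      then have positive real part, so their principal logarithms add up to
      \<open>Ln (q s)\<close>.\<close>
    have half: "Re (fst (Q s) / fst (P s)) > 0 \<and> cell_log \<gamma> h \<delta> a b (c s, k s) = Ln (q s)"
      if big: "norm (fst (P s)) > 2 * \<delta>" for s
    proof -
      have nzs: "fst (P s) \<noteq> 0" using big \<delta> by auto
      have Re_pos: "Re ((\<gamma> t - c s) / fst (P s)) > 0" if "t \<in> {a..b}" for t
      proof -
        have "norm ((\<gamma> t - \<gamma> a) / fst (P s)) < 1"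
          using small[OF that] big \<delta> nzs by (simp add: norm_divide divide_less_eq_1)
        then have "\<bar>Re ((\<gamma> t - \<gamma> a) / fst (P s))\<bar> < 1" using abs_Re_le_cmod le_less_trans by blast
        moreover have "(\<gamma> t - c s) / fst (P s) = 1 + (\<gamma> t - \<gamma> a) / fst (P s)"
          using nzs by (simp add: P_def field_simps)
        ultimately show ?thesis by simp
      qed
      have R1: "Re (fst (Q s) / fst (P s)) > 0" using Re_pos[of b] \<open>a < b\<close> by (simp add: Q_def)
      then have nzQ: "fst (Q s) \<noteq> 0" by auto
      have "log_change \<gamma> a b (c s) = Ln ((\<gamma> b - c s) / fst (P s)) - Ln ((\<gamma> a - c s) / fst (P s))"
        by (rule log_change_eq_Ln[OF \<gamma>]) (use \<open>a < b\<close> nzs Re_pos in \<open>auto simp: complex_nonpos_Reals_iff not_le\<close>)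
      also have "\<dots> = Ln (fst (Q s) / fst (P s))" using nzs by (simp add: P_def Q_def)
      finally have lc: "log_change \<gamma> a b (c s) = Ln (fst (Q s) / fst (P s))" .
      have cnjeq: "cnj (fst (P s)) * fst (Q s) = of_real ((norm (fst (P s)))\<^sup>2) * (fst (Q s) / fst (P s))"
        by (subst normq[symmetric]) (use nzs in simp)
      have "Re (cnj (fst (P s)) * fst (Q s)) > 0"
        unfolding cnjeq Re_mult using R1 nzs by simp
      then have "Re (inverse (cnj (fst (P s)) * fst (Q s))) > 0"
        unfolding inverse_complex.sel by (intro divide_pos_pos add_pos_nonneg) auto
      then have R2: "Re (1 + of_real (\<rho> s) / (cnj (fst (P s)) * fst (Q s))) > 0"
        using \<rho>0[of s] by (simp add: divide_inverse add_pos_nonneg)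
      have "up s = Ln (fst (Q s) / fst (P s) * (1 + of_real (\<rho> s) / (cnj (fst (P s)) * fst (Q s))))"
        unfolding up_def lc
      proof (rule Ln_times_simple[symmetric])
        show "fst (Q s) / fst (P s) \<noteq> 0" "1 + of_real (\<rho> s) / (cnj (fst (P s)) * fst (Q s)) \<noteq> 0"
          using R1 R2 by (metis less_irrefl zero_complex.sel(1))+
        have "\<bar>Im (Ln (fst (Q s) / fst (P s)))\<bar> < pi / 2" "\<bar>Im (Ln (1 + of_real (\<rho> s) / (cnj (fst (P s)) * fst (Q s))))\<bar> < pi / 2"
          using R1 R2 Re_Ln_pos_lt by (metis less_irrefl zero_complex.sel(1))+
        then show "- pi < Im (Ln (fst (Q s) / fst (P s))) + Im (Ln (1 + of_real (\<rho> s) / (cnj (fst (P s)) * fst (Q s))))"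
          "Im (Ln (fst (Q s) / fst (P s))) + Im (Ln (1 + of_real (\<rho> s) / (cnj (fst (P s)) * fst (Q s)))) \<le> pi"
          by linarith+
      qed
      also have "fst (Q s) / fst (P s) * (1 + of_real (\<rho> s) / (cnj (fst (P s)) * fst (Q s))) = q s"
        using nzs nzQ by (simp add: q_def field_simps)
      finally show ?thesis using R1 by (simp add: cl)
    qed
    show ?thesis
    proof (rule down)
      have "((\<lambda>s. norm (fst (P s))) \<longlongrightarrow> norm (fst (P s0))) (at s0)" by (intro tendsto_intros PQ)
      then have "\<forall>\<^sub>F s in at s0. norm (fst (P s)) > 2 * \<delta>" using True by (rule order_tendstoD)
      then show "\<forall>\<^sub>F s in at s0. cell_log \<gamma> h \<delta> a b (c s, k s) = Ln (q s)"
        by eventually_elim (use half in blast)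
      have "cnj (fst (P s0)) * fst (Q s0) = of_real ((norm (fst (P s0)))\<^sup>2) * (fst (Q s0) / fst (P s0))"
        by (subst normq[symmetric]) (use nz in simp)
      then have "Re (cnj (fst (P s0)) * fst (Q s0)) > 0"
        using half[OF True] nz by (simp only: Re_mult) simp
      then show "Re (of_real (\<rho> s0) + cnj (fst (P s0)) * fst (Q s0)) > 0" using \<rho>0[of s0] by simp
      show "\<not> (\<exists>t\<in>{a..b}. \<gamma> t = c s0 \<and> h t > k s0)"
        using small True \<delta> by (force simp: P_def norm_minus_commute)
    qed
  next
    case False
    \<comment> \<open>Both coordinates at most \<open>2 * \<delta>\<close> would give a squared
      distance of at most \<open>8 * \<delta>\<^sup>2\<close>, less than the required
      \<open>16 * \<delta>\<^sup>2\<close>.\<close>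
    have near: "\<bar>snd (P s0)\<bar> > 2 * \<delta>"
    proof (rule ccontr)
      assume "\<not> ?thesis"
      then have "(snd (P s0))\<^sup>2 \<le> (2 * \<delta>)\<^sup>2" using \<delta> abs_le_square_iff[of "snd (P s0)" "2 * \<delta>"] by simp
      moreover have "(norm (fst (P s0)))\<^sup>2 \<le> (2 * \<delta>)\<^sup>2" using False by (intro power_mono) auto
      moreover have "(4 * \<delta>)\<^sup>2 \<le> (norm (P s0))\<^sup>2" using far \<delta> by (intro power_mono) (auto simp: P_def)
      moreover have "\<delta>\<^sup>2 > 0" using \<delta> by simp
      ultimately show False unfolding norm_prod_sq power_mult_distrib by simp
    qed
    have limn: "((\<lambda>s. norm (fst (P s))) \<longlongrightarrow> norm (fst (P s0))) (at s0)"
      and lims: "((\<lambda>s. snd (P s)) \<longlongrightarrow> snd (P s0)) (at s0)" by (intro tendsto_intros PQ)+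
    show ?thesis
    proof (cases "snd (P s0) > 0")
      case up: True
      have "\<forall>\<^sub>F s in at s0. norm (fst (P s)) < 3 * \<delta>" using limn by (rule order_tendstoD) (use False \<delta> in auto)
      moreover have "\<forall>\<^sub>F s in at s0. snd (P s) > 0" using lims up by (rule order_tendstoD)
      ultimately have ev: "\<forall>\<^sub>F s in at s0. up s = cell_log \<gamma> h \<delta> a b (c s, k s)"
        by eventually_elim (simp add: cl)
      have height: "h t > k s0" if "t \<in> {a..b}" for t
        using small[OF that] near up \<delta> by (simp add: P_def abs_if split: if_splits)
      obtain Lm Lp where L: "((\<lambda>s. log_change \<gamma> a b (c s)) \<longlongrightarrow> Lm) (at_left s0)"
        "((\<lambda>s. log_change \<gamma> a b (c s)) \<longlongrightarrow> Lp) (at_right s0)"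
        "Lp - Lm = of_real (2 * pi * of_bool (c s0 \<in> \<gamma> ` {a..b})) * \<i>"
        using log_change_limits[OF \<gamma> c \<open>a < b\<close> ends off simple] trans height by blast
      have "snd (Q s0) > 0" using dQ(2)[of s0] near up by (simp add: abs_if split: if_splits)
      \<comment> \<open>Below the arc \<open>\<rho>\<close> is the smaller term, so the argument of
        the second logarithm in \<open>up\<close> stays within distance 1 of 1, off the cut.\<close>
      have "\<rho> s0 < norm (fst (P s0)) * norm (fst (Q s0))"
        unfolding \<rho>_def
        using norm_minus_snd_less[OF up nz(1)] norm_minus_snd_less[OF \<open>snd (Q s0) > 0\<close> nz(2)]
          abs_snd_le_norm[of "P s0"] abs_snd_le_norm[of "Q s0"]
        by (intro mult_strict_mono) auto
      then have "norm (of_real (\<rho> s0) / (cnj (fst (P s0)) * fst (Q s0))) < 1"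
        using \<rho>0[of s0] nz by (simp add: norm_divide norm_mult)
      then have "\<bar>Re (of_real (\<rho> s0) / (cnj (fst (P s0)) * fst (Q s0)))\<bar> < 1"
        using abs_Re_le_cmod le_less_trans by blast
      then have "1 + of_real (\<rho> s0) / (cnj (fst (P s0)) * fst (Q s0)) \<notin> \<real>\<^sub>\<le>\<^sub>0"
        by (auto simp: complex_nonpos_Reals_iff)
      then have M: "((\<lambda>s. Ln (1 + of_real (\<rho> s) / (cnj (fst (P s)) * fst (Q s)))) \<longlongrightarrow>
          Ln (1 + of_real (\<rho> s0) / (cnj (fst (P s0)) * fst (Q s0)))) (at s0)" (is "(_ \<longlongrightarrow> ?M) _")
        by (intro tendsto_Ln tendsto_intros lim\<rho> PQ) (use nz in auto)
      have lim_up: "(up \<longlongrightarrow> Lm + ?M) (at_left s0)" "(up \<longlongrightarrow> Lp + ?M) (at_right s0)"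
        unfolding up_def by (intro tendsto_add L isCont_imp_limits[OF M])+
      have "((\<lambda>s. cell_log \<gamma> h \<delta> a b (c s, k s)) \<longlongrightarrow> Lm + ?M) (at_left s0)"
        by (rule Lim_transform_eventually[OF lim_up(1)], rule filter_leD[OF at_le ev]) simp
      moreover have "((\<lambda>s. cell_log \<gamma> h \<delta> a b (c s, k s)) \<longlongrightarrow> Lp + ?M) (at_right s0)"
        by (rule Lim_transform_eventually[OF lim_up(2)], rule filter_leD[OF at_le ev]) simp
      moreover have "(Lp + ?M) - (Lm + ?M) = of_real (2 * pi * of_bool (\<exists>t\<in>{a..b}. \<gamma> t = c s0 \<and> h t > k s0)) * \<i>"
      proof -
        have "c s0 \<in> \<gamma> ` {a..b} \<longleftrightarrow> (\<exists>t\<in>{a..b}. \<gamma> t = c s0 \<and> h t > k s0)" using height by force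
        then show ?thesis using L(3) by simp
      qed
      ultimately show ?thesis by (intro exI conjI)
    next
      case dn: False
      have sP: "snd (P s0) < 0" using near dn \<delta> by (auto simp: abs_if split: if_splits)
      have sQ: "snd (Q s0) < 0" using dQ(2)[of s0] near dn \<delta> by (auto simp: abs_if split: if_splits)
      show ?thesis
      proof (rule down)
        have "\<forall>\<^sub>F s in at s0. snd (P s) < 0" using lims sP by (rule order_tendstoD)
        then show "\<forall>\<^sub>F s in at s0. cell_log \<gamma> h \<delta> a b (c s, k s) = Ln (q s)"
          by eventually_elim (simp add: cl)
        \<comment> \<open>Above the arc the inequality is reversed, so the sum has positive real
          part whatever the argument of the horizontal product is.\<close>
        have "norm (fst (P s0)) * norm (fst (Q s0)) < \<rho> s0"
          unfolding \<rho>_def using sP sQ norm_fst_le_norm[of "P s0"] norm_fst_le_norm[of "Q s0"] nz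
            norm_ge_zero[of "P s0"] norm_ge_zero[of "Q s0"] norm_ge_zero[of "fst (Q s0)"]
          by (intro mult_strict_mono) (simp_all del: norm_ge_zero)
        moreover have "\<bar>Re (cnj (fst (P s0)) * fst (Q s0))\<bar> \<le> norm (fst (P s0)) * norm (fst (Q s0))"
          by (metis abs_Re_le_cmod complex_mod_cnj norm_mult)
        ultimately show "Re (of_real (\<rho> s0) + cnj (fst (P s0)) * fst (Q s0)) > 0" by simp
        show "\<not> (\<exists>t\<in>{a..b}. \<gamma> t = c s0 \<and> h t > k s0)"
          using small near dn \<delta> by (force simp: P_def abs_if split: if_splits)
      qed
    qed
  qed
qed

lemma exp_eq_pos_real_imp_Ints:
  assumes "exp z = of_real r" "r > 0"
  shows "Im z / (2 * pi) \<in> \<int>"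
proof -
  have "exp z = exp (of_real (ln r))" using assms by (simp add: exp_of_real)
  then obtain m :: int where "z = of_real (ln r) + (of_int (2 * m) * pi) * \<i>" unfolding exp_eq by blast
  then show ?thesis by simp
qed

text \<open>
  The hypotheses say that \<open>K1 \<inter> K2\<close> separates the two curves. Then the holonomy around the second one has a
  periodic logarithm along the first. Comparing it with the sum of the logarithms over the cells,
  which jumps by \<open>2 \<pi> \<i>\<close> at each passage under the second curve, shows that there is no such passage.
\<close>

lemma no_under_passage:
  fixes \<gamma> c :: "real \<Rightarrow> complex" and h k :: "real \<Rightarrow> real"
  assumes \<gamma>: "\<gamma> C1_differentiable_on UNIV" and c: "c C1_differentiable_on UNIV"
    and h: "continuous_on UNIV h" and k: "continuous_on UNIV k"
    and per: "\<And>t m. \<gamma> (t + of_int m) = \<gamma> t" "\<And>t m. h (t + of_int m) = h t"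
      "\<And>t m. c (t + of_int m) = c t" "\<And>t m. k (t + of_int m) = k t"
    and K: "closed K1" "closed K2" "K1 \<union> K2 = UNIV" "Borsukian (K1 \<inter> K2)"
    and L1: "\<And>s. (c s, k s) \<in> K1" and L2: "\<And>t. (\<gamma> t, h t) \<notin> K1"
    and off: "\<And>s0. \<forall>\<^sub>F s in at s0. c s \<notin> range \<gamma>"
    and fin: "finite {t\<in>{0..2}. \<gamma> t \<in> range c}" "finite {s\<in>{0..1}. c s \<in> range \<gamma>}"
    and simple: "\<And>s t t'. \<gamma> t = c s \<Longrightarrow> \<gamma> t' = c s \<Longrightarrow> t - t' \<in> \<int>"
    and trans: "\<And>s t. \<gamma> t = c s \<Longrightarrow> h t > k s \<Longrightarrow>
       plane_det (vector_derivative \<gamma> (at t)) (vector_derivative c (at s)) > 0"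
    and cross: "\<gamma> t1 = c s1"
  shows "\<not> h t1 > k s1"
proof
  assume above: "h t1 > k s1"
  have cont2: "continuous_on A (\<lambda>t. (\<gamma> t, h t))" and cont1: "continuous_on A (\<lambda>s. (c s, k s))" for A
    by (intro continuous_on_Pair C1_continuous_on[OF \<gamma>] C1_continuous_on[OF c] continuous_on_subset[OF h] continuous_on_subset[OF k]; simp)+
  have red: "\<exists>t'\<in>{0..1}. (\<gamma> t, h t) = (\<gamma> t', h t')" for t
    using per(1,2)[of "frac t" "\<lfloor>t\<rfloor>"] frac_lt_1[of t]
    by (intro bexI[of _ "frac t"]) (auto simp: frac_def less_imp_le)
  have "compact ((\<lambda>t. (\<gamma> t, h t)) ` {0..1})" by (intro compact_continuous_image cont2) auto
  moreover have "K1 \<inter> (\<lambda>t. (\<gamma> t, h t)) ` {0..1} = {}" using L2 by auto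
  ultimately obtain d where d: "d > 0" "\<And>x y. x \<in> K1 \<Longrightarrow> y \<in> (\<lambda>t. (\<gamma> t, h t)) ` {0..1} \<Longrightarrow> d \<le> dist x y"
    using separate_closed_compact[OF K(1)] by metis
  \<comment> \<open>Makes \<open>4 * \<delta>\<close> the guaranteed distance between
    \<open>K1\<close> and the curve, as asked for by \<open>cell_log_limits\<close>.\<close>
  define \<delta> where "\<delta> = d / 4"
  have \<delta>: "\<delta> > 0" using d by (simp add: \<delta>_def)
  have far: "4 * \<delta> \<le> norm ((\<gamma> t, h t) - x)" if "x \<in> K1" for x t
    using red[of t] d(2)[OF that] by (force simp: \<delta>_def dist_norm norm_minus_commute)
  have "uniformly_continuous_on {0..2} (\<lambda>t. (\<gamma> t, h t))"
    by (rule compact_uniformly_continuous[OF cont2]) simp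
  then obtain \<eta> where \<eta>: "\<eta> > 0"
    "\<And>t t'. t \<in> {0..2} \<Longrightarrow> t' \<in> {0..2} \<Longrightarrow> dist t' t < \<eta> \<Longrightarrow> dist (\<gamma> t', h t') (\<gamma> t, h t) < \<delta>"
    unfolding uniformly_continuous_on_def using \<delta> by metis
  obtain N0 where N0: "1 / \<eta> < real N0" using reals_Archimedean2 by blast
  define N where "N = Suc N0"
  have N: "N > 0" "1 / real N < \<eta>"
  proof -
    have "1 / \<eta> < real N" using N0 by (simp add: N_def)
    then show "1 / real N < \<eta>" using \<eta>(1) by (simp add: field_simps N_def)
  qed (simp add: N_def)
  \<comment> \<open>The offsets for which a vertex of the polygon projects onto the curve
    \<open>c\<close>. They are finite in number, so some offset \<open>t0\<close> puts all crossings
    in the interior of cells. Vertices \<open>t0 + m / N\<close> range over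
    \<open>{0..2}\<close>.\<close>
  let ?Bad = "\<Union>m\<in>{..N}. (\<lambda>t. t - real m / real N) ` {t\<in>{0..2}. \<gamma> t \<in> range c}"
  have "finite ?Bad" using fin(1) by simp
  then have "\<not> {0..1::real} \<subseteq> ?Bad"
    using infinite_Icc[of "0::real" 1] finite_subset[of "{0..1::real}" ?Bad] by (metis zero_less_one)
  then obtain t0 where t0: "t0 \<in> {0..1::real}" "t0 \<notin> ?Bad" by blast
  define a where "a m = t0 + real m / real N" for m
  have a_bounds: "a m \<in> {0..2}" if "m \<le> N" for m
    using t0(1) that N(1) by (auto simp: a_def divide_le_eq_1 intro: add_mono[of t0 1 "real m / real N" 1, simplified])
  have a_off: "\<gamma> (a m) \<noteq> c s" if "m \<le> N" for m s
  proof
    assume "\<gamma> (a m) = c s"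
    then have "a m \<in> {t\<in>{0..2}. \<gamma> t \<in> range c}" using a_bounds[OF that] by auto
    then have "t0 \<in> ?Bad" using that by (intro UN_I[of m] image_eqI[of _ _ "a m"]) (auto simp: a_def)
    with t0 show False by blast
  qed
  have a_less: "a m < a (Suc m)" "a (Suc m) - a m = 1 / real N" for m
    using N(1) by (simp_all add: a_def field_simps)
  have small: "norm (\<gamma> t - \<gamma> (a m)) < \<delta> \<and> \<bar>h t - h (a m)\<bar> < \<delta> \<and> dist (\<gamma> t, h t) (\<gamma> (a m), h (a m)) < \<delta>"
    if "m < N" "t \<in> {a m..a (Suc m)}" for m t
  proof -
    have "t \<in> {0..2}" "a m \<in> {0..2}" using a_bounds[of m] a_bounds[of "Suc m"] that by auto
    moreover have "dist t (a m) < \<eta>" using that a_less(2)[of m] N(2) by (auto simp: dist_real_def)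
    ultimately have D: "dist (\<gamma> t, h t) (\<gamma> (a m), h (a m)) < \<delta>" using \<eta>(2) by blast
    moreover have "dist (\<gamma> t) (\<gamma> (a m)) \<le> dist (\<gamma> t, h t) (\<gamma> (a m), h (a m))" "dist (h t) (h (a m)) \<le> dist (\<gamma> t, h t) (\<gamma> (a m), h (a m))"
      using dist_fst_le[of "(\<gamma> t, h t)" "(\<gamma> (a m), h (a m))"] dist_snd_le[of "(\<gamma> t, h t)" "(\<gamma> (a m), h (a m))"] by simp_all
    ultimately show ?thesis by (simp add: dist_norm)
  qed
  define p where "p m = (\<gamma> (a m), h (a m))" for m
  have pN: "p N = p 0" using per(1,2)[of t0 1] N(1) by (simp add: p_def a_def)
  \<comment> \<open>A side shorter than the distance from \<open>x\<close> to its start is seen from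
    \<open>x\<close> under an acute angle.\<close>
  have inner_pos: "(p m - x) \<bullet> (p (Suc m) - x) > 0" if "x \<in> K1" "m < N" for x m
  proof -
    have 1: "4 * \<delta> \<le> norm (p m - x)" using far[OF that(1)] by (simp add: p_def)
    have "dist (p (Suc m)) (p m) < \<delta>"
      using small[OF that(2), of "a (Suc m)"] a_less(1)[of m] by (simp add: p_def)
    then have "norm ((p m - x) - (p (Suc m) - x)) < \<delta>"
      by (simp add: dist_norm norm_minus_commute)
    then have "norm ((p m - x) - (p (Suc m) - x)) < norm (p m - x)" using 1 \<delta> by linarith
    then have "(norm ((p m - x) - (p (Suc m) - x)))\<^sup>2 < (norm (p m - x))\<^sup>2"
      by (intro power_strict_mono) auto
    moreover have "0 < (A + B - C) / 2" if "C < A" "0 \<le> B" for A B C :: real using that by simp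
    ultimately show ?thesis unfolding dot_norm_neg using zero_le_power2 by blast
  qed
  have hol: "holonomy p N x = (\<Prod>m<N. spin_inner (p m - x) (p (Suc m) - x))" for x
    by (rule holonomy_eq[OF N(1) pN])
  have hol_nz: "holonomy p N x \<noteq> 0" if "x \<in> K1" for x
    unfolding hol using spin_inner_nonzero[OF inner_pos[OF that]] by simp
  obtain g where g: "continuous_on K1 g" "\<And>x. x \<in> K1 \<Longrightarrow> holonomy p N x = exp (g x)"
    using closed_Un_continuous_logarithm[OF K continuous_holonomy hol_nz] by metis
  define G where "G s = g (c s, k s)" for s
  have contG: "continuous_on UNIV G"
    unfolding G_def by (rule continuous_on_compose2[OF g(1) cont1]) (use L1 in auto)
  define l where "l m s = cell_log \<gamma> h \<delta> (a m) (a (Suc m)) (c s, k s)" for m s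
  \<comment> \<open>The global logarithm and the sum of local ones have exponentials differing by a
    positive factor, so \<open>\<psi>\<close> is an integer off the crossings. It is periodic, and
    continuity of \<open>G\<close> leaves only the jumps of the cells.\<close>
  define \<psi> where "\<psi> s = Im (G s - (\<Sum>m<N. l m s)) / (2 * pi)" for s
  have per\<psi>: "\<psi> (s + 1) = \<psi> s" for s
    using per(3,4)[of s 1] by (simp add: \<psi>_def G_def l_def)
  have int: "\<psi> s \<in> \<int>" if s: "c s \<notin> range \<gamma>" for s
  proof -
    have "\<exists>r>0. exp (l m s) = of_real r * spin_inner (p m - (c s, k s)) (p (Suc m) - (c s, k s))" if "m < N" for m
    proof (rule exp_cell_log[OF \<gamma>, of "a m" "a (Suc m)" "(c s, k s)" h \<delta>])
      show "fst (c s, k s) \<notin> \<gamma> ` {a m..a (Suc m)}" using s by auto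
    qed (use a_less(1)[of m] inner_pos[OF L1 that] in \<open>auto simp: l_def p_def\<close>)
    then obtain r where r: "\<And>m. m < N \<Longrightarrow> r m > 0"
      "\<And>m. m < N \<Longrightarrow> exp (l m s) = of_real (r m) * spin_inner (p m - (c s, k s)) (p (Suc m) - (c s, k s))"
      by metis
    have "exp (\<Sum>m<N. l m s) = (\<Prod>m<N. of_real (r m) * spin_inner (p m - (c s, k s)) (p (Suc m) - (c s, k s)))"
      unfolding exp_sum[OF finite_lessThan] by (intro prod.cong refl r(2)) simp
    also have "\<dots> = of_real (\<Prod>m<N. r m) * exp (G s)"
      by (simp add: prod.distrib G_def flip: hol g(2)[OF L1])
    finally have "exp (\<Sum>m<N. l m s) = of_real (\<Prod>m<N. r m) * exp (G s)" .
    moreover have pos: "(\<Prod>m<N. r m) > 0" using r(1) by (intro prod_pos) auto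
    ultimately have "exp (G s - (\<Sum>m<N. l m s)) = of_real (1 / (\<Prod>m<N. r m))"
      by (simp add: exp_diff field_simps del: of_real_prod)
    from exp_eq_pos_real_imp_Ints[OF this] pos show ?thesis by (simp add: \<psi>_def)
  qed
  define J where "J m s \<longleftrightarrow> (\<exists>t\<in>{a m..a (Suc m)}. \<gamma> t = c s \<and> h t > k s)" for m s
  have lims: "\<exists>dm dp. (\<forall>\<^sub>F s in at_left s0. \<psi> s = dm) \<and> (\<forall>\<^sub>F s in at_right s0. \<psi> s = dp) \<and>
      dp - dm = - (\<Sum>m<N. of_bool (J m s0))" for s0
  proof -
    have "\<exists>Lm Lp. ((\<lambda>s. l m s) \<longlongrightarrow> Lm) (at_left s0) \<and> ((\<lambda>s. l m s) \<longlongrightarrow> Lp) (at_right s0) \<and>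
        Lp - Lm = of_real (2 * pi * of_bool (J m s0)) * \<i>" if m: "m < N" for m
      unfolding l_def J_def
    proof (rule cell_log_limits[OF \<gamma> C1_has_vector_derivative[OF c] _ a_less(1) \<delta>])
      show "isCont k s0" using k by (simp add: continuous_on_eq_continuous_at)
      show "norm (\<gamma> t - \<gamma> (a m)) < \<delta> \<and> \<bar>h t - h (a m)\<bar> < \<delta>" if "t \<in> {a m..a (Suc m)}" for t
        using small[OF m that] by blast
      show "4 * \<delta> \<le> norm (\<gamma> (a m) - c s0, h (a m) - k s0)" using far[OF L1, of "a m" s0] by simp
      show "c s0 \<noteq> \<gamma> (a m)" "c s0 \<noteq> \<gamma> (a (Suc m))" using a_off[of m s0] a_off[of "Suc m" s0] m by auto
      then show "t = t'" if t: "t \<in> {a m..a (Suc m)}" "t' \<in> {a m..a (Suc m)}" "\<gamma> t = c s0" "\<gamma> t' = c s0" for t t'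
      proof -
        have "t \<noteq> a m" "t \<noteq> a (Suc m)" "t' \<noteq> a m" "t' \<noteq> a (Suc m)" using t \<open>c s0 \<noteq> \<gamma> (a m)\<close> \<open>c s0 \<noteq> \<gamma> (a (Suc m))\<close> by auto
        then have "\<bar>t - t'\<bar> < a (Suc m) - a m" using t by (auto simp: abs_if)
        also have "\<dots> \<le> 1" using a_less(2) N(1) by simp
        finally show ?thesis using Ints_nonzero_abs_less1[OF simple[OF t(3,4)]] by simp
      qed
      show "\<forall>\<^sub>F s in at s0. c s \<notin> \<gamma> ` {a m..a (Suc m)}" using off by eventually_elim auto
      show "plane_det (vector_derivative \<gamma> (at t)) (vector_derivative c (at s0)) > 0" if "\<gamma> t = c s0" "h t > k s0" for t
        using trans[OF that] .
    qed
    then obtain Lm Lp where L: "\<And>m. m < N \<Longrightarrow> ((\<lambda>s. l m s) \<longlongrightarrow> Lm m) (at_left s0)"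
      "\<And>m. m < N \<Longrightarrow> ((\<lambda>s. l m s) \<longlongrightarrow> Lp m) (at_right s0)"
      "\<And>m. m < N \<Longrightarrow> Lp m - Lm m = of_real (2 * pi * of_bool (J m s0)) * \<i>" by metis
    have Gs: "(G \<longlongrightarrow> G s0) (at s0)" using contG by (simp add: continuous_on_def)
    let ?dm = "Im (G s0 - (\<Sum>m<N. Lm m)) / (2 * pi)" and ?dp = "Im (G s0 - (\<Sum>m<N. Lp m)) / (2 * pi)"
    have "(\<psi> \<longlongrightarrow> ?dm) (at_left s0)" "(\<psi> \<longlongrightarrow> ?dp) (at_right s0)"
      unfolding \<psi>_def by (intro tendsto_intros isCont_imp_limits[OF Gs] L; simp)+
    moreover have "\<forall>\<^sub>F s in at_left s0. \<psi> s \<in> \<int>" "\<forall>\<^sub>F s in at_right s0. \<psi> s \<in> \<int>"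
      using filter_leD[OF at_le off[of s0], of "{..<s0}"] filter_leD[OF at_le off[of s0], of "{s0<..}"]
      by (auto elim!: eventually_mono intro: int)
    ultimately have "\<forall>\<^sub>F s in at_left s0. \<psi> s = ?dm" "\<forall>\<^sub>F s in at_right s0. \<psi> s = ?dp"
      by (auto intro: tendsto_Ints_eventually_const)
    moreover have "?dp - ?dm = - (\<Sum>m<N. Im (Lp m - Lm m) / (2 * pi))"
      by (simp add: sum_subtractf diff_divide_distrib flip: sum_divide_distrib)
    moreover have "(\<Sum>m<N. Im (Lp m - Lm m) / (2 * pi)) = (\<Sum>m<N. of_bool (J m s0))"
      by (intro sum.cong refl) (simp add: L(3) del: minus_complex.sel)
    ultimately show ?thesis by metis
  qed
  let ?T = "{s\<in>{0..<1}. c s \<in> range \<gamma>}"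
  have lim: "Lim (at_right s0) \<psi> - Lim (at_left s0) \<psi> = - (\<Sum>m<N. of_bool (J m s0))" for s0
  proof -
    obtain dm dp where d: "\<forall>\<^sub>F s in at_left s0. \<psi> s = dm" "\<forall>\<^sub>F s in at_right s0. \<psi> s = dp"
      "dp - dm = - (\<Sum>m<N. of_bool (J m s0))" using lims[of s0] by blast
    have "Lim (at_left s0) \<psi> = dm" "Lim (at_right s0) \<psi> = dp"
      by (rule Lim_eventually_const[OF d(1)], simp) (rule Lim_eventually_const[OF d(2)], simp)
    with d(3) show ?thesis by simp
  qed
  \<comment> \<open>Over a period the jumps of \<open>\<psi>\<close> add up to zero, and none of
    them is positive; so no cell has a jump.\<close>
  have "Lim (at_left 1) \<psi> - Lim (at_left 0) \<psi> = (\<Sum>s\<in>?T. Lim (at_right s) \<psi> - Lim (at_left s) \<psi>)"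
  proof (rule sum_of_jumps_Lim)
    show "finite ?T" by (rule finite_subset[OF _ fin(2)]) auto
    show "Lim (at_left u) \<psi> = Lim (at_right u) \<psi>" if "u \<in> {0..<1} - ?T" for u
    proof -
      have "c u \<notin> range \<gamma>" using that by auto
      then have "\<not> J m u" for m unfolding J_def by (metis rangeI)
      then show ?thesis using lim[of u] by simp
    qed
    show "\<exists>d. \<forall>\<^sub>F x in at_left u. \<psi> x = d" "\<exists>d. \<forall>\<^sub>F x in at_right u. \<psi> x = d" for u
      using lims[of u] by blast+
  qed auto
  moreover have "Lim (at_left 1) \<psi> = Lim (at_left 0) \<psi>"
  proof -
    obtain d where d0: "\<forall>\<^sub>F x in at_left 0. \<psi> x = d" using lims by blast
    then have "\<forall>\<^sub>F r in at_right 0. \<psi> (0 + - 1 * r) = d" unfolding eventually_at_right_0_shift(1) .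
    moreover have "\<psi> (1 + - 1 * r) = \<psi> (0 + - 1 * r)" for r using per\<psi>[of "- r"] by simp
    ultimately have "\<forall>\<^sub>F x in at_left 1. \<psi> x = d" unfolding eventually_at_right_0_shift(1)[of _ 1] by simp
    from Lim_eventually_const[OF this] Lim_eventually_const[OF d0] show ?thesis by simp
  qed
  ultimately have "(\<Sum>s\<in>?T. \<Sum>m<N. of_bool (J m s)) = (0::real)" by (simp add: lim sum_negf)
  moreover have "finite ?T" by (rule finite_subset[OF _ fin(2)]) auto
  ultimately have "\<forall>s\<in>?T. (\<Sum>m<N. of_bool (J m s)) = (0::real)"
    by (subst (asm) sum_nonneg_eq_0_iff) (auto intro: sum_nonneg)
  then have noJ: "\<not> J m s" if "s \<in> ?T" "m < N" for s m
    using that by (subst (asm) sum_nonneg_eq_0_iff) auto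
  define s where "s = frac s1"
  \<comment> \<open>The representative of \<open>t1\<close> in the period
    \<open>[t0, t0 + 1)\<close> covered by the cells.\<close>
  define t where "t = t1 - of_int \<lfloor>t1 - t0\<rfloor>"
  have cs: "c s = c s1" "k s = k s1" using per(3,4)[of s "\<lfloor>s1\<rfloor>"] by (simp_all add: s_def frac_def)
  have ts: "\<gamma> t = \<gamma> t1" "h t = h t1" using per(1,2)[of t "\<lfloor>t1 - t0\<rfloor>"] by (simp_all add: t_def)
  have sT: "s \<in> ?T" using cross frac_lt_1[of s1] cs by (auto simp: s_def) (metis rangeI)
  have t: "0 \<le> t - t0" "t - t0 < 1" unfolding t_def by linarith+
  define m where "m = nat \<lfloor>(t - t0) * real N\<rfloor>"
  have m: "real m \<le> (t - t0) * real N" "(t - t0) * real N < real m + 1"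
    using t(1) N(1) by (simp_all add: m_def)
  have "(t - t0) * real N < real N" using t(2) N(1) by simp
  then have "m < N" using m(1) by linarith
  have "t \<in> {a m..a (Suc m)}" using m N(1) by (simp add: a_def field_simps)
  then have "J m s" using cross above cs ts unfolding J_def by metis
  with noJ[OF sT \<open>m < N\<close>] show False by blast
qed

subsection \<open>Split links and split diagrams\<close>

abbreviation north_pole :: "(complex \<times> real) \<times> real" where "north_pole \<equiv> (0, 1)"

definition stereographic :: "(complex \<times> real) \<times> real \<Rightarrow> complex \<times> real" where
  "stereographic x = (1 / (1 - snd x)) *\<^sub>R fst x"

lemma S3_iff: "x \<in> S3 \<longleftrightarrow> (norm (fst x))\<^sup>2 + (snd x)\<^sup>2 = 1"
  by (auto simp: S3_def norm_prod_def)

lemma norm_sq_plus_1_neq_0: "(norm x)\<^sup>2 + 1 \<noteq> (0::real)"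
  using zero_le_power2[of "norm x"] by linarith

lemma stereographic_inverse: "stereographic (inverse_stereographic x) = x"
proof -
  let ?N = "(norm x)\<^sup>2"
  have N: "?N + 1 \<noteq> 0" by (rule norm_sq_plus_1_neq_0)
  have eq: "1 - (?N - 1) / (?N + 1) = 2 / (?N + 1)" using N by (simp add: field_simps)
  have eq2: "1 / (2 / (?N + 1)) * (2 / (?N + 1)) = 1" using N by (simp add: field_simps)
  show ?thesis
    unfolding stereographic_def inverse_stereographic_def snd_conv fst_conv eq scaleR_scaleR eq2 by (rule scaleR_one)
qed

lemma inverse_stereographic_S3: "inverse_stereographic x \<in> S3 - {north_pole}"
proof -
  let ?N = "(norm x)\<^sup>2"
  have N: "?N + 1 \<noteq> 0" by (rule norm_sq_plus_1_neq_0)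
  have "(2 / (?N + 1))\<^sup>2 * ?N + ((?N - 1) / (?N + 1))\<^sup>2 = 1"
  proof -
    have "(2 / (?N + 1))\<^sup>2 * ?N + ((?N - 1) / (?N + 1))\<^sup>2 = (4 * ?N + (?N - 1)\<^sup>2) / (?N + 1)\<^sup>2"
      by (simp add: power_divide add_divide_distrib)
    also have "4 * ?N + (?N - 1)\<^sup>2 = (?N + 1)\<^sup>2" by (simp add: power2_eq_square algebra_simps)
    finally show ?thesis using N by simp
  qed
  then have "inverse_stereographic x \<in> S3"
    unfolding S3_iff inverse_stereographic_def fst_conv snd_conv norm_scaleR power_mult_distrib power2_abs .
  moreover have "(?N - 1) / (?N + 1) \<noteq> 1" using N by (simp add: field_simps)
  then have "inverse_stereographic x \<noteq> north_pole" unfolding inverse_stereographic_def by (metis snd_conv)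
  ultimately show ?thesis by blast
qed

lemma inverse_stereographic_stereographic:
  assumes "x \<in> S3 - {north_pole}"
  shows "inverse_stereographic (stereographic x) = x"
proof -
  obtain p r where x: "x = (p, r)" by (cases x)
  have sq: "(norm p)\<^sup>2 = (1 - r) * (1 + r)" using assms by (simp add: x S3_iff power2_eq_square algebra_simps)
  have r: "1 - r \<noteq> 0"
  proof
    assume "1 - r = 0"
    with sq have "p = 0" by simp
    with assms \<open>1 - r = 0\<close> show False by (simp add: x)
  qed
  have N: "(norm (stereographic x))\<^sup>2 = (1 + r) / (1 - r)"
    using r sq by (simp add: stereographic_def x power_mult_distrib power_divide power2_eq_square)
  have N1: "(1 + r) / (1 - r) + 1 = 2 / (1 - r)" "(1 + r) / (1 - r) - 1 = 2 * r / (1 - r)"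
    using r by (simp_all add: field_simps)
  show ?thesis
    unfolding inverse_stereographic_def N N1 using r by (simp add: stereographic_def x)
qed

lemma continuous_inverse_stereographic: "continuous_on A inverse_stereographic"
  unfolding inverse_stereographic_def
  by (intro continuous_intros) (use norm_sq_plus_1_neq_0 in auto)

lemma snd_S3_neq_1: "x \<in> S3 - {north_pole} \<Longrightarrow> 1 - snd x \<noteq> 0"
  by (cases x) (auto simp: S3_iff)

lemma continuous_stereographic: "continuous_on (S3 - {north_pole}) stereographic"
  unfolding stereographic_def
  by (intro continuous_intros) (use snd_S3_neq_1 in auto)

lemma inj_inverse_stereographic: "inverse_stereographic x = inverse_stereographic y \<longleftrightarrow> x = y"
  by (metis stereographic_inverse)

lemma vimage_homeomorphic:
  assumes "S \<subseteq> S3"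
  shows "S - {north_pole} homeomorphic inverse_stereographic -` S"
proof -
  have "homeomorphism (S - {north_pole}) (inverse_stereographic -` S) stereographic inverse_stereographic"
  proof
    show "continuous_on (S - {north_pole}) stereographic"
      by (rule continuous_on_subset[OF continuous_stereographic]) (use assms in auto)
    show "stereographic ` (S - {north_pole}) \<subseteq> inverse_stereographic -` S"
    proof
      fix y assume "y \<in> stereographic ` (S - {north_pole})"
      then obtain x where x: "x \<in> S" "x \<in> S3 - {north_pole}" "y = stereographic x" using assms by blast
      with inverse_stereographic_stereographic[OF x(2)] show "y \<in> inverse_stereographic -` S"
        by (simp only: vimage_eq)
    qed
    show "inverse_stereographic ` (inverse_stereographic -` S) \<subseteq> S - {north_pole}"
      by (rule image_subsetI) (use inverse_stereographic_S3 in blast)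
    show "inverse_stereographic (stereographic x) = x" if "x \<in> S - {north_pole}" for x
      using assms that by (intro inverse_stereographic_stereographic) auto
  qed (auto simp: stereographic_inverse continuous_inverse_stereographic)
  then show ?thesis unfolding homeomorphic_def by blast
qed

text \<open>The point at infinity may lie on the splitting sphere or not. In the first case a plane
  remains, in the second the whole 2-sphere; both are Borsukian.\<close>

lemma Borsukian_punctured_sphere:
  assumes "S homeomorphic sphere (0 :: complex \<times> real) 1"
  shows "Borsukian (S - {a})"
proof (cases "a \<in> S")
  case False
  then show ?thesis
    using Borsukian_sphere[of "0 :: complex \<times> real" 1] homeomorphic_Borsukian_eq[OF assms] by simp
next
  case True
  obtain f g where fg: "homeomorphism S (sphere (0 :: complex \<times> real) 1) f g"
    using assms by (auto simp: homeomorphic_def)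
  have fa: "f a \<in> sphere 0 1" using fg True by (auto simp: homeomorphism_def)
  have "homeomorphism (S - {a}) (sphere 0 1 - {f a}) f g"
  proof (rule homeomorphism_of_subsets[OF fg])
    show "f ` (S - {a}) = sphere 0 1 - {f a}"
    proof -
      have "inj_on f S" "f ` S = sphere 0 1" using fg by (auto simp: homeomorphism_def intro: inj_on_inverseI)
      then show ?thesis using inj_on_image_set_diff[of f S S "{a}"] True by simp
    qed
  qed auto
  then have "S - {a} homeomorphic (sphere 0 1 - {f a})" unfolding homeomorphic_def by blast
  moreover have "(sphere 0 1 - {f a}) homeomorphic {x :: complex \<times> real. (0, 1) \<bullet> x = 0}"
    by (rule homeomorphic_punctured_sphere_hyperplane[OF _ fa]) (simp_all add: zero_prod_def)
  moreover have "Borsukian {x :: complex \<times> real. (0, 1) \<bullet> x = 0}"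
    by (intro convex_imp_Borsukian convex_hyperplane)
  ultimately show ?thesis by (meson homeomorphic_Borsukian_eq)
qed

lemma tame_2sphere_props:
  assumes "tame_2sphere S"
  shows "compact S" "S \<subseteq> S3" "Borsukian (inverse_stereographic -` S)"
proof -
  obtain e :: "(complex \<times> real) \<times> real \<Rightarrow> (complex \<times> real) \<times> real" where e:
    "continuous_on (sphere 0 1 \<times> {-1..1}) e" "inj_on e (sphere 0 1 \<times> {-1..1})"
    "e ` (sphere 0 1 \<times> {-1..1}) \<subseteq> S3" "S = e ` (sphere 0 1 \<times> {0})"
    using assms unfolding tame_2sphere_def by blast
  define f where "f x = e (x, 0)" for x
  have sub: "sphere (0 :: complex \<times> real) 1 \<times> {0} \<subseteq> sphere 0 1 \<times> {-1..1::real}" by auto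
  have f: "continuous_on (sphere 0 1) f"
    unfolding f_def by (rule continuous_on_compose2[OF e(1)]) (auto intro!: continuous_intros)
  have fS: "f ` sphere 0 1 = S" unfolding e(4) f_def by auto
  show "compact S" unfolding fS[symmetric] by (intro compact_continuous_image f compact_sphere)
  show S: "S \<subseteq> S3" using e(3,4) sub by blast
  have "inj_on f (sphere 0 1)" 
  proof (rule inj_onI)
    fix x y :: "complex \<times> real" assume xy: "x \<in> sphere 0 1" "y \<in> sphere 0 1" "f x = f y"
    have "(x, 0) \<in> sphere 0 1 \<times> {-1..1::real}" "(y, 0) \<in> sphere 0 1 \<times> {-1..1::real}"
      using xy(1,2) sub by blast+
    from inj_onD[OF e(2) xy(3)[unfolded f_def] this] show "x = y" by (rule Pair_inject)
  qed
  then have "S homeomorphic sphere (0 :: complex \<times> real) 1"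
    using homeomorphic_compact[OF compact_sphere f fS] homeomorphic_sym by blast
  from Borsukian_punctured_sphere[OF this] vimage_homeomorphic[OF S]
  show "Borsukian (inverse_stereographic -` S)" using homeomorphic_Borsukian_eq by blast
qed

text \<open>Components of the complement are open because \<open>S3\<close> is locally connected.
  The two closed sets cover \<open>S3\<close> and meet exactly in \<open>S\<close>, as needed for
  \<open>closed_Un_continuous_logarithm\<close>.\<close>

lemma closed_sides_of_sphere:
  fixes x :: "(complex \<times> real) \<times> real"
  assumes S: "compact S" "S \<subseteq> S3"
  defines "U \<equiv> connected_component_set (S3 - S) x"
  shows "closed (U \<union> S)" "closed (S3 - U)"
proof -
  have "closedin (top_of_set S3) S" using S by (simp add: closed_subset compact_imp_closed)
  then have op: "openin (top_of_set S3) (S3 - S)" by (intro openin_diff) auto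
  have "locally connected S3" unfolding S3_def by (rule locally_connected_sphere)
  then have "locally connected (S3 - S)" using op locally_open_subset by blast
  then have "openin (top_of_set (S3 - S)) U" unfolding U_def by (rule openin_connected_component_locally_connected)
  then have U: "openin (top_of_set S3) U" using op openin_trans by blast
  have "openin (top_of_set (S3 - S)) (S3 - S - U)"
    unfolding U_def by (intro openin_diff openin_subtopology_self closedin_connected_component)
  then have V: "openin (top_of_set S3) (S3 - S - U)" using op openin_trans by blast
  have S3: "closed S3" by (simp add: S3_def)
  have "closedin (top_of_set S3) (S3 - (S3 - S - U))" "closedin (top_of_set S3) (S3 - U)"
    using U V by (auto intro: closedin_diff)
  moreover have "S3 - (S3 - S - U) = U \<union> S"
    using S(2) connected_component_subset[of "S3 - S" x] by (auto simp: U_def)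
  ultimately show "closed (U \<union> S)" "closed (S3 - U)" using closedin_closed_trans[OF _ S3] by auto
qed

section \<open>From a split link to a split diagram\<close>

context diagram
begin

lemma range_closed: assumes "i < n" shows "closed (range (\<gamma> i))"
proof -
  have "range (\<gamma> i) = \<gamma> i ` {0..1}"
  proof safe
    fix t
    have "\<gamma> i t = \<gamma> i (frac t)" "frac t \<in> {0..1}"
      using per_frac[OF assms] frac_lt_1[of t] by (auto simp: less_imp_le)
    then show "\<gamma> i t \<in> \<gamma> i ` {0..1}" by blast
  qed auto
  then show ?thesis
    by (metis compact_Icc compact_continuous_image compact_imp_closed continuous_\<gamma>[OF assms])
qed

lemma crossing_cases:
  assumes "i < n" "j < n" "i \<noteq> j" "\<gamma> i s = \<gamma> j t"
  shows "((i, frac s), (j, frac t)) \<in> crossings D \<or> ((j, frac t), (i, frac s)) \<in> crossings D"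
proof -
  have d: "double_pair D (i, frac s) (j, frac t)" using assms by (simp add: double_frac)
  then show ?thesis using double_sym[OF d] double_overs[OF d] by (auto simp: crossings_def)
qed

text \<open>The linking number of the two separated components is zero, and it counts the crossings
  with \<open>b\<close> over \<open>a\<close>, all with sign 1.\<close>

lemma linked_components:
  fixes h :: "nat \<Rightarrow> real \<Rightarrow> real"
  assumes ab: "a < n" "b < n" "a \<noteq> b"
    and cont: "\<And>i. i < n \<Longrightarrow> continuous_on UNIV (h i)" and per_h: "\<And>i t. i < n \<Longrightarrow> h i (t + 1) = h i t"
    and height: "\<And>i s j t. ((i, s), (j, t)) \<in> crossings D \<Longrightarrow> h i s > h j t"
    and K: "closed K1" "closed K2" "K1 \<union> K2 = UNIV" "Borsukian (K1 \<inter> K2)"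
    and L: "\<And>s. (\<gamma> a s, h a s) \<in> K1" "\<And>t. (\<gamma> b t, h b t) \<notin> K1"
    and pos: "\<And>s t. ((b, t), (a, s)) \<in> crossings D \<Longrightarrow> sgn (plane_det (vel D (b, t)) (vel D (a, s))) = 1"
  shows "((b, t), (a, s)) \<notin> crossings D"
proof
  assume cr: "((b, t), (a, s)) \<in> crossings D"
  have h_int: "h i (t + of_int m) = h i t" if "i < n" for i t m
  proof (induction m rule: int_induct[of _ 0])
    case (step1 k)
    then show ?case using per_h[OF that, of "t + of_int k"] by (simp add: add_ac)
  next
    case (step2 k)
    then show ?case using per_h[OF that, of "t + of_int (k - 1)"] by (simp add: add_ac)
  qed simp
  have h_frac: "h i (frac t) = h i t" if "i < n" for i t
    using h_int[OF that, of "frac t" "\<lfloor>t\<rfloor>"] by (simp add: frac_def)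
  have pass: "(a, frac s) \<in> passages D" "(b, frac t) \<in> passages D" if "\<gamma> b t = \<gamma> a s" for s t
    using that ab double_frac[of b a t s] double_frac[of a b s t] unfolding passages_def by auto
  have "\<not> h b t > h a s"
  proof (rule no_under_passage[OF C1[OF ab(2)] C1[OF ab(1)] cont[OF ab(2)] cont[OF ab(1)] per_int[OF ab(2)] h_int[OF ab(2)]
        per_int[OF ab(1)] h_int[OF ab(1)] K L])
    show "\<forall>\<^sub>F s in at s0. \<gamma> a s \<notin> range (\<gamma> b)" for s0
      using eventually_regular[OF ab(1)]
      by eventually_elim (use pass in \<open>auto simp: regular_params_def\<close>)
    show "finite {t \<in> {0..2}. \<gamma> b t \<in> range (\<gamma> a)}"
      by (rule finite_subset[OF _ finite_passage_times[of 0 2 b]]) (use pass in auto)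
    show "finite {s \<in> {0..1}. \<gamma> a s \<in> range (\<gamma> b)}"
      by (rule finite_subset[OF _ finite_passage_times[of 0 1 a]]) (use pass in force)
    show "t - t' \<in> \<int>" if "\<gamma> b t = \<gamma> a s" "\<gamma> b t' = \<gamma> a s" for s t t'
    proof -
      have "double_pair D (a, frac s) (b, frac t)" "double_pair D (a, frac s) (b, frac t')"
        using that ab by (auto simp: double_frac)
      from double_unique[OF this] show ?thesis by (auto intro: frac_eq_imp_diff_Ints)
    qed
    show "plane_det (V b t) (V a s) > 0" if "\<gamma> b t = \<gamma> a s" "h b t > h a s" for s t
    proof -
      have "((b, frac t), (a, frac s)) \<in> crossings D"
        using crossing_cases[OF ab(2,1) ab(3)[symmetric] that(1)] height[of a "frac s" b "frac t"] that(2) ab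
        by (auto simp: h_frac)
      from pos[OF this] show ?thesis using ab by (simp add: vel_frac sgn_1_pos)
    qed
    show "\<gamma> b t = \<gamma> a s" using cr double_pairD(5)[of b t a s] by (simp add: crossings_def)
  qed
  with height[OF cr] show False by simp
qed

lemma split_link_imp_split_diagram:
  assumes succ: "successively_almost_positive k D" and good: "good_diagram D"
    and rep: "represents D L" and split: "split_link L"
  shows "split_diagram D"
proof -
  have nL: "ncomps L = n" and oL: "oriented_link L" using rep by (auto simp: represents_def)
  obtain h where h: "\<And>i t. i < n \<Longrightarrow> curve L i t = inverse_stereographic (\<gamma> i t, h i t)"
    and height: "\<And>i s j t. ((i, s), (j, t)) \<in> crossings D \<Longrightarrow> h i s > h j t"
    using rep unfolding represents_def by blast
  have contL: "continuous_on UNIV (curve L i)" and perL: "curve L i (t + 1) = curve L i t" if "i < n" for i t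
    using oL that nL by (auto simp: oriented_link_def immersed_curves_def intro: C1_continuous_on)
  have curve_eq: "stereographic (curve L i t) = (\<gamma> i t, h i t)" if "i < n" for i t
    by (simp add: h[OF that] stereographic_inverse)
  \<comment> \<open>A representing link only comes with some height function; its continuity is
    recovered from that of the link by projecting back.\<close>
  have conth: "continuous_on UNIV (h i)" if "i < n" for i
  proof -
    have "range (curve L i) \<subseteq> S3 - {north_pole}"
      unfolding h[OF that] by (rule image_subsetI) (rule inverse_stereographic_S3)
    then have "continuous_on UNIV (\<lambda>t. snd (stereographic (curve L i t)))"
      by (intro continuous_on_snd continuous_on_compose2[OF continuous_stereographic contL[OF that]])
        auto
    then show ?thesis by (simp add: curve_eq[OF that])
  qed
  have perh: "h i (t + 1) = h i t" if "i < n" for i t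
    using curve_eq[OF that, of "t + 1"] curve_eq[OF that, of t] perL[OF that] by simp
  obtain S x y where S: "tame_2sphere S" "S \<inter> trace L = {}" and xy: "x \<in> trace L" "y \<in> trace L"
    "\<not> connected_component (S3 - S) x y" using split unfolding split_link_def by blast
  note props = tame_2sphere_props[OF S(1)]
  define U where "U = connected_component_set (S3 - S) x"
  have ranges: "range (curve L i) \<subseteq> S3 - S" "connected (range (curve L i))" if "i < n" for i
  proof -
    show "range (curve L i) \<subseteq> S3 - S" using oL S(2) that nL by (auto simp: oriented_link_def trace_def)
    show "connected (range (curve L i))" by (rule connected_continuous_image[OF contL[OF that] connected_UNIV])
  qed
  have dich: "range (curve L i) \<subseteq> U \<or> range (curve L i) \<inter> U = {}" if "i < n" for i
  proof (cases "range (curve L i) \<inter> U = {}")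
    case False
    then obtain z where z: "z \<in> range (curve L i)" "z \<in> U" by blast
    have "range (curve L i) \<subseteq> connected_component_set (S3 - S) z"
      by (rule connected_component_maximal[OF z(1) ranges(2,1)[OF that]])
    also have "\<dots> = U" using z(2) unfolding U_def by (simp add: connected_component_eq)
    finally show ?thesis by blast
  qed simp
  define A where "A = {i. i < n \<and> range (curve L i) \<subseteq> U}"
  have inA: "curve L i t \<in> U" if "i \<in> A" for i t using that by (auto simp: A_def)
  have notA: "curve L i t \<notin> U" if "i < n" "i \<notin> A" for i t using that dich by (auto simp: A_def)
  have xU: "x \<in> U" using xy(1) ranges nL by (force simp: U_def trace_def)
  have yU: "y \<notin> U" using xy(3) by (simp add: U_def)
  obtain ix where ix: "ix \<in> A" using xy(1) xU notA nL by (auto simp: trace_def)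
  obtain iy where iy: "iy < n" "iy \<notin> A" using xy(2) yU inA nL by (auto simp: trace_def)
  let ?K1 = "inverse_stereographic -` (U \<union> S)" and ?K2 = "inverse_stereographic -` (S3 - U)"
  have "closed (U \<union> S)" "closed (S3 - U)"
    using closed_sides_of_sphere[OF props(1,2), of x] by (auto simp: U_def)
  then have clK: "closed ?K1" "closed ?K2"
    using closed_vimage[OF _ continuous_inverse_stereographic[of UNIV]] by blast+
  have UU: "U \<subseteq> S3 - S" unfolding U_def by (rule connected_component_subset)
  have unK: "?K1 \<union> ?K2 = UNIV" using inverse_stereographic_S3 by blast
  have "?K1 \<inter> ?K2 = inverse_stereographic -` S" using UU props(2) by auto
  then have borsK: "Borsukian (?K1 \<inter> ?K2)" using props(3) by simp
  have inK: "(\<gamma> i t, h i t) \<in> inverse_stereographic -` T \<longleftrightarrow> curve L i t \<in> T" if "i < n" for i t T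
    by (simp add: h[OF that])
  have LA: "(\<gamma> i t, h i t) \<in> ?K1" "(\<gamma> i t, h i t) \<notin> ?K2" if "i \<in> A" for i t
  proof -
    have "i < n" using that by (simp add: A_def)
    then show "(\<gamma> i t, h i t) \<in> ?K1" "(\<gamma> i t, h i t) \<notin> ?K2"
      using inA[OF that, of t] unfolding inK[OF \<open>i < n\<close>] by simp_all
  qed
  have LB: "(\<gamma> i t, h i t) \<notin> ?K1" "(\<gamma> i t, h i t) \<in> ?K2" if "i < n" "i \<notin> A" for i t
    using notA[OF that, of t] ranges(1)[OF that(1)] unfolding inK[OF that(1)] by blast+
  obtain i0 where i0: "i0 < n" and arc: "\<And>p q. (p, q) \<in> negative_crossings D \<Longrightarrow> fst p = i0"
  proof -
    obtain i a b where "i < n" and eq: "{p \<in> passages D. \<exists>u\<in>{a..b}. p = (i, frac u)} = fst ` negative_crossings D"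
      using succ unfolding successively_almost_positive_def by blast
    have "fst p = i" if "(p, q) \<in> negative_crossings D" for p q
    proof -
      have "p \<in> {p \<in> passages D. \<exists>u\<in>{a..b}. p = (i, frac u)}"
        using imageI[OF that, of fst] by (simp only: eq fst_conv)
      then show ?thesis by auto
    qed
    then show ?thesis using that[of i] \<open>i < n\<close> by blast
  qed
  have pos: "sgn (plane_det (vel D (b, t)) (vel D (a, s))) = 1"
    if "((b, t), (a, s)) \<in> crossings D" "b \<noteq> i0" for a b s t
  proof -
    have "((b, t), (a, s)) \<notin> negative_crossings D" using arc[of "(b, t)" "(a, s)"] that(2) by (metis fst_conv)
    then have "crossing_sign D ((b, t), (a, s)) = 1"
      using succ that(1) unfolding successively_almost_positive_def by blast
    then show ?thesis by (simp add: crossing_sign_def)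
  qed
  \<comment> \<open>The side of the sphere without the component \<open>i0\<close> of the overarc.
    Components in \<open>B\<close> have only positive overpassages, so
    \<open>linked_components\<close> applies to them, with the two closed sets exchanged according
    to the side.\<close>
  define B where "B = (if i0 \<in> A then {..<n} - A else A)"
  have B: "B \<subseteq> {..<n}" "i0 \<notin> B" using i0 by (auto simp: B_def A_def)
  have over: "fst q \<in> B" if cr: "(p, q) \<in> crossings D" "fst p \<in> B" for p q
  proof (rule ccontr)
    assume nq: "fst q \<notin> B"
    obtain b t a s where eq: "p = (b, t)" "q = (a, s)" by (cases p, cases q)
    have ab: "a < n" "b < n" using cr double_pairD[of b t a s] by (auto simp: eq crossings_def)
    have ne: "a \<noteq> b" "b \<noteq> i0" using nq cr(2) B by (auto simp: eq)
    have "((b, t), (a, s)) \<notin> crossings D"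
    proof (cases "i0 \<in> A")
      case True
      then have "a \<in> A" "b \<notin> A" using nq cr(2) ab by (auto simp: B_def eq)
      then show ?thesis
        using linked_components[OF ab ne(1) conth perh height clK unK borsK LA(1) LB(1)] ab pos ne(2) by blast
    next
      case False
      then have "a \<notin> A" "b \<in> A" using nq cr(2) ab by (auto simp: B_def eq)
      then show ?thesis
        using linked_components[OF ab ne(1) conth perh height clK(2,1) _ _ LB(2) LA(2)] ab pos ne(2) unK borsK
        by (metis Int_commute Un_commute)
    qed
    with cr(1) show False by (simp add: eq)
  qed
  have sep: "fst p \<in> B \<longleftrightarrow> fst q \<in> B" if "(p, q) \<in> crossings D" for p q
    using over[OF that] no_mixed_crossings[OF succ good B(1) _ that] over by blast
  have disj: "\<gamma> i s \<noteq> \<gamma> j t" if "i \<in> B" "j < n" "j \<notin> B" for i j s t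
  proof
    assume "\<gamma> i s = \<gamma> j t"
    then have "((i, frac s), (j, frac t)) \<in> crossings D \<or> ((j, frac t), (i, frac s)) \<in> crossings D"
      using that B(1) by (intro crossing_cases) auto
    with sep[of "(i, frac s)" "(j, frac t)"] sep[of "(j, frac t)" "(i, frac s)"] that show False by auto
  qed
  let ?P = "\<Union>i\<in>B. range (\<gamma> i)" and ?Q = "\<Union>i\<in>{..<n} - B. range (\<gamma> i)"
  have cl: "closed ?P" "closed ?Q" using B(1) range_closed finite_subset[OF B(1)] by (auto intro!: closed_UN)
  have tr: "trace D = ?P \<union> ?Q" using B(1) by (auto simp: trace_def)
  have "?P \<inter> ?Q = {}" using disj by fastforce
  then have inter: "?P \<inter> ?Q \<inter> trace D = {}" by simp
  have "B \<noteq> {}" "{..<n} - B \<noteq> {}" using ix iy i0 by (auto simp: B_def)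
  then have ne: "?P \<inter> trace D \<noteq> {}" "?Q \<inter> trace D \<noteq> {}" unfolding tr by auto
  show ?thesis
    unfolding split_diagram_def
  proof
    assume "connected (trace D)"
    from connected_closedD[OF this inter equalityD1[OF tr] cl] ne show False by argo
  qed
qed

end

section \<open>From a split diagram to a split link\<close>

lemma C1_differentiable_on_Pair:
  assumes "f C1_differentiable_on S" "g C1_differentiable_on S"
  shows "(\<lambda>t. (f t, g t)) C1_differentiable_on S"
proof -
  obtain F G where "\<forall>x\<in>S. (f has_vector_derivative F x) (at x)" "continuous_on S F"
    "\<forall>x\<in>S. (g has_vector_derivative G x) (at x)" "continuous_on S G"
    using assms unfolding C1_differentiable_on_def by blast
  then show ?thesis
    unfolding C1_differentiable_on_def
    by (intro exI[of _ "\<lambda>x. (F x, G x)"] conjI ballI has_vector_derivative_Pair continuous_on_Pair) auto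
qed

lemma C1_differentiable_on_inner:
  assumes "f C1_differentiable_on S" "g C1_differentiable_on S"
  shows "(\<lambda>t. f t \<bullet> g t) C1_differentiable_on S"
proof -
  obtain F G where FG: "\<forall>x\<in>S. (f has_vector_derivative F x) (at x)" "continuous_on S F"
    "\<forall>x\<in>S. (g has_vector_derivative G x) (at x)" "continuous_on S G"
    using assms unfolding C1_differentiable_on_def by blast
  have "continuous_on S f" "continuous_on S g"
    using assms C1_differentiable_imp_continuous_on by blast+
  then have "continuous_on S (\<lambda>x. f x \<bullet> G x + F x \<bullet> g x)" by (intro continuous_intros FG)
  then show ?thesis
    unfolding C1_differentiable_on_def
    by (intro exI[of _ "\<lambda>x. f x \<bullet> G x + F x \<bullet> g x"] conjI ballI
        bounded_bilinear.has_vector_derivative[OF bounded_bilinear_inner]) (use FG in auto)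
qed

lemma C1_differentiable_on_inverse:
  fixes f :: "real \<Rightarrow> real"
  assumes "f C1_differentiable_on S" "\<And>t. t \<in> S \<Longrightarrow> f t \<noteq> 0"
  shows "(\<lambda>t. inverse (f t)) C1_differentiable_on S"
proof -
  obtain F where F: "\<forall>x\<in>S. (f has_vector_derivative F x) (at x)" "continuous_on S F"
    using assms unfolding C1_differentiable_on_def by blast
  have "continuous_on S f" using assms(1) by (rule C1_differentiable_imp_continuous_on)
  then have cont: "continuous_on S (\<lambda>x. - (inverse (f x) * F x * inverse (f x)))"
    by (intro continuous_intros F) (use assms(2) in auto)
  have "((\<lambda>t. inverse (f t)) has_vector_derivative - (inverse (f x) * F x * inverse (f x))) (at x)"
    if "x \<in> S" for x
    using F(1) that assms(2)[OF that]
    by (auto simp flip: has_real_derivative_iff_has_vector_derivative intro!: DERIV_inverse')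
  with cont show ?thesis
    unfolding C1_differentiable_on_def
    by (intro exI[of _ "\<lambda>x. - (inverse (f x) * F x * inverse (f x))"] conjI ballI)
qed

lemma C1_inverse_stereographic:
  assumes "f C1_differentiable_on S"
  shows "(\<lambda>t. inverse_stereographic (f t)) C1_differentiable_on S"
proof -
  have eq: "inverse_stereographic x =
      ((2 * inverse (x \<bullet> x + 1)) *\<^sub>R x, (x \<bullet> x - 1) * inverse (x \<bullet> x + 1))" for x
    by (simp only: inverse_stereographic_def dot_square_norm divide_inverse)
  have "f t \<bullet> f t + 1 \<noteq> 0" for t unfolding dot_square_norm by (rule norm_sq_plus_1_neq_0)
  then show ?thesis
    unfolding eq
    by (intro C1_differentiable_on_Pair C1_differentiable_on_scaleR C1_differentiable_on_mult
        C1_differentiable_on_inverse C1_differentiable_on_add C1_differentiable_on_diff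
        C1_differentiable_on_inner C1_differentiable_on_const assms)
qed

text \<open>\<open>stereographic\<close> is a differentiable left inverse, so a vanishing velocity
  on the 3-sphere comes from a vanishing one below.\<close>

lemma immersed_inverse_stereographic:
  assumes "((\<lambda>t. inverse_stereographic (f t)) has_vector_derivative 0) (at t)"
  shows "(f has_vector_derivative 0) (at t)"
proof -
  define c where "c t = inverse_stereographic (f t)" for t
  have c: "(c has_vector_derivative 0) (at t)" using assms unfolding c_def .
  have "((\<lambda>t. fst (c t)) has_vector_derivative fst (0 :: (complex \<times> real) \<times> real)) (at t)"
    by (rule bounded_linear.has_vector_derivative[OF bounded_linear_fst c])
  moreover have "((\<lambda>t. snd (c t)) has_vector_derivative snd (0 :: (complex \<times> real) \<times> real)) (at t)"
    by (rule bounded_linear.has_vector_derivative[OF bounded_linear_snd c])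
  moreover have "1 - snd (c t) \<noteq> 0"
    unfolding c_def by (rule snd_S3_neq_1) (rule inverse_stereographic_S3)
  ultimately have "((\<lambda>t. (1 / (1 - snd (c t))) *\<^sub>R fst (c t)) has_vector_derivative 0) (at t)"
    by (auto intro!: derivative_eq_intros simp flip: has_real_derivative_iff_has_vector_derivative)
  moreover have "(\<lambda>t. (1 / (1 - snd (c t))) *\<^sub>R fst (c t)) = f"
    unfolding c_def by (simp only: stereographic_inverse flip: stereographic_def)
  ultimately show ?thesis by simp
qed

text \<open>The product of the squares of \<open>sin (pi * (t - s))\<close> over \<open>s\<close> in
  \<open>T\<close>; squaring turns the period 2 of the sine factor into 1. As a height it vanishes
  at underpassages and is positive at overpassages.\<close>

lemma periodic_bump:
  assumes "finite T" "T \<subseteq> {0..<1::real}"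
  obtains g :: "real \<Rightarrow> real" where "g C1_differentiable_on UNIV" "\<And>t. g (t + 1) = g t"
    "\<And>t. 0 \<le> g t" "\<And>t. g t \<le> 1" "\<And>t. t \<in> {0..<1} \<Longrightarrow> g t = 0 \<longleftrightarrow> t \<in> T"
proof
  define g where "g t = (\<Prod>s\<in>T. (sin (pi * (t - s)))\<^sup>2)" for t
  have "(\<lambda>t. sin (pi * (t - s))) C1_differentiable_on UNIV" for s
    unfolding C1_differentiable_on_def
    by (intro exI[of _ "\<lambda>t. pi * cos (pi * (t - s))"])
      (auto intro!: derivative_eq_intros continuous_intros simp flip: has_real_derivative_iff_has_vector_derivative)
  note sin_C1 = this
  show "g C1_differentiable_on UNIV"
    using assms(1) unfolding g_def power2_eq_square
    by (induction rule: finite_induct) (simp_all add: C1_differentiable_on_mult sin_C1)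
  show "g (t + 1) = g t" for t
  proof -
    have "sin (pi * (t + 1 - s)) = - sin (pi * (t - s))" for s
      using sin_periodic_pi[of "pi * (t - s)"] by (simp add: algebra_simps)
    then show ?thesis by (simp add: g_def)
  qed
  show "0 \<le> g t" for t by (simp add: g_def prod_nonneg)
  show "g t \<le> 1" for t
    unfolding g_def by (intro prod_le_1) (simp add: abs_square_le_1)
  show "g t = 0 \<longleftrightarrow> t \<in> T" if "t \<in> {0..<1}" for t
  proof -
    have "sin (pi * (t - s)) = 0 \<longleftrightarrow> t = s" if "s \<in> T" for s
    proof
      assume "sin (pi * (t - s)) = 0"
      then obtain m :: int where "pi * (t - s) = of_int m * pi" unfolding sin_zero_iff_int2 by blast
      then have "t - s = of_int m" by (simp add: mult.commute)
      moreover have "\<bar>t - s\<bar> < 1" using that \<open>t \<in> {0..<1}\<close> assms(2) by (auto simp: abs_less_iff)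
      ultimately have "m = 0" by simp
      with \<open>t - s = of_int m\<close> show "t = s" by simp
    qed simp
    then show ?thesis using assms(1) by (auto simp: g_def)
  qed
qed

lemma tame_equator: "tame_2sphere {x \<in> S3. snd (fst x) = 0}"
proof -
  \<comment> \<open>The bicollar consists of the parallel 2-spheres at height
    \<open>\<tau> / 2\<close>, of radius \<open>r \<tau>\<close>. Halving keeps the radius positive
    for \<open>\<tau>\<close> up to 1 in modulus.\<close>
  define r :: "real \<Rightarrow> real" where "r \<tau> = sqrt (1 - (\<tau> / 2)\<^sup>2)" for \<tau>
  define e where "e x = ((r (snd x) *\<^sub>R fst (fst x), snd x / 2), r (snd x) * snd (fst x))"
    for x :: "(complex \<times> real) \<times> real"
  let ?B = "sphere (0 :: complex \<times> real) 1 \<times> {-1..1::real}"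
  have le: "(\<tau> / 2)\<^sup>2 < 1" if "\<tau> \<in> {-1..1}" for \<tau> :: real
    using that by (auto simp: abs_square_less_1 abs_less_iff)
  have r: "r \<tau> > 0" "(r \<tau>)\<^sup>2 = 1 - (\<tau> / 2)\<^sup>2" if "\<tau> \<in> {-1..1}" for \<tau>
    using le[OF that] by (simp_all add: r_def)
  have norm_eq: "norm y = 1 \<longleftrightarrow> (norm (fst y))\<^sup>2 + (snd y)\<^sup>2 = 1" for y :: "complex \<times> real"
    by (simp add: norm_prod_def)
  have "continuous_on ?B e" unfolding e_def r_def by (intro continuous_intros) auto
  moreover have "inj_on e ?B"
  proof (rule inj_onI)
    fix x y assume xy: "x \<in> ?B" "y \<in> ?B" "e x = e y"
    then have s: "snd x = snd y" by (simp add: e_def)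
    have "r (snd y) \<noteq> 0" using r(1)[of "snd y"] xy(2) by fastforce
    with xy(3) s show "x = y" by (simp add: e_def prod_eq_iff)
  qed
  moreover have "e ` ?B \<subseteq> S3"
  proof (rule image_subsetI)
    fix x assume "x \<in> ?B"
    then have x: "norm (fst x) = 1" "snd x \<in> {-1..1}" by auto
    have "(norm (fst (e x)))\<^sup>2 + (snd (e x))\<^sup>2
        = (r (snd x))\<^sup>2 * ((norm (fst (fst x)))\<^sup>2 + (snd (fst x))\<^sup>2) + (snd x / 2)\<^sup>2"
      by (simp add: e_def norm_prod_def power_mult_distrib power_divide distrib_left)
    also have "\<dots> = 1" using x(1) r(2)[OF x(2)] unfolding norm_eq by simp
    finally show "e x \<in> S3" by (simp add: S3_iff)
  qed
  moreover have "{x \<in> S3. snd (fst x) = 0} = e ` (sphere 0 1 \<times> {0})"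
  proof (intro set_eqI iffI)
    fix x :: "(complex \<times> real) \<times> real" assume x: "x \<in> {x \<in> S3. snd (fst x) = 0}"
    then have "norm (fst (fst x), snd x) = 1" unfolding norm_eq by (auto simp: S3_iff norm_prod_def)
    moreover have "x = e ((fst (fst x), snd x), 0)" using x by (simp add: e_def r_def prod_eq_iff)
    ultimately show "x \<in> e ` (sphere 0 1 \<times> {0})" by (metis SigmaI dist_0_norm image_eqI mem_sphere singletonI)
  next
    fix x assume "x \<in> e ` (sphere 0 1 \<times> {0})"
    then obtain y where "norm y = 1" "x = e (y, 0)" by auto
    then show "x \<in> {x \<in> S3. snd (fst x) = 0}"
      unfolding norm_eq by (simp add: S3_iff norm_prod_def e_def r_def)
  qed
  ultimately show ?thesis unfolding tame_2sphere_def by blast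
qed

text \<open>A connected set on which the height changes sign meets the equator, by the intermediate
  value property.\<close>

lemma split_link_equator:
  assumes L: "\<And>z. z \<in> trace L \<Longrightarrow> snd (fst z) \<noteq> 0"
    and x: "x \<in> trace L" "snd (fst x) > 0" and y: "y \<in> trace L" "snd (fst y) < 0"
  shows "split_link L"
proof -
  let ?S = "{x \<in> S3. snd (fst x) = 0}"
  have "\<not> connected_component (S3 - ?S) x y"
  proof
    assume "connected_component (S3 - ?S) x y"
    then obtain T where T: "connected T" "T \<subseteq> S3 - ?S" "x \<in> T" "y \<in> T"
      unfolding connected_component_def by blast
    have conn: "connected ((\<lambda>z. snd (fst z)) ` T)"
      by (intro connected_continuous_image T continuous_intros)
    have mem: "snd (fst y) \<in> (\<lambda>z. snd (fst z)) ` T" "snd (fst x) \<in> (\<lambda>z. snd (fst z)) ` T" using T by auto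
    have "0 \<in> (\<lambda>z. snd (fst z)) ` T"
      using connectedD_interval[OF conn mem less_imp_le[OF y(2)] less_imp_le[OF x(2)]] .
    with T(2) show False by force
  qed
  moreover have "?S \<inter> trace L = {}" using L by blast
  ultimately show ?thesis unfolding split_link_def using tame_equator x(1) y(1) by blast
qed

context diagram
begin

text \<open>Any periodic smooth height works: the velocity is already nonzero in the projection, and
  coincidences in the projection are double points, where the heights differ.\<close>

lemma represents_lift:
  assumes C1h: "\<And>i. i < n \<Longrightarrow> h i C1_differentiable_on UNIV" and per_h: "\<And>i t. i < n \<Longrightarrow> h i (t + 1) = h i t"
    and height: "\<And>i s j t. ((i, s), (j, t)) \<in> crossings D \<Longrightarrow> h i s > h j t"
  shows "represents D \<lparr>ncomps = n, curve = \<lambda>i t. inverse_stereographic (\<gamma> i t, h i t)\<rparr>" (is "represents D ?L")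
proof -
  have "immersed_curves ?L"
    unfolding immersed_curves_def
  proof (intro allI impI conjI)
    fix i assume "i < ncomps ?L"
    then have i: "i < n" by simp
    show C1L: "curve ?L i C1_differentiable_on UNIV"
      by (simp add: C1_inverse_stereographic C1_differentiable_on_Pair C1 C1h i)
    show "curve ?L i (t + 1) = curve ?L i t" for t by (simp add: per per_h i)
    show "vector_derivative (curve ?L i) (at t) \<noteq> 0" for t
    proof
      assume "vector_derivative (curve ?L i) (at t) = 0"
      then have "((\<lambda>t. inverse_stereographic (\<gamma> i t, h i t)) has_vector_derivative 0) (at t)"
        using C1_has_vector_derivative[OF C1L, of t] by simp
      from bounded_linear.has_vector_derivative[OF bounded_linear_fst immersed_inverse_stereographic[OF this]]
      have "V i t = 0" by (simp add: vector_derivative_at)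
      with V_nz[OF i] show False by simp
    qed
  qed
  moreover have "trace ?L \<subseteq> S3" using inverse_stereographic_S3 by (auto simp: trace_def)
  moreover have "inj_on (pos ?L) (params ?L)"
  proof (rule inj_onI, rule ccontr)
    fix p q assume pq: "p \<in> params ?L" "q \<in> params ?L" "pos ?L p = pos ?L q" "p \<noteq> q"
    obtain i s j t where eq: "p = (i, s)" "q = (j, t)" by (cases p, cases q)
    have heq: "\<gamma> i s = \<gamma> j t" "h i s = h j t"
      using pq(3) by (simp_all add: eq pos_def inj_inverse_stereographic)
    have "double_pair D p q" using pq heq(1) by (simp add: double_pair_def params_def pos_def eq)
    then have "(p, q) \<in> crossings D \<or> (q, p) \<in> crossings D"
      using double_sym double_overs by (auto simp: crossings_def)
    then show False using height heq(2) unfolding eq by force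
  qed
  ultimately have "oriented_link ?L" by (simp add: oriented_link_def)
  then show ?thesis unfolding represents_def using height by (intro conjI exI[of _ h]) auto
qed

lemma split_diagram_imp_split_link:
  assumes "split_diagram D"
  shows "\<exists>L. represents D L \<and> split_link L"
proof -
  obtain E1 E2 where E: "closed E1" "closed E2" "trace D \<subseteq> E1 \<union> E2" "E1 \<inter> E2 \<inter> trace D = {}"
    "E1 \<inter> trace D \<noteq> {}" "E2 \<inter> trace D \<noteq> {}"
    using assms unfolding split_diagram_def connected_closed not_not by (elim exE conjE) (rule that)
  define A where "A = {i. i < n \<and> range (\<gamma> i) \<subseteq> E1}"
  have in_A: "\<gamma> i t \<in> E1" if "i \<in> A" for i t using that by (auto simp: A_def)
  \<comment> \<open>Each component is connected, so it lies entirely in one of the two closed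
    sets.\<close>
  have notin_A: "\<gamma> i t \<in> E2" if "i < n" "i \<notin> A" for i t
  proof -
    have sub: "range (\<gamma> i) \<subseteq> trace D" using that(1) by (auto simp: trace_def)
    have "connected (range (\<gamma> i))"
      by (rule connected_continuous_image[OF continuous_\<gamma>[OF that(1)] connected_UNIV])
    then have "E1 \<inter> range (\<gamma> i) = {} \<or> E2 \<inter> range (\<gamma> i) = {}"
      by (rule connected_closedD) (use sub E in auto)
    moreover have "\<not> range (\<gamma> i) \<subseteq> E1" using that by (simp add: A_def)
    ultimately show ?thesis using sub E(3) by blast
  qed
  define und where "und i = {t. (i, t) \<in> passages D - overs D}" for i
  define bump where "bump i g \<longleftrightarrow> g C1_differentiable_on UNIV \<and> (\<forall>t. g (t + 1) = g t) \<and> (\<forall>t. 0 \<le> g t) \<and>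
      (\<forall>t. g t \<le> 1) \<and> (\<forall>t\<in>{0..<1}. g t = 0 \<longleftrightarrow> t \<in> und i)" for i and g :: "real \<Rightarrow> real"
  have "\<exists>g. bump i g" for i
  proof -
    have "finite (und i)"
      by (rule finite_subset[OF _ finite_imageI[OF finite_passages, of snd]]) (force simp: und_def)
    moreover have "und i \<subseteq> {0..<1}" using passages_params by (auto simp: und_def params_def)
    ultimately show ?thesis
      by (rule periodic_bump) (rule exI, unfold bump_def, intro conjI allI ballI)
  qed
  then have "\<forall>i. \<exists>g. bump i g" ..
  then obtain g where "\<forall>i. bump i (g i)" by (rule choice[THEN exE])
  then have g: "\<And>i. g i C1_differentiable_on UNIV" "\<And>i t. g i (t + 1) = g i t"
    "\<And>i t. 0 \<le> g i t" "\<And>i t. g i t \<le> 1" "\<And>i t. t \<in> {0..<1} \<Longrightarrow> g i t = 0 \<longleftrightarrow> t \<in> und i"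
    by (simp_all add: bump_def)
  \<comment> \<open>The bump has values between 0 and 1, so heights lie in \<open>[1, 2]\<close> for
    \<open>A\<close> and in \<open>[-2, -1]\<close> otherwise. At a crossing both strands have the
    same offset, and the bump alone decides: zero below, positive above.\<close>
  define h where "h i t = (if i \<in> A then 1 else -2) + g i t" for i t
  have height: "h i s > h j t" if "((i, s), (j, t)) \<in> crossings D" for i s j t
  proof -
    have d: "double_pair D (i, s) (j, t)" and o: "(i, s) \<in> overs D" using that by (auto simp: crossings_def)
    note d' = double_pairD[OF d]
    have "i \<in> A \<longleftrightarrow> j \<in> A"
      using in_A[of i s] in_A[of j t] notin_A[of i s] notin_A[of j t] d'(1,2,5) E(4)
        mem_trace_iff[of "\<gamma> i s"] by (metis IntI empty_iff)
    moreover have "(j, t) \<in> passages D" using double_sym[OF d] by (auto simp: passages_def)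
    then have "t \<in> und j" using double_overs[OF d] o by (simp add: und_def)
    then have "g j t = 0" using g(5) d'(8,9) by simp
    moreover have "s \<notin> und i" using o by (simp add: und_def)
    then have "g i s \<noteq> 0" using g(5) d'(6,7) by simp
    then have "g i s > 0" using g(3)[of i s] by simp
    ultimately show ?thesis by (simp add: h_def)
  qed
  define L where "L = \<lparr>ncomps = n, curve = \<lambda>i t. inverse_stereographic (\<gamma> i t, h i t)\<rparr>"
  have "represents D L"
    unfolding L_def
  proof (rule represents_lift)
    show "h i C1_differentiable_on UNIV" for i
      unfolding h_def by (intro C1_differentiable_on_add C1_differentiable_on_const g(1))
    show "h i (t + 1) = h i t" for i t by (simp add: h_def g(2))
  qed (rule height)
  moreover have "split_link L"
  proof -
    have snd_eq: "snd (fst (inverse_stereographic (z, r))) = 2 / ((norm (z, r))\<^sup>2 + 1) * r" for z r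
      by (simp add: inverse_stereographic_def)
    have pos: "2 / ((norm x)\<^sup>2 + 1) > 0" for x :: "complex \<times> real"
      using zero_le_power2[of "norm x"] by (intro divide_pos_pos) linarith+
    have hpos: "h i t > 0" if "i \<in> A" for i t using g(3)[of i t] that by (simp add: h_def)
    have hneg: "h i t < 0" if "i \<notin> A" for i t using g(4)[of i t] that by (simp add: h_def)
    have mem: "curve L i t \<in> trace L" if "i < n" for i t using that by (auto simp: trace_def L_def)
    have curve: "snd (fst (curve L i t)) = 2 / ((norm (\<gamma> i t, h i t))\<^sup>2 + 1) * h i t" for i t
      unfolding L_def by (simp only: closed_curves.select_convs snd_eq)
    obtain i0 j0 where ij: "i0 < n" "i0 \<in> A" "j0 < n" "j0 \<notin> A"
      using E(4-6) in_A notin_A unfolding disjoint_iff mem_trace_iff by (metis IntE IntI mem_trace_iff)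
    show ?thesis
    proof (rule split_link_equator)
      fix z assume "z \<in> trace L"
      then obtain i t where z: "z = curve L i t" by (auto simp: trace_def)
      have "h i t \<noteq> 0" using hpos[of i t] hneg[of i t] by fastforce
      then show "snd (fst z) \<noteq> 0" using pos[of "(\<gamma> i t, h i t)"] unfolding z curve by simp
    next
      show "curve L i0 0 \<in> trace L" "curve L j0 0 \<in> trace L" using mem ij by auto
      show "snd (fst (curve L i0 0)) > 0" unfolding curve by (intro mult_pos_pos pos hpos ij)
      show "snd (fst (curve L j0 0)) < 0" unfolding curve by (intro mult_pos_neg pos hneg ij)
    qed
  qed
  ultimately show ?thesis by blast
qed

end

theorem theorem1p5:
  fixes D :: link_diagram and k :: nat
  assumes "is_link_diagram D"
    and "successively_almost_positive k D"
    and "good_diagram D"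
  shows "(\<exists>L. represents D L \<and> split_link L) \<longleftrightarrow> split_diagram D"
proof -
  interpret diagram D by unfold_locales (rule assms(1))
  show ?thesis
    using split_link_imp_split_diagram[OF assms(2,3)] split_diagram_imp_split_link by blast
qed

end
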